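(* Let $f$ be a piecewise affine expanding Markov map of $I=[0,1]$ (as defined in the context). Let $k\in\{0,1,2,\dots\}$ and $r\in\{1,2,\dots\}$. There exists a projector $\Pi_{k,r}:W_r\to\mathfrak P_r(\mathcal I)\subset W_r$ such that the spectral radius of $\mathcal L_k(\mathbf 1-\Pi_{k,r})$ on $W_r$ (where $\mathbf 1$ is the identity operator) is not greater than $\lambda^{-(k+r-1)}$. Moreover $$\sigma\big(\mathcal L_k|_{\mathfrak P_r(\mathcal I)}\big)=\bigcup_{l=0}^r\sigma(B_{k+l}),$$ and the multiplicity of each eigenvalue $\xi\in\sigma(\mathcal L_k|_{\mathfrak P_r(\mathcal I)})$ is equal to the sum of the multiplicities of $\xi$ as an eigenvalue of $B_{k+l}$, $l\in\{0,\dots,r\}$.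
   Context: Let $I=[0,1]$. A map $f:I\to I$ is a piecewise affine expanding Markov map if there is a collection of disjoint open intervals $\{I_j\}_{j=1}^N$ forming a partition of a full measure subset of $I$ such that for all $i,j$ either $f(I_i)\cap I_j=\emptyset$ or $I_j\subseteq f(I_i)$; $f'$ is constant on each $I_i$ (so $f$ is affine on each $I_i$); and $f'>1$ on $\bigcup_i I_i$. Put $\mathcal I=\bigcup_i I_i$, $\lambda_j=f'|_{I_j}$ and $\lambda=\min_j\lambda_j>1$. The adjacency matrix is $A[i,j]=1$ if $I_j\subseteq f(I_i)$ and $A[i,j]=0$ otherwise, and $B_k[i,j]=\lambda_j^{-k}A[j,i]$ for $k\ge 0$ ($N\times N$ matrices). $\sigma$ denotes spectrum. $W_r=W^{r,1}(\mathcal I)$ is the Banach space of $h\in L^1(I)$ whose restriction to each $I_i$ is in the Sobolev space $W^{r,1}(I_i)$, with norm $\|h\|_r=\sum_{l=0}^r\int_{\mathcal I}|h^{(l)}(x)|\,dx$, where $h^{(l)}$ is the $l$-th weak derivative of $h$ restricted to $\mathcal I$. Let $g_j=(f|_{I_j})^{-1}:f(I_j)\to I_j$. The transfer operator $\mathcal L_k:W_r\to W_r$ is, for $x\in I_i$, $$\mathcal L_kh(x)=\sum_{y\in f^{-1}(x)}\frac{h(y)}{[f'(y)]^k}=\sum_jB_k[i,j]\,h\circ g_j(x)$$ (terms not defined at $x$ are taken to be zero). $\mathfrak P_r(\mathcal I)$ is the space of functions which on each $I_j$ are polynomials of degree at most $r$; it is invariant under $\mathcal L_k$. *)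

theory Defs
  imports "HOL-Analysis.Analysis" "Jordan_Normal_Form.Spectral_Radius"
begin

section \<open>The space of integrable functions on the unit interval\<close>

text \<open>
  Complex-valued Lebesgue integrable functions on \<open>[0,1]\<close>, modulo equality almost everywhere.
  Scalars are complex throughout because spectra and multiplicities are taken over the complex
  numbers. Only the values on \<open>[0,1]\<close> of a representative matter.
\<close>

abbreviation unit_leb :: "real measure" where
  "unit_leb \<equiv> lebesgue_on {0..1}"

definition L1_eq :: "(real \<Rightarrow> complex) \<Rightarrow> (real \<Rightarrow> complex) \<Rightarrow> bool" where
  "L1_eq u v \<longleftrightarrow> integrable unit_leb u \<and> integrable unit_leb v \<and> (AE x in unit_leb. u x = v x)"

quotient_type L1 = "real \<Rightarrow> complex" / partial: L1_eq
proof (rule part_equivpI)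
  show "\<exists>u. L1_eq u u"
    by (rule exI[of _ "\<lambda>_. 0"]) (simp add: L1_eq_def)
  show "symp L1_eq"
    by (auto simp: L1_eq_def intro!: sympI)
  show "transp L1_eq"
    by (auto simp: L1_eq_def intro!: transpI)
qed

instantiation L1 :: ab_group_add
begin

lift_definition zero_L1 :: L1 is "\<lambda>_. 0"
  by (simp add: L1_eq_def)

lift_definition plus_L1 :: "L1 \<Rightarrow> L1 \<Rightarrow> L1" is "\<lambda>u v x. u x + v x"
  by (auto simp: L1_eq_def)

lift_definition uminus_L1 :: "L1 \<Rightarrow> L1" is "\<lambda>u x. - u x"
  by (auto simp: L1_eq_def)

lift_definition minus_L1 :: "L1 \<Rightarrow> L1 \<Rightarrow> L1" is "\<lambda>u v x. u x - v x"
  by (auto simp: L1_eq_def)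

instance
  by (standard; transfer) (auto simp: L1_eq_def)

end

lift_definition scale_L1 :: "complex \<Rightarrow> L1 \<Rightarrow> L1" is "\<lambda>c u x. c * u x"
  by (auto simp: L1_eq_def)

interpretation L1: vector_space scale_L1
  by (standard; transfer) (auto simp: L1_eq_def algebra_simps)

lemma integrable_rep_L1: "integrable unit_leb (rep_L1 h)"
  using Quotient3_rep_reflp[OF Quotient3_L1, of h] by (simp add: L1_eq_def)

lemma AE_rep_abs_L1:
  assumes "integrable unit_leb u"
  shows "AE x in unit_leb. rep_L1 (abs_L1 u) x = u x"
proof -
  have "L1_eq u u"
    using assms by (simp add: L1_eq_def)
  then have "L1_eq (rep_L1 (abs_L1 u)) u"
    using rep_abs_rsp_left[OF Quotient3_L1] by blast
  then show ?thesis
    by (simp add: L1_eq_def)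
qed


section \<open>Bounded operators on a normed subspace\<close>

text \<open>
  A normed space is given by a subspace \<open>V\<close> of \<open>L1\<close> and a norm \<open>nrm\<close> on it. Operators
  are total functions on \<open>L1\<close> of which only the restriction to \<open>V\<close> is relevant.
\<close>

definition bounded_op_on :: "L1 set \<Rightarrow> (L1 \<Rightarrow> real) \<Rightarrow> (L1 \<Rightarrow> L1) \<Rightarrow> bool" where
  "bounded_op_on V nrm T \<longleftrightarrow>
     (\<forall>h\<in>V. T h \<in> V) \<and>
     (\<forall>h\<in>V. \<forall>h'\<in>V. T (h + h') = T h + T h') \<and>
     (\<forall>c. \<forall>h\<in>V. T (scale_L1 c h) = scale_L1 c (T h)) \<and>
     (\<exists>C. \<forall>h\<in>V. nrm (T h) \<le> C * nrm h)"

definition op_resolvent_set :: "L1 set \<Rightarrow> (L1 \<Rightarrow> real) \<Rightarrow> (L1 \<Rightarrow> L1) \<Rightarrow> complex set" where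
  "op_resolvent_set V nrm T =
     {\<xi>. \<exists>S. bounded_op_on V nrm S \<and>
         (\<forall>h\<in>V. S (scale_L1 \<xi> h - T h) = h \<and> scale_L1 \<xi> (S h) - T (S h) = h)}"

definition op_spectrum :: "L1 set \<Rightarrow> (L1 \<Rightarrow> real) \<Rightarrow> (L1 \<Rightarrow> L1) \<Rightarrow> complex set" where
  "op_spectrum V nrm T = - op_resolvent_set V nrm T"

text \<open>Extended reals, so that the supremum of an unbounded set would be infinite.\<close>

definition op_spectral_radius :: "L1 set \<Rightarrow> (L1 \<Rightarrow> real) \<Rightarrow> (L1 \<Rightarrow> L1) \<Rightarrow> ereal" where
  "op_spectral_radius V nrm T = (SUP \<xi>\<in>op_spectrum V nrm T. ereal (cmod \<xi>))"

text \<open>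
  Algebraic multiplicity: the dimension of the generalized eigenspace.
\<close>

definition op_multiplicity :: "L1 set \<Rightarrow> (L1 \<Rightarrow> L1) \<Rightarrow> complex \<Rightarrow> nat" where
  "op_multiplicity V T \<xi> =
     L1.dim {h \<in> V. \<exists>n. ((\<lambda>u. scale_L1 \<xi> u - T u) ^^ n) h = 0}"

definition projector_onto :: "L1 set \<Rightarrow> (L1 \<Rightarrow> real) \<Rightarrow> L1 set \<Rightarrow> (L1 \<Rightarrow> L1) \<Rightarrow> bool" where
  "projector_onto V nrm U P \<longleftrightarrow>
     bounded_op_on V nrm P \<and> (\<forall>h\<in>V. P (P h) = P h) \<and> P ` V = U"


section \<open>Piecewise affine expanding Markov maps\<close>

text \<open>
  The intervals of the partition are \<open>J 0, \<dots>, J (N - 1)\<close>; the values of \<open>J\<close> at other indices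
  are irrelevant.
\<close>

definition pa_expanding_markov :: "(real \<Rightarrow> real) \<Rightarrow> nat \<Rightarrow> (nat \<Rightarrow> real set) \<Rightarrow> bool" where
  "pa_expanding_markov f N J \<longleftrightarrow>
     f ` {0..1} \<subseteq> {0..1} \<and>
     (\<forall>j<N. \<exists>a b. a < b \<and> J j = {a<..<b} \<and> J j \<subseteq> {0..1}) \<and>
     disjoint_family_on J {..<N} \<and>
     negligible ({0..1} - (\<Union>j<N. J j)) \<and>
     (\<forall>i<N. \<forall>j<N. f ` J i \<inter> J j = {} \<or> J j \<subseteq> f ` J i) \<and>
     (\<forall>j<N. \<exists>c>1. \<forall>x\<in>J j. (f has_real_derivative c) (at x))"

definition slope :: "(real \<Rightarrow> real) \<Rightarrow> (nat \<Rightarrow> real set) \<Rightarrow> nat \<Rightarrow> real" where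
  "slope f J j = (THE c. \<forall>x\<in>J j. (f has_real_derivative c) (at x))"

definition min_slope :: "(real \<Rightarrow> real) \<Rightarrow> nat \<Rightarrow> (nat \<Rightarrow> real set) \<Rightarrow> real" where
  "min_slope f N J = Min (slope f J ` {..<N})"

definition adjacency :: "(real \<Rightarrow> real) \<Rightarrow> nat \<Rightarrow> (nat \<Rightarrow> real set) \<Rightarrow> complex mat" where
  "adjacency f N J = Matrix.mat N N (\<lambda>(i, j). if J j \<subseteq> f ` J i then 1 else 0)"

definition weighted_adjacency ::
    "(real \<Rightarrow> real) \<Rightarrow> nat \<Rightarrow> (nat \<Rightarrow> real set) \<Rightarrow> nat \<Rightarrow> complex mat" where
  "weighted_adjacency f N J k =
     Matrix.mat N N (\<lambda>(i, j). adjacency f N J $$ (j, i) / of_real (slope f J j) ^ k)"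


section \<open>The Sobolev spaces\<close>

definition test_function :: "real set \<Rightarrow> (real \<Rightarrow> real) \<Rightarrow> bool" where
  "test_function U \<phi> \<longleftrightarrow>
     (\<forall>n x. (deriv ^^ n) \<phi> field_differentiable at x) \<and>
     compact (closure {x. \<phi> x \<noteq> 0}) \<and> closure {x. \<phi> x \<noteq> 0} \<subseteq> U"

text \<open>
  \<open>g\<close> is, on each interval \<open>J j\<close> separately, the \<open>l\<close>-th weak derivative of \<open>h\<close>. Since the
  intervals cover \<open>[0,1]\<close> up to a null set, this determines \<open>g\<close> as an element of \<open>L1\<close>.
\<close>

definition has_weak_deriv :: "nat \<Rightarrow> (nat \<Rightarrow> real set) \<Rightarrow> nat \<Rightarrow> L1 \<Rightarrow> L1 \<Rightarrow> bool" where
  "has_weak_deriv N J l h g \<longleftrightarrow>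
     (\<forall>j<N. \<forall>\<phi>. test_function (J j) \<phi> \<longrightarrow>
        (\<integral>x. rep_L1 h x * of_real ((deriv ^^ l) \<phi> x) \<partial>lebesgue_on (J j)) =
        (- 1) ^ l * (\<integral>x. rep_L1 g x * of_real (\<phi> x) \<partial>lebesgue_on (J j)))"

definition weak_deriv :: "nat \<Rightarrow> (nat \<Rightarrow> real set) \<Rightarrow> nat \<Rightarrow> L1 \<Rightarrow> L1" where
  "weak_deriv N J l h = (THE g. has_weak_deriv N J l h g)"

definition sobolev :: "nat \<Rightarrow> (nat \<Rightarrow> real set) \<Rightarrow> nat \<Rightarrow> L1 set" where
  "sobolev N J r = {h. \<forall>l\<le>r. \<exists>g. has_weak_deriv N J l h g}"

definition sobolev_norm :: "nat \<Rightarrow> (nat \<Rightarrow> real set) \<Rightarrow> nat \<Rightarrow> L1 \<Rightarrow> real" where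
  "sobolev_norm N J r h =
     (\<Sum>l\<le>r. \<integral>x. cmod (rep_L1 (weak_deriv N J l h) x) \<partial>lebesgue_on (\<Union>j<N. J j))"

definition piecewise_poly :: "nat \<Rightarrow> (nat \<Rightarrow> real set) \<Rightarrow> nat \<Rightarrow> L1 set" where
  "piecewise_poly N J r =
     {h. \<forall>j<N. \<exists>p :: complex poly. Polynomial.degree p \<le> r \<and>
           (AE x in lebesgue_on (J j). rep_L1 h x = poly p (of_real x))}"


section \<open>The transfer operators\<close>

text \<open>
  Only preimages in the union of the intervals contribute, where \<open>deriv f\<close> is defined; there are
  finitely many of them because \<open>f\<close> is injective on each \<open>J j\<close>. For the maps considered here the
  sum respects equality almost everywhere, so the choice of the representative is immaterial.
\<close>

definition transfer_op ::
    "(real \<Rightarrow> real) \<Rightarrow> nat \<Rightarrow> (nat \<Rightarrow> real set) \<Rightarrow> nat \<Rightarrow> L1 \<Rightarrow> L1" where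
  "transfer_op f N J k h =
     abs_L1 (\<lambda>x. \<Sum>y | y \<in> (\<Union>j<N. J j) \<and> f y = x. rep_L1 h y / of_real (deriv f y) ^ k)"

end

theory Submission
  imports Defs
begin

text \<open>
The weak derivative turns smoothness into contraction. On an interval of the partition the operator
\<open>L\<^sub>k\<close> is a finite sum of compositions with affine contractions \<open>g\<^sub>j\<close> of slope \<open>1 / \<lambda>\<^sub>j\<close>, weighted by
\<open>\<lambda>\<^sub>j\<close> to the power \<open>- k\<close>. Differentiating \<open>h \<circ> g\<^sub>j\<close> produces one more factor \<open>1 / \<lambda>\<^sub>j\<close>, hence
\<open>D\<^sup>l L\<^sub>k = L\<^sub>k\<^sub>+\<^sub>l D\<^sup>l\<close> (lemma \<open>transfer_has_weak_deriv\<close>), while the change of variables \<open>x = f y\<close> shows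
that \<open>L\<^sub>m\<close> has norm at most \<open>\<lambda>\<close> to the power \<open>1 - m\<close> on \<open>L\<^sup>1\<close>, for \<open>m \<ge> 1\<close> (lemma \<open>norm_transfer_Suc_le\<close>).

Spectral radius. Since the piecewise polynomials are invariant, the nonzero spectrum of
\<open>L\<^sub>k (1 - \<Pi>)\<close> is that of \<open>L\<^sub>k\<close> on the quotient of \<open>W\<^sub>r\<close> by the piecewise polynomials of degree at
most \<open>r\<close>. Under \<open>D\<^sup>r\<close> this quotient becomes the quotient of \<open>L\<^sup>1\<close> by the piecewise constant functions,
and \<open>L\<^sub>k\<close> becomes \<open>L\<^sub>k\<^sub>+\<^sub>r\<close>, whose powers decay at least as fast as those of \<open>\<lambda>\<close> to the power \<open>1 - k - r\<close>. To make
the quotients concrete, let \<open>E\<close> be \<open>r\<close>-fold integration from the left end of each interval, so that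
\<open>D\<^sup>r E = 1\<close>, and let \<open>Q\<close> replace a function by its mean on each interval. The projector is
\<open>\<Pi> = 1 - E (1 - Q) D\<^sup>r\<close>. With \<open>R\<close> the resolvent of \<open>L\<^sub>k\<^sub>+\<^sub>r\<close> on \<open>L\<^sup>1\<close> at \<open>\<xi>\<close>, obtained from Banach's fixed
point theorem, the resolvent of \<open>L\<^sub>k (1 - \<Pi>)\<close> is \<open>(1 + L\<^sub>k E (1 - Q) R D\<^sup>r) / \<xi>\<close>
(lemma \<open>resolvent_off_disc\<close>).

Spectrum on the piecewise polynomials. The map \<open>D\<close> sends the piecewise polynomials of degree at most
\<open>r + 1\<close> onto those of degree at most \<open>r\<close>, its kernel consists of the piecewise constants, and it
intertwines \<open>L\<^sub>k\<close> with \<open>L\<^sub>k\<^sub>+\<^sub>1\<close>. On the piecewise constants \<open>L\<^sub>m\<close> is the matrix \<open>B\<^sub>m\<close>, which is triangular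
in a suitable basis. By induction \<open>L\<^sub>k\<close> is triangular on the piecewise polynomials, with the diagonals
of \<open>B\<^sub>k\<close>, ..., \<open>B\<^sub>k\<^sub>+\<^sub>r\<close> put together (lemma \<open>triangular_flag_piecewise_poly\<close>). Spectrum and
multiplicities are read off from the diagonal of a triangular operator
(lemmas \<open>op_spectrum_triangular_flag\<close> and \<open>op_multiplicity_triangular_flag\<close>).

The analytic input is that weak derivatives are unique and that a function with weak derivative zero
is constant on each interval (lemmas \<open>fundamental_lemma_calculus_of_variations\<close> and
\<open>du_bois_reymond\<close>), for which sufficiently many test functions are constructed from \<open>exp (- 1 / x)\<close>.
\<close>


section \<open>Triangular flags of invariant subspaces\<close>

locale flags = vector_space scale
  for scale :: "'a::field \<Rightarrow> 'b::ab_group_add \<Rightarrow> 'b"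
begin

definition linear_op_on :: "'b set \<Rightarrow> ('b \<Rightarrow> 'b) \<Rightarrow> bool" where
  "linear_op_on V T \<longleftrightarrow> (\<forall>x\<in>V. T x \<in> V) \<and> (\<forall>x\<in>V. \<forall>y\<in>V. T (x + y) = T x + T y) \<and>
     (\<forall>c. \<forall>x\<in>V. T (scale c x) = scale c (T x))"

lemma linear_op_onD:
  assumes "linear_op_on V T" "x \<in> V"
  shows "T x \<in> V" "y \<in> V \<Longrightarrow> T (x + y) = T x + T y" "T (scale c x) = scale c (T x)"
  using assms by (auto simp: linear_op_on_def)

lemma linear_op_on_subset:
  assumes "linear_op_on W T" "V \<subseteq> W" "\<And>x. x \<in> V \<Longrightarrow> T x \<in> V"
  shows "linear_op_on V T"
  using assms unfolding linear_op_on_def by (simp add: subset_eq)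

lemma linear_op_on_affine:
  assumes "linear_op_on V T" "subspace V" "x \<in> V" "y \<in> V"
  shows "T (scale c x + y) = scale c (T x) + T y"
  using linear_op_onD(2)[OF assms(1) subspace_scale[OF assms(2,3)] assms(4)]
    linear_op_onD(3)[OF assms(1,3)] by simp

lemma linear_op_on_zero:
  assumes "linear_op_on V T" "subspace V"
  shows "T 0 = 0"
  using linear_op_onD(3)[OF assms(1) subspace_0[OF assms(2)], of 0] by simp

lemma linear_op_on_diff:
  assumes "linear_op_on V T" "subspace V" "x \<in> V" "y \<in> V"
  shows "T (x - y) = T x - T y"
proof -
  have "T (x + scale (-1) y) = T x + scale (-1) (T y)"
    using assms linear_op_onD subspace_scale by metis
  then show ?thesis by simp
qed

lemma linear_op_on_funpow: "linear_op_on V T \<Longrightarrow> linear_op_on V (T ^^ n)"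
  by (induction n) (auto simp: linear_op_on_def)

lemma linear_op_on_shift:
  assumes "linear_op_on V T" "subspace V"
  shows "linear_op_on V (\<lambda>u. scale \<xi> u - T u)"
  using assms unfolding linear_op_on_def
  by (auto simp: subspace_diff subspace_scale scale_right_distrib scale_right_diff_distrib
      scale_left_commute)

text \<open>
A space is built up by one dimension at a time, and \<open>d\<close> is the scalar by which \<open>T\<close> acts on the new
one-dimensional quotient. The list thus is the diagonal of a triangular matrix of \<open>T\<close>, read from
the last basis vector to the first; no coordinates are chosen, so that flags can be continued along
exact sequences of invariant spaces.
\<close>

inductive triangular_flag :: "('b \<Rightarrow> 'b) \<Rightarrow> 'a list \<Rightarrow> 'b set \<Rightarrow> bool" for T where
  flag_Nil: "triangular_flag T [] {0}"
| flag_Cons: "triangular_flag T ds V \<Longrightarrow> v \<notin> V \<Longrightarrow> T v - scale d v \<in> V \<Longrightarrow>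
     triangular_flag T (d # ds) {scale c v + x | c x. x \<in> V}"

lemma subspace_extend:
  assumes "subspace V" shows "subspace {scale c v + x | c x. x \<in> V}"
proof (rule subspaceI)
  show "0 \<in> {scale c v + x | c x. x \<in> V}"
    using subspace_0[OF assms] by (auto intro!: exI[of _ 0] exI[of _ "0::'b"])
next
  fix x y assume "x \<in> {scale c v + x | c x. x \<in> V}" "y \<in> {scale c v + x | c x. x \<in> V}"
  then obtain c x' d y' where "x = scale c v + x'" "y = scale d v + y'" "x' \<in> V" "y' \<in> V"
    by blast
  then have "x + y = scale (c + d) v + (x' + y')" "x' + y' \<in> V"
    using subspace_add[OF assms] by (auto simp: scale_left_distrib algebra_simps)
  then show "x + y \<in> {scale c v + x | c x. x \<in> V}" by blast
next
  fix a x assume "x \<in> {scale c v + x | c x. x \<in> V}"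
  then obtain c x' where "x = scale c v + x'" "x' \<in> V"
    by blast
  then have "scale a x = scale (a * c) v + scale a x'" "scale a x' \<in> V"
    using subspace_scale[OF assms] by (auto simp: scale_right_distrib)
  then show "scale a x \<in> {scale c v + x | c x. x \<in> V}" by blast
qed

lemma subset_extend: "V \<subseteq> {scale c v + x | c x. x \<in> V}"
proof
  fix x assume "x \<in> V"
  moreover have "x = scale 0 v + x" by simp
  ultimately show "x \<in> {scale c v + x | c x. x \<in> V}" by blast
qed

lemma mem_extend:
  assumes "subspace V" shows "v \<in> {scale c v + x | c x. x \<in> V}"
  using subspace_0[OF assms] by (auto intro!: exI[of _ 1] exI[of _ "0::'b"])

lemma triangular_flag_subspace: "triangular_flag T ds V \<Longrightarrow> subspace V"
  by (induction rule: triangular_flag.induct) (auto intro: subspace_extend)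

lemma triangular_flag_linear:
  assumes "triangular_flag T ds V" "linear_op_on W T" "subspace W" "V \<subseteq> W"
  shows "linear_op_on V T"
  using assms
proof (induction rule: triangular_flag.induct)
  case flag_Nil
  then have "T 0 = 0" using linear_op_on_zero by blast
  then show ?case by (auto simp: linear_op_on_def)
next
  case (flag_Cons ds V v d)
  let ?V = "{scale c v + x | c x. x \<in> V}"
  have V: "subspace V" using flag_Cons.hyps triangular_flag_subspace by blast
  have lin: "linear_op_on V T" using flag_Cons subset_extend[of V v] by blast
  have v: "v \<in> W" "V \<subseteq> W"
    using mem_extend[OF V, of v] subset_extend[of V v] flag_Cons.prems by blast+
  have "T h \<in> ?V" if h: "h \<in> ?V" for h
  proof -
    obtain c x where h: "h = scale c v + x" "x \<in> V" using h by blast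
    have "T h = scale c (T v) + T x"
      using linear_op_on_affine[OF flag_Cons.prems(1,2) v(1)] h v(2) by blast
    also have "\<dots> = scale (c * d) v + (scale c (T v - scale d v) + T x)"
      by (simp add: scale_right_diff_distrib)
    finally show ?thesis
      using subspace_add[OF V] subspace_scale[OF V] flag_Cons.hyps(3) linear_op_onD(1)[OF lin] h(2)
      by blast
  qed
  then show ?case
    by (rule linear_op_on_subset[OF flag_Cons.prems(1,3)])
qed

lemma nilpotent_combine:
  assumes "linear_op_on V A" "subspace V" "x \<in> V" "y \<in> V" "(A ^^ n) x = 0" "(A ^^ m) y = 0"
  shows "(A ^^ (n + m)) (x + y) = 0"
proof -
  have "(A ^^ (n + m)) x = 0"
    using assms(5) linear_op_on_zero[OF linear_op_on_funpow[OF assms(1)] assms(2), of m]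
    by (simp add: add.commute[of n] funpow_add)
  moreover have "(A ^^ (n + m)) y = 0"
    using assms(6) linear_op_on_zero[OF linear_op_on_funpow[OF assms(1)] assms(2), of n]
    by (simp add: funpow_add)
  ultimately show ?thesis
    using linear_op_onD(2)[OF linear_op_on_funpow[OF assms(1)] assms(3,4)] by simp
qed

text \<open>
A weak form of Fitting's decomposition: up to vectors that are killed by a power of \<open>A = \<xi> - T\<close>,
the operator \<open>A\<close> is onto. When a line with \<open>d \<noteq> \<xi>\<close> is added, \<open>A\<close> is invertible on it modulo \<open>V\<close>. When
\<open>d = \<xi>\<close>, \<open>A\<close> maps everything into \<open>V\<close>; if \<open>A w\<close> is \<open>A u\<close> and \<open>u\<close> is \<open>A u'\<close> in this sense, then \<open>w\<close>
is \<open>A u'\<close>.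
\<close>

lemma triangular_flag_shift_onto_mod_nilpotent:
  fixes \<xi> :: 'a
  assumes "triangular_flag T ds V" "linear_op_on V T" "w \<in> V"
  defines "A \<equiv> \<lambda>u. scale \<xi> u - T u"
  shows "\<exists>u\<in>V. \<exists>n. (A ^^ n) (w - A u) = 0"
  using assms(1-3)
proof (induction arbitrary: w rule: triangular_flag.induct)
  case flag_Nil
  then show ?case using linear_op_on_zero[OF flag_Nil(1)]
    by (auto simp: A_def intro!: exI[of _ 0])
next
  case (flag_Cons ds V v d)
  let ?V = "{scale c v + x | c x. x \<in> V}"
  have V: "subspace V" using flag_Cons.hyps triangular_flag_subspace by blast
  have V': "subspace ?V" using subspace_extend[OF V] .
  have sub: "V \<subseteq> ?V" "v \<in> ?V" by (rule subset_extend, rule mem_extend[OF V])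
  have linT: "linear_op_on V T"
    using triangular_flag_linear[OF flag_Cons.hyps(1) flag_Cons.prems(1) V' sub(1)] .
  have IH: "\<exists>u\<in>V. \<exists>n. (A ^^ n) (w - A u) = 0" if "w \<in> V" for w
    using flag_Cons.IH[OF linT that] .
  have lin: "linear_op_on V A" unfolding A_def by (rule linear_op_on_shift[OF linT V])
  have lin': "linear_op_on ?V A" unfolding A_def by (rule linear_op_on_shift[OF flag_Cons.prems(1) V'])
  obtain c x where w: "w = scale c v + x" "x \<in> V" using flag_Cons.prems(2) by blast
  have Av: "A v - scale (\<xi> - d) v \<in> V"
  proof -
    have "A v - scale (\<xi> - d) v = - (T v - scale d v)"
      unfolding A_def scale_left_diff_distrib by (simp add: algebra_simps)
    then show ?thesis using subspace_neg[OF V flag_Cons.hyps(3)] by (simp only:)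
  qed
  show ?case
  proof (cases "d = \<xi>")
    case False
    define b where "b = scale (c / (\<xi> - d)) v"
    have b: "b \<in> ?V" using sub(2) subspace_scale[OF V'] by (simp add: b_def)
    have "A b = scale (c / (\<xi> - d)) (A v - scale (\<xi> - d) v) + scale c v"
      using False linear_op_onD(3)[OF lin' sub(2)]
      by (simp add: b_def scale_right_diff_distrib)
    then have "w - A b = x - scale (c / (\<xi> - d)) (A v - scale (\<xi> - d) v)"
      using w by simp
    then have "w - A b \<in> V"
      using w(2) Av subspace_diff[OF V] subspace_scale[OF V] by simp
    then obtain u n where u: "u \<in> V" "(A ^^ n) (w - A b - A u) = 0" using IH by blast
    have "A (b + u) = A b + A u" using linear_op_onD(2)[OF lin' b] u sub by blast
    then have "(A ^^ n) (w - A (b + u)) = 0" using u by (simp add: algebra_simps)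
    moreover have "b + u \<in> ?V" using subspace_add[OF V' b] u sub by blast
    ultimately show ?thesis by blast
  next
    case True
    have wV: "w \<in> ?V" using flag_Cons.prems by blast
    have Av': "A v \<in> V" using Av True by simp
    have "A w = scale c (A v) + A x"
      using linear_op_on_affine[OF lin' V' sub(2)] w sub(1) by blast
    then have "A w \<in> V"
      using Av' subspace_add[OF V] subspace_scale[OF V] linear_op_onD(1)[OF lin] w(2) by simp
    then obtain u n where u: "u \<in> V" "(A ^^ n) (A w - A u) = 0" using IH by blast
    obtain u' m where u': "u' \<in> V" "(A ^^ m) (u - A u') = 0" using IH[OF u(1)] by blast
    have "(A ^^ Suc n) (w - u) = 0"
      using u(2) linear_op_on_diff[OF lin' V' wV subsetD[OF sub(1) u(1)]]
      by (simp add: funpow_Suc_right del: funpow.simps)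
    moreover have "w - u \<in> ?V" using subspace_diff[OF V' wV] u sub by blast
    moreover have "u - A u' \<in> ?V"
      using u u' sub subspace_diff[OF V] linear_op_onD(1)[OF lin] by blast
    ultimately have "(A ^^ (Suc n + m)) ((w - u) + (u - A u')) = 0"
      using nilpotent_combine[OF lin' V'] u'(2) by blast
    then have "(A ^^ (Suc n + m)) (w - A u') = 0" by (simp del: funpow.simps)
    then show ?thesis using u'(1) sub(1) by blast
  qed
qed

text \<open>
A line with \<open>d \<noteq> \<xi>\<close> adds no generalized eigenvector, because the powers of \<open>\<xi> - d\<close> do not vanish. A
line with \<open>d = \<xi>\<close> adds exactly one dimension: \<open>v\<close> itself may fail to be a generalized eigenvector,
but \<open>A v\<close> lies in \<open>V\<close> and is there equal to some \<open>A u\<close> up to a nilpotent part, so that \<open>v - u\<close> is one.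
\<close>

lemma triangular_flag_generalized_eigenspace_basis:
  fixes \<xi> :: 'a
  assumes "triangular_flag T ds V" "linear_op_on V T"
  defines "A \<equiv> \<lambda>u. scale \<xi> u - T u"
  shows "\<exists>B. finite B \<and> independent B \<and> card B = count_list ds \<xi> \<and>
    span B = {h \<in> V. \<exists>n. (A ^^ n) h = 0}"
  using assms(1,2)
proof (induction rule: triangular_flag.induct)
  case flag_Nil
  show ?case by (rule exI[of _ "{}"]) (auto intro!: exI[of _ 0] simp: independent_empty)
next
  case (flag_Cons ds V v d)
  let ?V = "{scale c v + x | c x. x \<in> V}"
  have V: "subspace V" using flag_Cons.hyps triangular_flag_subspace by blast
  have V': "subspace ?V" using subspace_extend[OF V] .
  have sub: "V \<subseteq> ?V" "v \<in> ?V" by (rule subset_extend, rule mem_extend[OF V])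
  have linT: "linear_op_on V T"
    using triangular_flag_linear[OF flag_Cons.hyps(1) flag_Cons.prems(1) V' sub(1)] .
  have lin: "linear_op_on V A" unfolding A_def by (rule linear_op_on_shift[OF linT V])
  have lin': "linear_op_on ?V A" unfolding A_def by (rule linear_op_on_shift[OF flag_Cons.prems(1) V'])
  obtain B where B: "finite B" "independent B" "card B = count_list ds \<xi>"
    "span B = {h \<in> V. \<exists>n. (A ^^ n) h = 0}" using flag_Cons.IH[OF linT] by blast
  have Av: "A v - scale (\<xi> - d) v \<in> V"
  proof -
    have "A v - scale (\<xi> - d) v = - (T v - scale d v)"
      unfolding A_def scale_left_diff_distrib by (simp add: algebra_simps)
    then show ?thesis using subspace_neg[OF V flag_Cons.hyps(3)] by (simp only:)
  qed
  show ?case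
  proof (cases "d = \<xi>")
    case False
    have "h \<in> V" if h: "h \<in> ?V" "(A ^^ n) h = 0" for h n
    proof -
      have step: "\<exists>x\<in>V. (A ^^ n) v = scale ((\<xi> - d) ^ n) v + x" for n
      proof (induction n)
        case 0
        then show ?case using subspace_0[OF V] by auto
      next
        case (Suc n)
        then obtain x where x: "x \<in> V" "(A ^^ n) v = scale ((\<xi> - d) ^ n) v + x" by blast
        have "(A ^^ Suc n) v = scale ((\<xi> - d) ^ n) (A v) + A x"
          using linear_op_on_affine[OF lin' V' sub(2)] x sub(1) by (simp add: subset_eq)
        also have "\<dots> = scale ((\<xi> - d) ^ Suc n) v +
            (scale ((\<xi> - d) ^ n) (A v - scale (\<xi> - d) v) + A x)"
          by (simp add: scale_right_diff_distrib mult.commute)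
        finally show ?case
          using Av subspace_add[OF V] subspace_scale[OF V] linear_op_onD(1)[OF lin] x(1) by blast
      qed
      obtain c x where hc: "h = scale c v + x" "x \<in> V" using h(1) by blast
      obtain y where y: "y \<in> V" "(A ^^ n) v = scale ((\<xi> - d) ^ n) v + y" using step by blast
      have "0 = scale c ((A ^^ n) v) + (A ^^ n) x"
        using linear_op_on_affine[OF linear_op_on_funpow[OF lin', of n] V' sub(2)] h(2) hc sub(1)
        by (simp add: subset_eq)
      then have "scale (c * (\<xi> - d) ^ n) v = - (scale c y + (A ^^ n) x)"
        using y(2) by (simp add: scale_right_distrib add.assoc add_eq_0_iff2)
      moreover have "scale c y + (A ^^ n) x \<in> V"
        using y hc(2) linear_op_onD(1)[OF linear_op_on_funpow[OF lin, of n]]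
          subspace_add[OF V] subspace_scale[OF V] by blast
      ultimately have m: "scale (c * (\<xi> - d) ^ n) v \<in> V" using subspace_neg[OF V] by metis
      have "c = 0"
      proof (rule ccontr)
        assume "c \<noteq> 0"
        then have "v = scale (1 / (c * (\<xi> - d) ^ n)) (scale (c * (\<xi> - d) ^ n) v)"
          using False by simp
        then show False using m subspace_scale[OF V] flag_Cons.hyps(2) by metis
      qed
      then show ?thesis using hc by simp
    qed
    then have "{h \<in> ?V. \<exists>n. (A ^^ n) h = 0} = {h \<in> V. \<exists>n. (A ^^ n) h = 0}"
      using sub by blast
    then show ?thesis using B False by auto
  next
    case True
    have "A v \<in> V" using Av True by simp
    then obtain u n where u: "u \<in> V" "(A ^^ n) (A v - A u) = 0"
      using triangular_flag_shift_onto_mod_nilpotent[OF flag_Cons.hyps(1) linT, of "A v" \<xi>]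
      unfolding A_def by blast
    define w where "w = v - u"
    have wV: "w \<in> ?V" unfolding w_def using subspace_diff[OF V' sub(2)] u sub by blast
    have wA: "(A ^^ Suc n) w = 0"
      using u(2) linear_op_on_diff[OF lin' V' sub(2) subsetD[OF sub(1) u(1)]]
      by (simp add: w_def funpow_Suc_right del: funpow.simps)
    have wnV: "w \<notin> V"
      using subspace_add[OF V _ u(1), of w] flag_Cons.hyps(2) by (auto simp: w_def)
    have "w \<notin> span B" using B wnV by blast
    then have "independent (insert w B)" "w \<notin> B" using B independent_insertI span_base by blast+
    moreover have "span (insert w B) = {h \<in> ?V. \<exists>n. (A ^^ n) h = 0}"
    proof (intro equalityI subsetI)
      fix h assume "h \<in> span (insert w B)"
      then obtain c where c: "h - scale c w \<in> span B" using span_breakdown_eq by blast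
      then obtain m where m: "h - scale c w \<in> V" "(A ^^ m) (h - scale c w) = 0" using B by blast
      have 1: "scale c w \<in> ?V" using wV subspace_scale[OF V'] by blast
      have 2: "(A ^^ Suc n) (scale c w) = 0"
        using wA linear_op_onD(3)[OF linear_op_on_funpow[OF lin'] wV] by (metis scale_zero_right)
      have "(A ^^ (m + Suc n)) ((h - scale c w) + scale c w) = 0"
        using nilpotent_combine[OF lin' V' _ 1 m(2) 2] m(1) sub by blast
      moreover have "(h - scale c w) + scale c w \<in> ?V"
        using subspace_add[OF V' _ 1] m(1) sub by blast
      ultimately show "h \<in> {h \<in> ?V. \<exists>n. (A ^^ n) h = 0}" unfolding diff_add_cancel by blast
    next
      fix h assume "h \<in> {h \<in> ?V. \<exists>n. (A ^^ n) h = 0}"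
      then obtain m c x where h: "h \<in> ?V" "(A ^^ m) h = 0" "h = scale c v + x" "x \<in> V" by blast
      have 1: "scale (-c) w \<in> ?V" using wV subspace_scale[OF V'] by blast
      have 2: "(A ^^ Suc n) (scale (-c) w) = 0"
        using wA linear_op_onD(3)[OF linear_op_on_funpow[OF lin'] wV] by (metis scale_zero_right)
      have "(A ^^ (m + Suc n)) (h + scale (-c) w) = 0"
        using nilpotent_combine[OF lin' V' h(1) 1 h(2) 2] .
      moreover have "h + scale (-c) w = x + scale c u"
        using h by (simp add: w_def scale_right_diff_distrib)
      moreover have "x + scale c u \<in> V"
        using h u subspace_add[OF V] subspace_scale[OF V] by blast
      ultimately have "h + scale (-c) w \<in> span B"
        unfolding B(4) by (metis (mono_tags, lifting) mem_Collect_eq)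
      then show "h \<in> span (insert w B)"
        using span_breakdown_eq[of h w B] by auto
    qed
    moreover have "card (insert w B) = count_list (d # ds) \<xi>" "finite (insert w B)"
      using B \<open>w \<notin> B\<close> True by auto
    ultimately show ?thesis by blast
  qed
qed

text \<open>
Diagonals add up along an exact sequence: the preimages under \<open>D\<close> of the steps of a flag of the
image continue a flag of the kernel.
\<close>

lemma triangular_flag_lift:
  assumes U: "triangular_flag T' es U" and K: "triangular_flag T ds {h \<in> V. D h = 0}"
    and V: "subspace V" and onto: "U \<subseteq> D ` V"
    and add: "\<And>x y. x \<in> V \<Longrightarrow> y \<in> V \<Longrightarrow> D (x + y) = D x + D y"
    and scl: "\<And>c x. x \<in> V \<Longrightarrow> D (scale c x) = scale c (D x)"
    and inter: "\<And>x. x \<in> V \<Longrightarrow> T x \<in> V \<and> D (T x) = T' (D x)"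
  shows "triangular_flag T (es @ ds) {h \<in> V. D h \<in> U}"
  using U onto
proof (induction rule: triangular_flag.induct)
  case flag_Nil
  then show ?case using K by simp
next
  case (flag_Cons es U u e)
  have U: "subspace U" using flag_Cons.hyps triangular_flag_subspace by blast
  have IH: "triangular_flag T (es @ ds) {h \<in> V. D h \<in> U}"
    using flag_Cons subset_extend[of U u] by blast
  obtain v where v: "v \<in> V" "D v = u" using flag_Cons.prems mem_extend[OF U, of u] by blast
  have Ddiff: "D (x - y) = D x - D y" if "x \<in> V" "y \<in> V" for x y
    using add[of x "scale (-1) y"] scl[of y "-1"] that subspace_scale[OF V that(2)] by (simp add: subspace_neg[OF V])
  have "T v - scale e v \<in> {h \<in> V. D h \<in> U}"
    using v inter[OF v(1)] scl[OF v(1)] Ddiff[of "T v" "scale e v"] subspace_diff[OF V]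
      subspace_scale[OF V v(1)] flag_Cons.hyps(3) by auto
  moreover have "v \<notin> {h \<in> V. D h \<in> U}" using v flag_Cons.hyps(2) by auto
  moreover have "{scale c v + x |c x. x \<in> {h \<in> V. D h \<in> U}} = {h \<in> V. D h \<in> {scale c u + x |c x. x \<in> U}}"
  proof (intro equalityI subsetI)
    fix h assume "h \<in> {scale c v + x |c x. x \<in> {h \<in> V. D h \<in> U}}"
    then obtain c x where h: "h = scale c v + x" "x \<in> V" "D x \<in> U" by blast
    then have "D h = scale c u + D x" using add scl v subspace_scale[OF V v(1)] by auto
    then show "h \<in> {h \<in> V. D h \<in> {scale c u + x |c x. x \<in> U}}"
      using h subspace_add[OF V] subspace_scale[OF V v(1)] by blast
  next
    fix h assume "h \<in> {h \<in> V. D h \<in> {scale c u + x |c x. x \<in> U}}"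
    then obtain c x where h: "h \<in> V" "D h = scale c u + x" "x \<in> U" by blast
    have cv: "scale c v \<in> V" using subspace_scale[OF V v(1)] .
    have "D (h - scale c v) = x" using Ddiff[OF h(1) cv] h scl[OF v(1)] v by simp
    then have "h - scale c v \<in> {h \<in> V. D h \<in> U}" using h subspace_diff[OF V h(1) cv] by auto
    moreover have "h = scale c v + (h - scale c v)" by simp
    ultimately show "h \<in> {scale c v + x |c x. x \<in> {h \<in> V. D h \<in> U}}" by blast
  qed
  ultimately show ?case
    using triangular_flag.flag_Cons[OF IH, of v e] by simp
qed

end


interpretation L1: flags scale_L1 ..


section \<open>Bounded operators and their resolvents\<close>

definition seminorm_on :: "L1 set \<Rightarrow> (L1 \<Rightarrow> real) \<Rightarrow> bool" where
  "seminorm_on V nrm \<longleftrightarrow> (\<forall>h\<in>V. 0 \<le> nrm h) \<and>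
     (\<forall>h\<in>V. \<forall>h'\<in>V. nrm (h + h') \<le> nrm h + nrm h') \<and>
     (\<forall>c. \<forall>h\<in>V. nrm (scale_L1 c h) = cmod c * nrm h)"

lemma bounded_op_on_linear: "bounded_op_on V nrm T \<Longrightarrow> L1.linear_op_on V T"
  by (simp add: bounded_op_on_def L1.linear_op_on_def)

lemma bounded_op_onI:
  assumes "L1.linear_op_on V T" "\<And>h. h \<in> V \<Longrightarrow> nrm (T h) \<le> C * nrm h"
  shows "bounded_op_on V nrm T"
  using assms by (auto simp: bounded_op_on_def L1.linear_op_on_def)

lemma bounded_op_on_bound:
  assumes "bounded_op_on V nrm T" "seminorm_on V nrm"
  obtains C where "C \<ge> 0" "\<And>h. h \<in> V \<Longrightarrow> nrm (T h) \<le> C * nrm h"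
proof -
  obtain C where C: "\<And>h. h \<in> V \<Longrightarrow> nrm (T h) \<le> C * nrm h"
    using assms(1) unfolding bounded_op_on_def by blast
  have "nrm (T h) \<le> \<bar>C\<bar> * nrm h" if "h \<in> V" for h
    using C[OF that] assms(2) that mult_right_mono[OF abs_ge_self, of "nrm h" C]
    by (force simp: seminorm_on_def)
  then show ?thesis using that[of "\<bar>C\<bar>"] by simp
qed

lemma bounded_op_on_compose:
  assumes "bounded_op_on V nrm S" "bounded_op_on V nrm T" "seminorm_on V nrm"
  shows "bounded_op_on V nrm (\<lambda>h. S (T h))"
proof -
  obtain C D where "C \<ge> 0" "\<And>h. h \<in> V \<Longrightarrow> nrm (S h) \<le> C * nrm h" 
     "D \<ge> 0" "\<And>h. h \<in> V \<Longrightarrow> nrm (T h) \<le> D * nrm h"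
    using assms bounded_op_on_bound by metis
  moreover have "T h \<in> V" if "h \<in> V" for h using assms that by (simp add: bounded_op_on_def)
  ultimately have "nrm (S (T h)) \<le> C * D * nrm h" if "h \<in> V" for h
    using that mult_left_mono[of "nrm (T h)" "D * nrm h" C] order_trans[of "nrm (S (T h))" "C * nrm (T h)"]
    by (simp add: mult.assoc)
  then show ?thesis
    using bounded_op_on_linear[OF assms(1)] bounded_op_on_linear[OF assms(2)]
    by (intro bounded_op_onI[of _ _ _ "C * D"]) (auto simp: L1.linear_op_on_def)
qed

lemma bounded_op_on_combine:
  assumes "bounded_op_on V nrm S" "bounded_op_on V nrm T" "seminorm_on V nrm" "L1.subspace V"
  shows "bounded_op_on V nrm (\<lambda>h. scale_L1 a (S h) + scale_L1 b (T h))"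
proof -
  obtain C D where C: "\<And>h. h \<in> V \<Longrightarrow> nrm (S h) \<le> C * nrm h" 
    and D: "\<And>h. h \<in> V \<Longrightarrow> nrm (T h) \<le> D * nrm h"
    using assms bounded_op_on_bound by metis
  have mem: "S h \<in> V" "T h \<in> V" if "h \<in> V" for h using assms that by (simp_all add: bounded_op_on_def)
  show ?thesis
  proof (rule bounded_op_onI)
    show "L1.linear_op_on V (\<lambda>h. scale_L1 a (S h) + scale_L1 b (T h))"
      using bounded_op_on_linear[OF assms(1)] bounded_op_on_linear[OF assms(2)] assms(4)
      by (auto simp: L1.linear_op_on_def L1.subspace_add L1.subspace_scale L1.scale_right_distrib
          mult.commute)
    fix h assume h: "h \<in> V"
    have "nrm (scale_L1 a (S h) + scale_L1 b (T h)) \<le> cmod a * nrm (S h) + cmod b * nrm (T h)"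
      using assms(3,4) mem[OF h] L1.subspace_scale unfolding seminorm_on_def by metis
    also have "\<dots> \<le> cmod a * (C * nrm h) + cmod b * (D * nrm h)"
      using C[OF h] D[OF h] by (intro add_mono mult_left_mono) auto
    finally show "nrm (scale_L1 a (S h) + scale_L1 b (T h)) \<le> (cmod a * C + cmod b * D) * nrm h"
      by (simp add: algebra_simps)
  qed
qed

primrec factor_product :: "(L1 \<Rightarrow> L1) \<Rightarrow> complex list \<Rightarrow> L1 \<Rightarrow> L1" where
  "factor_product T [] h = h"
| "factor_product T (d # ds) h = factor_product T ds (T h - scale_L1 d h)"

text \<open>
The Cayley-Hamilton theorem for flags: \<open>T - d\<close> maps each step of the flag into the preceding one.
\<close>

lemma factor_product_eq_0:
  assumes "L1.triangular_flag T ds V" "L1.linear_op_on V T" "h \<in> V"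
  shows "factor_product T ds h = 0"
  using assms
proof (induction arbitrary: h rule: L1.triangular_flag.induct)
  case (flag_Cons ds V v d)
  let ?V = "{scale_L1 c v + x | c x. x \<in> V}"
  have V: "L1.subspace V" using flag_Cons.hyps L1.triangular_flag_subspace by blast
  have V': "L1.subspace ?V" using L1.subspace_extend[OF V] .
  have sub: "V \<subseteq> ?V" "v \<in> ?V" by (rule L1.subset_extend, rule L1.mem_extend[OF V])
  have linT: "L1.linear_op_on V T"
    using L1.triangular_flag_linear[OF flag_Cons.hyps(1) flag_Cons.prems(1) V' sub(1)] .
  obtain c x where h: "h = scale_L1 c v + x" "x \<in> V" using flag_Cons.prems by blast
  have "T h = scale_L1 c (T v) + T x"
    using L1.linear_op_on_affine[OF flag_Cons.prems(1) V' sub(2)] h sub(1) by blast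
  then have "T h - scale_L1 d h = scale_L1 c (T v - scale_L1 d v) + (T x - scale_L1 d x)"
    by (simp add: h(1) L1.scale_right_diff_distrib L1.scale_right_distrib L1.scale_left_commute)
  then have "T h - scale_L1 d h \<in> V"
    using h(2) flag_Cons.hyps(3) L1.subspace_add[OF V] L1.subspace_scale[OF V]
      L1.subspace_diff[OF V] L1.linear_op_onD(1)[OF linT] by simp
  then show ?case using flag_Cons.IH[OF linT] by simp
qed simp

lemma bounded_op_on_id: "bounded_op_on V nrm (\<lambda>h. h)"
  by (auto simp: bounded_op_on_def intro!: exI[of _ 1])

lemma bounded_op_on_factor:
  assumes "bounded_op_on V nrm T" "seminorm_on V nrm" "L1.subspace V"
  shows "bounded_op_on V nrm (\<lambda>h. T h - scale_L1 d h)"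
  using bounded_op_on_combine[OF assms(1) bounded_op_on_id assms(2,3), of 1 "- d"] by simp

lemma bounded_op_on_factor_product:
  assumes "bounded_op_on V nrm T" "seminorm_on V nrm" "L1.subspace V"
  shows "bounded_op_on V nrm (factor_product T ds)"
proof (induction ds)
  case Nil
  then show ?case using bounded_op_on_id by (simp add: bounded_op_on_def)
next
  case (Cons d ds)
  then show ?case
    using bounded_op_on_compose[OF Cons bounded_op_on_factor[OF assms] assms(2)]
    by (simp add: bounded_op_on_def)
qed

lemma factor_product_commute:
  assumes "L1.linear_op_on V T" "L1.subspace V" "h \<in> V"
  shows "factor_product T ds (T h) = T (factor_product T ds h)"
  using assms(3)
proof (induction ds arbitrary: h)
  case (Cons d ds)
  have "T (T h) - scale_L1 d (T h) = T (T h - scale_L1 d h)"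
    using L1.linear_op_on_diff[OF assms(1,2)] L1.linear_op_onD[OF assms(1)] Cons.prems
      L1.subspace_scale[OF assms(2)] by simp
  moreover have "T h - scale_L1 d h \<in> V"
    using L1.linear_op_onD[OF assms(1)] Cons.prems L1.subspace_scale[OF assms(2)]
      L1.subspace_diff[OF assms(2)] by simp
  ultimately show ?case using Cons.IH[of "T h - scale_L1 d h"] by simp
qed simp

text \<open>
If \<open>c\<close> makes the polynomial \<open>1 - c \<Prod>(x - d)\<close> vanish at \<open>\<xi>\<close>, then \<open>\<xi> - x\<close> divides it. The quotient,
evaluated at \<open>T\<close>, is \<open>Q\<close>. As a polynomial in \<open>T\<close> it is bounded and commutes with \<open>T\<close>; this gives
bounded resolvents on finite-dimensional spaces without comparing norms.
\<close>

lemma inverse_modulo_factor_product: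
  assumes "bounded_op_on V nrm T" "seminorm_on V nrm" "L1.subspace V" "\<xi> \<notin> set ds"
  shows "\<exists>Q c. bounded_op_on V nrm Q \<and> (\<forall>h\<in>V. Q (T h) = T (Q h)) \<and>
    (\<forall>h\<in>V. Q (scale_L1 \<xi> h - T h) = h - scale_L1 c (factor_product T ds h))"
  using assms(4)
proof (induction ds)
  case Nil
  have "T 0 = 0" using L1.linear_op_on_zero[OF bounded_op_on_linear assms(3)] assms(1) .
  moreover have "bounded_op_on V nrm (\<lambda>h. scale_L1 0 h + scale_L1 0 h)"
    by (rule bounded_op_on_combine[OF bounded_op_on_id bounded_op_on_id assms(2,3)])
  ultimately show ?case
    by (intro exI[of _ "\<lambda>h. 0"] exI[of _ 1]) simp
next
  case (Cons d ds)
  then obtain Q c where Q: "bounded_op_on V nrm Q" "\<And>h. h \<in> V \<Longrightarrow> Q (T h) = T (Q h)"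
    "\<And>h. h \<in> V \<Longrightarrow> Q (scale_L1 \<xi> h - T h) = h - scale_L1 c (factor_product T ds h)"
    by auto
  \<comment> \<open>From \<open>(\<xi> - d) \<Prod> = \<Prod> (T - d) + (\<xi> - T) \<Prod>\<close>, where \<open>\<Prod>\<close> is the product over \<open>ds\<close>.\<close>
  define e where "e = c / (\<xi> - d)"
  have e: "e * (\<xi> - d) = c" using Cons.prems by (simp add: e_def)
  let ?C = "factor_product T ds"
  let ?Q = "\<lambda>h. scale_L1 1 (Q h) + scale_L1 e (?C h)"
  have C: "bounded_op_on V nrm ?C" by (rule bounded_op_on_factor_product[OF assms(1-3)])
  note linT = bounded_op_on_linear[OF assms(1)] 
  note linC = bounded_op_on_linear[OF C] 
  have bQ: "bounded_op_on V nrm ?Q"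
    by (rule bounded_op_on_combine[OF Q(1) C assms(2,3)])
  have "?Q (T h) = T (?Q h)" if h: "h \<in> V" for h
    using Q(2)[OF h] factor_product_commute[OF linT assms(3) h, of ds]
      L1.linear_op_on_affine[OF linT assms(3), of "?C h" "Q h" e]
      L1.linear_op_onD(1)[OF linC h] L1.linear_op_onD(1)[OF bounded_op_on_linear[OF Q(1)] h]
    by (simp add: add.commute)
  moreover have "?Q (scale_L1 \<xi> h - T h) = h - scale_L1 e (factor_product T (d # ds) h)"
    if h: "h \<in> V" for h
  proof -
    have 1: "T h - scale_L1 d h = scale_L1 (\<xi> - d) h - (scale_L1 \<xi> h - T h)"
      by (simp add: L1.scale_left_diff_distrib)
    have 2: "scale_L1 (\<xi> - d) h \<in> V" "scale_L1 \<xi> h - T h \<in> V"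
      using h L1.subspace_scale[OF assms(3)] L1.subspace_diff[OF assms(3)] L1.linear_op_onD(1)[OF linT]
      by simp_all
    have "factor_product T (d # ds) h = scale_L1 (\<xi> - d) (?C h) - ?C (scale_L1 \<xi> h - T h)"
      unfolding factor_product.simps 1
      using L1.linear_op_on_diff[OF linC assms(3) 2] L1.linear_op_onD(3)[OF linC h] by simp
    then have "scale_L1 e (factor_product T (d # ds) h)
        = scale_L1 c (?C h) - scale_L1 e (?C (scale_L1 \<xi> h - T h))"
      by (simp add: L1.scale_right_diff_distrib e)
    then show ?thesis using Q(3)[OF h] by (simp del: factor_product.simps add: algebra_simps)
  qed
  ultimately show ?case using bQ by blast
qed

lemma count_list_pos_iff: "0 < count_list xs x \<longleftrightarrow> x \<in> set xs"
  using count_list_0_iff[of xs x] by auto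

lemma op_multiplicity_triangular_flag:
  assumes "L1.triangular_flag T ds V" "L1.linear_op_on V T"
  shows "op_multiplicity V T \<xi> = count_list ds \<xi>"
  using L1.triangular_flag_generalized_eigenspace_basis[OF assms, of \<xi>]
    L1.dim_span_eq_card_independent
  unfolding op_multiplicity_def by metis

text \<open>
Off the diagonal the polynomial \<open>Q\<close> above is the resolvent, since the product of all factors is
zero. On the diagonal there is a generalized eigenvector, hence an eigenvector, and no inverse.
\<close>

lemma op_spectrum_triangular_flag:
  assumes flag: "L1.triangular_flag T ds V" and T: "bounded_op_on V nrm T" and nrm: "seminorm_on V nrm"
  shows "op_spectrum V nrm T = set ds"
proof -
  have V: "L1.subspace V" using L1.triangular_flag_subspace[OF flag] .
  note linT = bounded_op_on_linear[OF T]
  have "\<xi> \<in> op_resolvent_set V nrm T \<longleftrightarrow> \<xi> \<notin> set ds" for \<xi>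
  proof
    assume "\<xi> \<notin> set ds"
    then obtain Q c where Q: "bounded_op_on V nrm Q" "\<And>h. h \<in> V \<Longrightarrow> Q (T h) = T (Q h)"
      "\<And>h. h \<in> V \<Longrightarrow> Q (scale_L1 \<xi> h - T h) = h - scale_L1 c (factor_product T ds h)"
      using inverse_modulo_factor_product[OF T nrm V] by metis
    note linQ = bounded_op_on_linear[OF Q(1)]
    have *: "Q (scale_L1 \<xi> h - T h) = h" if "h \<in> V" for h
      using Q(3)[OF that] factor_product_eq_0[OF flag linT that] by simp
    moreover have "scale_L1 \<xi> (Q h) - T (Q h) = h" if h: "h \<in> V" for h
      using *[OF h] Q(2)[OF h] L1.linear_op_on_diff[OF linQ V, of "scale_L1 \<xi> h" "T h"]
        L1.linear_op_onD[OF linQ h] L1.subspace_scale[OF V h] L1.linear_op_onD(1)[OF linT h] by simp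
    ultimately show "\<xi> \<in> op_resolvent_set V nrm T"
      using Q(1) unfolding op_resolvent_set_def by blast
  next
    assume "\<xi> \<in> op_resolvent_set V nrm T"
    then obtain S where S: "bounded_op_on V nrm S"
      "\<And>h. h \<in> V \<Longrightarrow> S (scale_L1 \<xi> h - T h) = h"
      unfolding op_resolvent_set_def by blast
    have S0: "S 0 = 0" using L1.linear_op_on_zero[OF bounded_op_on_linear[OF S(1)] V] .
    let ?A = "\<lambda>u. scale_L1 \<xi> u - T u"
    have linA: "L1.linear_op_on V ?A" by (rule L1.linear_op_on_shift[OF linT V])
    have "h = 0" if "h \<in> V" "(?A ^^ n) h = 0" for h n
      using that
    proof (induction n)
      case (Suc n)
      have "(?A ^^ n) h \<in> V" using L1.linear_op_onD(1)[OF L1.linear_op_on_funpow[OF linA]] Suc by blast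
      then have "(?A ^^ n) h = 0" using S(2)[of "(?A ^^ n) h"] S0 Suc.prems(2) by simp
      then show ?case using Suc by blast
    qed simp
    then have "{h \<in> V. \<exists>n. (?A ^^ n) h = 0} \<subseteq> {0}" by blast
    then have "op_multiplicity V T \<xi> \<le> card ({}::L1 set)"
      unfolding op_multiplicity_def by (intro L1.dim_le_card) auto
    then show "\<xi> \<notin> set ds"
      using op_multiplicity_triangular_flag[OF flag linT, of \<xi>] count_list_pos_iff[of ds \<xi>] by simp
  qed
  then show ?thesis unfolding op_spectrum_def by auto
qed


section \<open>The Banach space of integrable functions\<close>

lemma L1_eqI: "AE x in unit_leb. rep_L1 h x = rep_L1 h' x \<Longrightarrow> h = h'"
  using Quotient3_rel_rep[OF Quotient3_L1, of h h'] by (simp add: L1_eq_def integrable_rep_L1)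

lemma AE_rep_plus: "AE x in unit_leb. rep_L1 (h + h') x = rep_L1 h x + rep_L1 h' x"
proof -
  have "h + h' = abs_L1 (\<lambda>x. rep_L1 h x + rep_L1 h' x)"
    using plus_L1.abs_eq[of "rep_L1 h" "rep_L1 h'"] Quotient3_abs_rep[OF Quotient3_L1]
    by (simp add: L1_eq_def integrable_rep_L1)
  then show ?thesis using AE_rep_abs_L1 integrable_rep_L1 by simp
qed

lemma AE_rep_diff: "AE x in unit_leb. rep_L1 (h - h') x = rep_L1 h x - rep_L1 h' x"
proof -
  have "h - h' = abs_L1 (\<lambda>x. rep_L1 h x - rep_L1 h' x)"
    using minus_L1.abs_eq[of "rep_L1 h" "rep_L1 h'"] Quotient3_abs_rep[OF Quotient3_L1]
    by (simp add: L1_eq_def integrable_rep_L1)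
  then show ?thesis using AE_rep_abs_L1 integrable_rep_L1 by simp
qed

lemma AE_rep_scale: "AE x in unit_leb. rep_L1 (scale_L1 c h) x = c * rep_L1 h x"
proof -
  have "scale_L1 c h = abs_L1 (\<lambda>x. c * rep_L1 h x)"
    using scale_L1.abs_eq[of "rep_L1 h" c] Quotient3_abs_rep[OF Quotient3_L1]
    by (simp add: L1_eq_def integrable_rep_L1)
  then show ?thesis using AE_rep_abs_L1 integrable_rep_L1 by simp
qed

lemma AE_rep_zero: "AE x in unit_leb. rep_L1 0 x = 0"
  using AE_rep_abs_L1[of "\<lambda>_. 0"] by (simp add: zero_L1_def)

text \<open>
The norm makes \<open>L1\<close> a real Banach space; this is the structure to which Banach's fixed point
theorem applies. Complex scalars act by \<open>scale_L1\<close>.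
\<close>

instantiation L1 :: real_normed_vector
begin

definition norm_L1 :: "L1 \<Rightarrow> real" where
  "norm_L1 h = (\<integral>x. cmod (rep_L1 h x) \<partial>unit_leb)"

definition scaleR_L1 :: "real \<Rightarrow> L1 \<Rightarrow> L1" where
  "scaleR_L1 a = scale_L1 (of_real a)"

definition dist_L1 :: "L1 \<Rightarrow> L1 \<Rightarrow> real" where
  "dist_L1 h h' = norm (h - h')"

definition sgn_L1 :: "L1 \<Rightarrow> L1" where
  "sgn_L1 h = scaleR (inverse (norm h)) h"

definition uniformity_L1 :: "(L1 \<times> L1) filter" where
  "uniformity_L1 = (INF e\<in>{0 <..}. principal {(x, y). dist x y < e})"

definition open_L1 :: "L1 set \<Rightarrow> bool" where
  "open_L1 U \<longleftrightarrow> (\<forall>x\<in>U. \<forall>\<^sub>F (x', y) in uniformity. x' = x \<longrightarrow> y \<in> U)"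

instance
proof
  fix h h' :: L1 and a b :: real
  show "dist h h' = norm (h - h')" "sgn h = scaleR (inverse (norm h)) h"
    by (rule dist_L1_def sgn_L1_def)+
  show "(uniformity :: (L1 \<times> L1) filter) = (INF e\<in>{0 <..}. principal {(x, y). dist x y < e})"
    by (rule uniformity_L1_def)
  show "open U \<longleftrightarrow> (\<forall>x\<in>U. \<forall>\<^sub>F (x', y) in uniformity. x' = x \<longrightarrow> y \<in> U)" for U :: "L1 set"
    by (rule open_L1_def)
  show "a *\<^sub>R (h + h') = a *\<^sub>R h + a *\<^sub>R h'" "(a + b) *\<^sub>R h = a *\<^sub>R h + b *\<^sub>R h"
    "a *\<^sub>R b *\<^sub>R h = (a * b) *\<^sub>R h" "1 *\<^sub>R h = h"
    by (simp_all add: scaleR_L1_def L1.scale_right_distrib L1.scale_left_distrib)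
  have int: "integrable unit_leb (\<lambda>x. cmod (rep_L1 g x))" for g
    using integrable_rep_L1 by simp
  show "norm h = 0 \<longleftrightarrow> h = 0"
  proof
    assume "norm h = 0"
    then have "AE x in unit_leb. cmod (rep_L1 h x) = 0"
      using integral_nonneg_eq_0_iff_AE[OF int] by (simp add: norm_L1_def)
    then show "h = 0" using AE_rep_zero by (intro L1_eqI) (auto elim: AE_mp)
  next
    assume "h = 0"
    then show "norm h = 0"
      using AE_rep_zero integral_cong_AE[of "\<lambda>x. cmod (rep_L1 0 x)" unit_leb "\<lambda>_. 0"] int[of 0]
      by (auto simp: norm_L1_def elim: AE_mp)
  qed
  show "norm (h + h') \<le> norm h + norm h'"
  proof -
    have "norm (h + h') \<le> (\<integral>x. cmod (rep_L1 h x) + cmod (rep_L1 h' x) \<partial>unit_leb)"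
      unfolding norm_L1_def using AE_rep_plus[of h h'] int
      by (intro integral_mono_AE) (auto elim!: AE_mp simp: norm_triangle_ineq)
    then show ?thesis using int by (simp add: norm_L1_def)
  qed
  show "norm (a *\<^sub>R h) = \<bar>a\<bar> * norm h"
  proof -
    have "norm (a *\<^sub>R h) = (\<integral>x. \<bar>a\<bar> * cmod (rep_L1 h x) \<partial>unit_leb)"
      unfolding norm_L1_def scaleR_L1_def using AE_rep_scale[of "of_real a" h] int integrable_rep_L1
      by (intro integral_cong_AE) (auto elim!: AE_mp simp: norm_mult)
    then show ?thesis using int by (simp add: norm_L1_def)
  qed
qed

end

lemma norm_scale_L1: "norm (scale_L1 c h) = cmod c * norm h"
proof -
  have "norm (scale_L1 c h) = (\<integral>x. cmod c * cmod (rep_L1 h x) \<partial>unit_leb)"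
    unfolding norm_L1_def using AE_rep_scale[of c h] integrable_rep_L1
    by (intro integral_cong_AE) (auto elim!: AE_mp simp: norm_mult)
  then show ?thesis using integrable_rep_L1 by (simp add: norm_L1_def)
qed

lemma norm_abs_L1:
  assumes "integrable unit_leb u"
  shows "norm (abs_L1 u) = (\<integral>x. cmod (u x) \<partial>unit_leb)"
  unfolding norm_L1_def using assms AE_rep_abs_L1[OF assms] integrable_rep_L1
  by (intro integral_cong_AE) (auto elim!: AE_mp)

text \<open>
By monotone convergence the series of absolute values is finite almost everywhere, so the limit is
the pointwise sum.
\<close>

lemma L1_absolutely_summable_converges:
  fixes g :: "nat \<Rightarrow> L1"
  assumes "summable (\<lambda>n. norm (g n))"
  shows "\<exists>h. (\<lambda>n. \<Sum>i<n. g i) \<longlonglongrightarrow> h"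
proof -
  let ?r = "\<lambda>n. rep_L1 (g n)"
  have int: "integrable unit_leb (?r n)" for n by (rule integrable_rep_L1)
  have nn: "(\<integral>\<^sup>+ x. ennreal (cmod (?r n x)) \<partial>unit_leb) = ennreal (norm (g n))" for n
    unfolding norm_L1_def using int[of n] by (intro nn_integral_eq_integral) auto
  have "(\<integral>\<^sup>+ x. (\<Sum>n. ennreal (cmod (?r n x))) \<partial>unit_leb) = (\<Sum>n. ennreal (norm (g n)))"
    using int by (subst nn_integral_suminf) (auto simp: nn)
  also have "\<dots> \<noteq> \<infinity>"
    unfolding suminf_ennreal2[OF norm_ge_zero assms] by simp
  finally have "AE x in unit_leb. (\<Sum>n. ennreal (cmod (?r n x))) \<noteq> \<infinity>"
    using int by (intro nn_integral_PInf_AE) auto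
  then have ae: "AE x in unit_leb. summable (\<lambda>n. norm (?r n x))"
    by eventually_elim (intro summable_suminf_not_top, auto)
  have sm: "summable (\<lambda>n. \<integral>x. norm (?r n x) \<partial>unit_leb)" using assms by (simp add: norm_L1_def)
  let ?s = "\<lambda>x. \<Sum>n. ?r n x"
  have ints: "integrable unit_leb ?s" by (rule integrable_suminf[OF int ae sm])
  have tail: "norm (abs_L1 ?s - (\<Sum>i<n. g i)) \<le> (\<Sum>i. norm (g (i + n)))" for n
  proof -
    have sumAE: "AE x in unit_leb. rep_L1 (\<Sum>i<n. g i) x = (\<Sum>i<n. ?r i x)"
    proof (induction n)
      case 0 then show ?case using AE_rep_zero by simp
    next
      case (Suc n)
      show ?case using Suc AE_rep_plus[of "\<Sum>i<n. g i" "g n"] by eventually_elim simp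
    qed
    have ae': "AE x in unit_leb. summable (\<lambda>i. norm (?r (i + n) x))"
      using ae by eventually_elim (simp add: summable_iff_shift[of "\<lambda>i. norm (rep_L1 (g i) _)"])
    have sm': "summable (\<lambda>i. \<integral>x. norm (?r (i + n) x) \<partial>unit_leb)"
      using sm by (simp add: summable_iff_shift[of "\<lambda>i. \<integral>x. norm (?r i x) \<partial>unit_leb"])
    have int': "integrable unit_leb (\<lambda>x. \<Sum>i. norm (?r (i + n) x))"
      using int ae' sm' by (intro integrable_suminf) auto
    have "norm (abs_L1 ?s - (\<Sum>i<n. g i)) \<le> (\<integral>x. (\<Sum>i. norm (?r (i + n) x)) \<partial>unit_leb)"
      unfolding norm_L1_def
    proof (rule integral_mono_AE[OF _ int'])
      show "AE x in unit_leb. cmod (rep_L1 (abs_L1 ?s - (\<Sum>i<n. g i)) x) \<le> (\<Sum>i. norm (?r (i + n) x))"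
        using AE_rep_diff[of "abs_L1 ?s" "\<Sum>i<n. g i"] AE_rep_abs_L1[OF ints] sumAE ae ae'
      proof eventually_elim
        case (elim x)
        have "?s x - (\<Sum>i<n. ?r i x) = (\<Sum>i. ?r (i + n) x)"
          using suminf_minus_initial_segment[OF summable_norm_cancel[OF elim(4)]] by simp
        then show ?case using elim summable_norm[OF elim(5)] by simp
      qed
    qed (simp add: integrable_rep_L1)
    also have "\<dots> = (\<Sum>i. \<integral>x. norm (?r (i + n) x) \<partial>unit_leb)"
      using int ae' sm' by (intro integral_suminf) auto
    finally show ?thesis by (simp add: norm_L1_def)
  qed
  have "(\<lambda>n. \<Sum>i. norm (g (i + n))) \<longlonglongrightarrow> 0"
    using suminf_exist_split2[OF assms] .
  then have "(\<lambda>n. norm (abs_L1 ?s - (\<Sum>i<n. g i))) \<longlonglongrightarrow> 0"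
    by (rule Lim_null_comparison[rotated]) (simp add: tail)
  then have "(\<lambda>n. \<Sum>i<n. g i) \<longlonglongrightarrow> abs_L1 ?s"
    by (simp add: norm_minus_commute tendsto_norm_zero_iff LIM_zero_iff)
  then show ?thesis by blast
qed

instance L1 :: banach
proof
  fix X :: "nat \<Rightarrow> L1" assume X: "Cauchy X"
  have "\<exists>N. \<forall>m\<ge>N. norm (X m - X N) < (1/2) ^ n" for n
    using CauchyD[OF X, of "(1/2) ^ n"] by fastforce
  then obtain N where N: "\<And>n m. m \<ge> N n \<Longrightarrow> norm (X m - X (N n)) < (1/2) ^ n" by metis
  \<comment> \<open>A strictly increasing choice of indices beyond \<open>N n\<close>; the increments along it are summable.\<close>
  define \<sigma> where "\<sigma> n = (\<Sum>i\<le>n. N i + 1)" for n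
  have \<sigma>: "strict_mono \<sigma>" "N n \<le> \<sigma> n" for n
    unfolding \<sigma>_def
    by (rule strict_monoI_Suc, simp) (cases n; simp)
  define g where "g n = X (\<sigma> (Suc n)) - X (\<sigma> n)" for n
  have "norm (g n) \<le> 2 * (1/2) ^ n" for n
  proof -
    have "norm (g n) \<le> norm (X (\<sigma> (Suc n)) - X (N n)) + norm (X (\<sigma> n) - X (N n))"
      unfolding g_def using norm_triangle_ineq4[of "X (\<sigma> (Suc n)) - X (N n)" "X (\<sigma> n) - X (N n)"] by simp
    moreover have "N n \<le> \<sigma> (Suc n)" using \<sigma>(2)[of n] strict_monoD[OF \<sigma>(1), of n "Suc n"] by simp
    ultimately show ?thesis using N[OF \<sigma>(2)[of n]] N[of n "\<sigma> (Suc n)"] by simp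
  qed
  moreover have "summable (\<lambda>n. 2 * (1/2::real) ^ n)"
    by (rule summable_mult[OF summable_geometric]) simp
  ultimately have "summable (\<lambda>n. norm (g n))"
    using summable_comparison_test'[of "\<lambda>n. 2 * (1/2::real) ^ n" 0 "\<lambda>n. norm (g n)"] by simp
  then obtain h where "(\<lambda>n. \<Sum>i<n. g i) \<longlonglongrightarrow> h" using L1_absolutely_summable_converges by blast
  moreover have "(\<Sum>i<n. g i) = X (\<sigma> n) - X (\<sigma> 0)" for n
    unfolding g_def by (rule sum_lessThan_telescope)
  ultimately have "(\<lambda>n. X (\<sigma> n) - X (\<sigma> 0) + X (\<sigma> 0)) \<longlonglongrightarrow> h + X (\<sigma> 0)"
    by (intro tendsto_add) auto
  then have "(X \<circ> \<sigma>) \<longlonglongrightarrow> h + X (\<sigma> 0)" by (simp add: o_def)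
  then show "convergent X"
    using Cauchy_converges_subseq[OF X \<sigma>(1)] convergent_def by blast
qed

text \<open>
The equation \<open>\<xi> u - M u = g\<close> says that \<open>u\<close> is a fixed point of a contraction with factor \<open>\<rho> / |\<xi>|\<close>.
Uniqueness of the fixed point makes the solution linear in \<open>g\<close>.
\<close>

lemma resolvent_of_contraction:
  fixes M :: "L1 \<Rightarrow> L1"
  assumes lin: "\<And>h h'. M (h + h') = M h + M h'" "\<And>c h. M (scale_L1 c h) = scale_L1 c (M h)"
    and bd: "\<And>h. norm (M h) \<le> \<rho> * norm h" and \<xi>: "\<rho> < cmod \<xi>" "0 \<le> \<rho>"
  obtains R where "\<And>g. scale_L1 \<xi> (R g) - M (R g) = g"
    "\<And>g g'. R (g + g') = R g + R g'" "\<And>c g. R (scale_L1 c g) = scale_L1 c (R g)"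
    "\<And>g. norm (R g) \<le> 1 / (cmod \<xi> - \<rho>) * norm g"
proof -
  have \<xi>0: "\<xi> \<noteq> 0" using \<xi> by auto
  have Mdiff: "M (h - h') = M h - M h'" for h h' using lin(1)[of "h - h'" h'] by (simp add: algebra_simps)
  have "\<exists>!u. scale_L1 (1/\<xi>) (g + M u) = u" for g
  proof (rule banach_fix_type[of "\<rho> / cmod \<xi>"])
    show "0 \<le> \<rho> / cmod \<xi>" "\<rho> / cmod \<xi> < 1"
      using \<xi> by (simp_all add: divide_less_eq_1)
    show "\<forall>x y. dist (scale_L1 (1 / \<xi>) (g + M x)) (scale_L1 (1 / \<xi>) (g + M y))
        \<le> \<rho> / cmod \<xi> * dist x y"
    proof (intro allI)
      fix x y
      have "dist (scale_L1 (1 / \<xi>) (g + M x)) (scale_L1 (1 / \<xi>) (g + M y)) = norm (M (x - y)) / cmod \<xi>"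
        by (simp add: dist_norm L1.scale_right_diff_distrib[symmetric] norm_scale_L1 norm_divide Mdiff)
      also have "\<dots> \<le> \<rho> * norm (x - y) / cmod \<xi>" using bd by (intro divide_right_mono) auto
      finally show "dist (scale_L1 (1 / \<xi>) (g + M x)) (scale_L1 (1 / \<xi>) (g + M y)) \<le> \<rho> / cmod \<xi> * dist x y"
        by (simp add: dist_norm)
    qed
  qed
  moreover have "scale_L1 (1/\<xi>) (g + M u) = u \<longleftrightarrow> scale_L1 \<xi> u - M u = g" for g u
  proof
    assume "scale_L1 (1/\<xi>) (g + M u) = u"
    then have "scale_L1 \<xi> u = g + M u" using \<xi>0 by (metis L1.scale_scale L1.scale_one mult.commute nonzero_divide_eq_eq)
    then show "scale_L1 \<xi> u - M u = g" by simp
  next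
    assume "scale_L1 \<xi> u - M u = g"
    then have "g + M u = scale_L1 \<xi> u" by (simp add: algebra_simps)
    then show "scale_L1 (1/\<xi>) (g + M u) = u" using \<xi>0 by simp
  qed
  ultimately have ex1: "\<exists>!u. scale_L1 \<xi> u - M u = g" for g by simp
  define R where "R g = (THE u. scale_L1 \<xi> u - M u = g)" for g
  have R: "scale_L1 \<xi> (R g) - M (R g) = g" for g unfolding R_def by (rule theI'[OF ex1])
  have RI: "R g = u" if "scale_L1 \<xi> u - M u = g" for g u using ex1[of g] R[of g] that by blast
  show ?thesis
  proof (rule that[of R])
    show "scale_L1 \<xi> (R g) - M (R g) = g" for g by (rule R)
    show "R (g + g') = R g + R g'" for g g'
      using R[of g] R[of g'] by (intro RI) (simp add: lin L1.scale_right_distrib algebra_simps)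
    show "R (scale_L1 c g) = scale_L1 c (R g)" for c g
    proof (rule RI)
      have "scale_L1 \<xi> (scale_L1 c (R g)) - M (scale_L1 c (R g)) = scale_L1 c (scale_L1 \<xi> (R g) - M (R g))"
        by (simp add: lin L1.scale_right_diff_distrib mult.commute)
      then show "scale_L1 \<xi> (scale_L1 c (R g)) - M (scale_L1 c (R g)) = scale_L1 c g" using R by simp
    qed
    show "norm (R g) \<le> 1 / (cmod \<xi> - \<rho>) * norm g" for g
    proof -
      have "cmod \<xi> * norm (R g) = norm (g + M (R g))"
        using R[of g] by (metis norm_scale_L1 diff_add_cancel)
      also have "\<dots> \<le> norm g + \<rho> * norm (R g)" using norm_triangle_ineq[of g "M (R g)"] bd[of "R g"] by simp
      finally show ?thesis using \<xi> by (simp add: field_simps)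
    qed
  qed
qed


section \<open>Test functions and weak constancy\<close>

text \<open>
Differentiability of finite order admits induction on the order, with the derivative in the role
of the function; smoothness is then differentiability of every order.
\<close>

definition times_differentiable :: "nat \<Rightarrow> (real \<Rightarrow> real) \<Rightarrow> bool" where
  "times_differentiable n f \<longleftrightarrow> (\<forall>m<n. \<forall>x. (deriv ^^ m) f field_differentiable at x)"

abbreviation smooth :: "(real \<Rightarrow> real) \<Rightarrow> bool" where
  "smooth f \<equiv> \<forall>n x. (deriv ^^ n) f field_differentiable at x"

lemma smooth_iff: "smooth f \<longleftrightarrow> (\<forall>n. times_differentiable n f)"
  by (auto simp: times_differentiable_def)

lemma times_differentiable_0 [simp]: "times_differentiable 0 f"
  by (simp add: times_differentiable_def)

lemma times_differentiable_Suc: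
  "times_differentiable (Suc n) f \<longleftrightarrow> (\<forall>x. f field_differentiable at x) \<and> times_differentiable n (deriv f)"
proof -
  have "times_differentiable (Suc n) f \<longleftrightarrow>
      (\<forall>x. f field_differentiable at x) \<and> (\<forall>m<n. \<forall>x. (deriv ^^ Suc m) f field_differentiable at x)"
    unfolding times_differentiable_def All_less_Suc2 by simp
  then show ?thesis by (simp add: times_differentiable_def funpow_Suc_right del: funpow.simps)
qed

lemma times_differentiable_mono: "times_differentiable (Suc n) f \<Longrightarrow> times_differentiable n f"
  by (simp add: times_differentiable_def)

lemma times_differentiable_add:
  "times_differentiable n f \<Longrightarrow> times_differentiable n g \<Longrightarrow> times_differentiable n (\<lambda>x. f x + g x)"
proof (induction n arbitrary: f g)
  case (Suc n)
  then have "deriv (\<lambda>x. f x + g x) = (\<lambda>x. deriv f x + deriv g x)"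
    by (simp add: fun_eq_iff deriv_add times_differentiable_Suc)
  then show ?case using Suc by (simp add: times_differentiable_Suc field_differentiable_add)
qed simp

lemma times_differentiable_mult:
  "times_differentiable n f \<Longrightarrow> times_differentiable n g \<Longrightarrow> times_differentiable n (\<lambda>x. f x * g x)"
proof (induction n arbitrary: f g)
  case (Suc n)
  then have "deriv (\<lambda>x. f x * g x) = (\<lambda>x. f x * deriv g x + deriv f x * g x)"
    by (simp add: fun_eq_iff deriv_mult times_differentiable_Suc)
  moreover have "times_differentiable n (\<lambda>x. f x * deriv g x + deriv f x * g x)"
    using Suc by (intro times_differentiable_add Suc.IH times_differentiable_mono[of n f]
        times_differentiable_mono[of n g]) (simp_all add: times_differentiable_Suc)
  ultimately show ?case using Suc by (simp add: times_differentiable_Suc field_differentiable_mult)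
qed simp

lemma times_differentiable_const: "times_differentiable n (\<lambda>x. c)"
proof (induction n arbitrary: c)
  case (Suc n)
  have "deriv (\<lambda>x. c) = (\<lambda>x. 0)" by (simp add: fun_eq_iff)
  then show ?case using Suc by (simp add: times_differentiable_Suc)
qed simp

lemma smooth_add: "smooth f \<Longrightarrow> smooth g \<Longrightarrow> smooth (\<lambda>x. f x + g x)"
  and smooth_mult: "smooth f \<Longrightarrow> smooth g \<Longrightarrow> smooth (\<lambda>x. f x * g x)"
  and smooth_const: "smooth (\<lambda>x. c)"
  unfolding smooth_iff
  by (simp_all add: times_differentiable_add times_differentiable_mult times_differentiable_const)

lemma smooth_deriv: "smooth f \<Longrightarrow> smooth (deriv f)"
  unfolding smooth_iff using times_differentiable_Suc by blast

lemma smooth_higher_deriv: "smooth f \<Longrightarrow> smooth ((deriv ^^ m) f)"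
proof (induction m)
  case (Suc m)
  have "smooth (deriv ((deriv ^^ m) f))" using Suc.IH[OF Suc.prems] by (rule smooth_deriv)
  then show ?case by simp
qed simp

lemma smooth_has_derivative: "smooth f \<Longrightarrow> (f has_real_derivative deriv f x) (at x)"
  by (metis DERIV_deriv_iff_field_differentiable funpow_0)

lemma smooth_continuous_on: "smooth f \<Longrightarrow> continuous_on S f"
  by (meson DERIV_continuous continuous_at_imp_continuous_on smooth_has_derivative)

lemma higher_deriv_affine:
  assumes "smooth f"
  shows "(deriv ^^ n) (\<lambda>x. f (t + c * x)) = (\<lambda>x. c ^ n * (deriv ^^ n) f (t + c * x))"
proof (induction n)
  case (Suc n)
  have "((\<lambda>x. c ^ n * (deriv ^^ n) f (t + c * x)) has_real_derivative
      c ^ Suc n * (deriv ^^ Suc n) f (t + c * x)) (at x)" for x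
  proof -
    have d: "((deriv ^^ n) f has_real_derivative (deriv ^^ Suc n) f (t + c * x)) (at (t + c * x))"
      using smooth_has_derivative[OF smooth_higher_deriv[OF assms]] by simp
    have "((\<lambda>x. t + c * x) has_real_derivative c) (at x)"
      by (auto intro!: derivative_eq_intros)
    from DERIV_cmult[OF DERIV_chain2[where g = "\<lambda>x. t + c * x", OF d this], of "c ^ n"]
    show ?thesis by (simp add: mult_ac)
  qed
  then have "deriv (\<lambda>x. c ^ n * (deriv ^^ n) f (t + c * x)) = (\<lambda>x. c ^ Suc n * (deriv ^^ Suc n) f (t + c * x))"
    by (intro ext DERIV_imp_deriv)
  then show ?case using Suc by simp
qed simp

lemma smooth_affine:
  assumes "smooth f" shows "smooth (\<lambda>x. f (t + c * x))"
proof (intro allI)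
  fix n x
  have "((deriv ^^ n) f has_real_derivative (deriv ^^ Suc n) f (t + c * x)) (at (t + c * x))"
    using smooth_has_derivative[OF smooth_higher_deriv[OF assms]] by simp
  then have "((\<lambda>x. c ^ n * (deriv ^^ n) f (t + c * x)) has_real_derivative
      c ^ n * ((deriv ^^ Suc n) f (t + c * x) * c)) (at x)"
    by (intro DERIV_cmult DERIV_chain2[where g = "\<lambda>x. t + c * x"]) (auto intro!: derivative_eq_intros)
  then show "(deriv ^^ n) (\<lambda>x. f (t + c * x)) field_differentiable at x"
    unfolding higher_deriv_affine[OF assms] field_differentiable_def by blast
qed

text \<open>
The function \<open>exp (- 1 / x)\<close>, extended by zero to the left, together with a polynomial factor
in \<open>1 / x\<close>: with this factor the family is closed under differentiation, also at zero.
\<close>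

definition flat_exp :: "real poly \<Rightarrow> real \<Rightarrow> real" where
  "flat_exp p x = (if x > 0 then poly p (1 / x) * exp (- (1 / x)) else 0)"

lemma poly_times_exp_neg_tendsto_0: "((\<lambda>y::real. poly p y * exp (- y)) \<longlongrightarrow> 0) at_top"
proof -
  have "((\<lambda>y::real. \<Sum>i\<le>Polynomial.degree p. coeff p i * (y ^ i / exp y)) \<longlongrightarrow> (\<Sum>i\<le>Polynomial.degree p. coeff p i * 0)) at_top"
    by (intro tendsto_intros tendsto_power_div_exp_0)
  then show ?thesis
    by (simp add: poly_altdef sum_distrib_right exp_minus field_simps sum_divide_distrib)
qed

lemma flat_exp_has_derivative:
  "(flat_exp p has_real_derivative flat_exp ([:0, 0, 1:] * (p - pderiv p)) x) (at x)"
proof -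
  let ?q = "[:0, 0, 1:] * (p - pderiv p)"
  consider "x > 0" | "x < 0" | "x = 0" by linarith
  then show ?thesis
  proof cases
    case 1
    have "((\<lambda>x. poly p (1 / x) * exp (- (1 / x))) has_real_derivative flat_exp ?q x) (at x)"
      using 1 unfolding flat_exp_def
      by (auto intro!: derivative_eq_intros DERIV_chain2[OF poly_DERIV] simp: field_simps power2_eq_square)
    then show ?thesis
      by (rule has_field_derivative_transform_within_open[where S = "{0<..}"]) (use 1 in \<open>auto simp: flat_exp_def\<close>)
  next
    case 2
    have "((\<lambda>x. 0) has_real_derivative 0) (at x)" by simp
    then have "(flat_exp p has_real_derivative 0) (at x)"
      by (rule has_field_derivative_transform_within_open[where S = "{..<0}"]) (use 2 in \<open>auto simp: flat_exp_def\<close>)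
    then show ?thesis using 2 by (simp add: flat_exp_def)
  next
    case 3
    have "((\<lambda>h. poly ([:0,1:] * p) (inverse h) * exp (- inverse h)) \<longlongrightarrow> 0) (at_right (0::real))"
      by (rule filterlim_compose[OF poly_times_exp_neg_tendsto_0 filterlim_inverse_at_top_right])
    then have "((\<lambda>h. flat_exp p h / h) \<longlongrightarrow> 0) (at_right (0::real))"
      by (rule Lim_transform_eventually)
        (auto simp: flat_exp_def eventually_at_right_field field_simps intro: exI[of _ 1])
    moreover have "((\<lambda>h. flat_exp p h / h) \<longlongrightarrow> 0) (at_left (0::real))"
      by (rule Lim_transform_eventually[OF tendsto_const])
        (auto simp: flat_exp_def eventually_at_left_field intro: exI[of _ "-1"])
    ultimately have "((\<lambda>h. flat_exp p h / h) \<longlongrightarrow> 0) (at (0::real))"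
      by (simp add: filterlim_split_at)
    then show ?thesis using 3 by (simp add: DERIV_def flat_exp_def)
  qed
qed

lemma smooth_flat_exp: "smooth (flat_exp p)"
proof -
  have "times_differentiable n (flat_exp p)" for n
  proof (induction n arbitrary: p)
    case (Suc n)
    have "deriv (flat_exp p) = flat_exp ([:0, 0, 1:] * (p - pderiv p))"
      using DERIV_imp_deriv[OF flat_exp_has_derivative] by blast
    then show ?case
      using Suc flat_exp_has_derivative by (auto simp: times_differentiable_Suc field_differentiable_def)
  qed simp
  then show ?thesis by (simp add: smooth_iff)
qed

text \<open>
The support is compact in an open interval exactly if two interior points bound it. In this form
sums, substitutions and antiderivatives are easily recognised as test functions.
\<close>

lemma test_function_interval_iff:
  assumes "a < b"
  shows "test_function {a<..<b} \<phi> \<longleftrightarrow>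
    smooth \<phi> \<and> (\<exists>c d. a < c \<and> c < d \<and> d < b \<and> (\<forall>x. x \<notin> {c..d} \<longrightarrow> \<phi> x = 0))"
proof
  assume \<phi>: "test_function {a<..<b} \<phi>"
  let ?K = "closure {x. \<phi> x \<noteq> 0}"
  \<comment> \<open>The two added points ensure that \<open>K\<close> is nonempty and its bounds are distinct.\<close>
  define K where "K = insert ((2*a+b)/3) (insert ((a+2*b)/3) ?K)"
  have K: "compact K" "K \<subseteq> {a<..<b}" "K \<noteq> {}"
    using \<phi> assms by (auto simp: test_function_def K_def compact_insert)
  obtain c where c: "c \<in> K" "\<And>x. x \<in> K \<Longrightarrow> c \<le> x" using compact_attains_inf[OF K(1,3)] by blast
  obtain d where d: "d \<in> K" "\<And>x. x \<in> K \<Longrightarrow> x \<le> d" using compact_attains_sup[OF K(1,3)] by blast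
  have "c \<le> (2*a+b)/3" "(a+2*b)/3 \<le> d" by (rule c(2) d(2); simp add: K_def)+
  then have "a < c" "d < b" "c < d" using c d K(2) assms by (auto simp: field_simps)
  moreover have "\<phi> x = 0" if "x \<notin> {c..d}" for x
    using that c(2) d(2) closure_subset[of "{x. \<phi> x \<noteq> 0}"] by (auto simp: K_def)
  ultimately show "smooth \<phi> \<and> (\<exists>c d. a < c \<and> c < d \<and> d < b \<and> (\<forall>x. x \<notin> {c..d} \<longrightarrow> \<phi> x = 0))"
    using \<phi> unfolding test_function_def by blast
next
  assume "smooth \<phi> \<and> (\<exists>c d. a < c \<and> c < d \<and> d < b \<and> (\<forall>x. x \<notin> {c..d} \<longrightarrow> \<phi> x = 0))"
  then obtain c d where cd: "smooth \<phi>" "a < c" "c < d" "d < b" "\<And>x. x \<notin> {c..d} \<Longrightarrow> \<phi> x = 0" by blast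
  have "closure {x. \<phi> x \<noteq> 0} \<subseteq> {c..d}" using cd(5) by (intro closure_minimal) (auto, meson, meson)
  then show "test_function {a<..<b} \<phi>"
    using cd bounded_subset[OF bounded_closed_interval, of "{x. \<phi> x \<noteq> 0}" c d]
      closure_subset[of "{x. \<phi> x \<noteq> 0}"] unfolding test_function_def compact_closure by auto
qed

lemma test_function_smooth: "test_function U \<phi> \<Longrightarrow> smooth \<phi>"
  by (simp add: test_function_def)

lemma test_function_outside: "test_function U \<phi> \<Longrightarrow> x \<notin> U \<Longrightarrow> \<phi> x = 0"
  using closure_subset[of "{x. \<phi> x \<noteq> 0}"] by (auto simp: test_function_def)

lemma test_function_deriv:
  assumes "test_function U \<phi>" shows "test_function U (deriv \<phi>)"
proof -
  let ?K = "closure {x. \<phi> x \<noteq> 0}"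
  have "deriv \<phi> x = 0" if x: "x \<notin> ?K" for x
  proof -
    have "((\<lambda>x. 0) has_real_derivative 0) (at x)" by simp
    then have "(\<phi> has_real_derivative 0) (at x)"
      by (rule has_field_derivative_transform_within_open[where S = "- ?K"])
        (use x closure_subset[of "{x. \<phi> x \<noteq> 0}"] in auto)
    then show ?thesis by (rule DERIV_imp_deriv)
  qed
  then have "closure {x. deriv \<phi> x \<noteq> 0} \<subseteq> ?K" by (intro closure_minimal) auto
  moreover have "compact ?K" "?K \<subseteq> U" "smooth \<phi>" using assms by (auto simp: test_function_def)
  moreover have "compact (closure {x. deriv \<phi> x \<noteq> 0})"
    using calculation(1) bounded_subset[OF compact_imp_bounded[OF calculation(2)], of "{x. deriv \<phi> x \<noteq> 0}"]
      closure_subset[of "{x. deriv \<phi> x \<noteq> 0}"] by (auto simp: compact_closure)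
  ultimately show ?thesis unfolding test_function_def using smooth_deriv[of \<phi>] by blast
qed

lemma test_function_higher_deriv: "test_function U \<phi> \<Longrightarrow> test_function U ((deriv ^^ n) \<phi>)"
  by (induction n) (auto intro: test_function_deriv)

lemma test_function_bounded:
  assumes "test_function U \<phi>" obtains B where "\<And>x. \<bar>\<phi> x\<bar> \<le> B"
proof -
  let ?K = "closure {x. \<phi> x \<noteq> 0}"
  have "bounded (\<phi> ` ?K)"
    using assms smooth_continuous_on[OF test_function_smooth[OF assms]]
    by (intro compact_imp_bounded compact_continuous_image) (auto simp: test_function_def)
  then obtain B where B: "\<And>x. x \<in> ?K \<Longrightarrow> \<bar>\<phi> x\<bar> \<le> B" by (auto simp: bounded_iff)
  have "\<bar>\<phi> x\<bar> \<le> max B 0" for x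
    using B[of x] closure_subset[of "{x. \<phi> x \<noteq> 0}"] by (cases "\<phi> x = 0") auto
  then show ?thesis using that by blast
qed

lemma test_function_measurable: "test_function U \<phi> \<Longrightarrow> \<phi> \<in> borel_measurable borel"
  by (intro borel_measurable_continuous_onI smooth_continuous_on test_function_smooth)

lemma test_function_measurable_lebesgue_on [measurable_dest]:
  "test_function U \<phi> \<Longrightarrow> \<phi> \<in> borel_measurable (lebesgue_on S)"
  using test_function_measurable[of U \<phi>]
  by (intro measurable_restrict_space1 measurable_completion) simp

lemma integrable_times_test_function:
  fixes u :: "real \<Rightarrow> complex"
  assumes "integrable (lebesgue_on S) u" "test_function U \<phi>"
  shows "integrable (lebesgue_on S) (\<lambda>x. u x * of_real (\<phi> x))"
proof -
  obtain B where B: "\<And>x. \<bar>\<phi> x\<bar> \<le> B" using test_function_bounded[OF assms(2)] by blast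
  show ?thesis
  proof (rule Bochner_Integration.integrable_bound)
    show "integrable (lebesgue_on S) (\<lambda>x. B * cmod (u x))" using assms(1) by simp
    show "(\<lambda>x. u x * complex_of_real (\<phi> x)) \<in> borel_measurable (lebesgue_on S)"
      using assms(1) test_function_measurable_lebesgue_on[OF assms(2), of S] by measurable
    show "AE x in lebesgue_on S. norm (u x * complex_of_real (\<phi> x)) \<le> norm (B * cmod (u x))"
      using B order_trans[OF abs_ge_zero B] by (intro AE_I2) (auto simp: norm_mult abs_mult mult.commute intro: mult_right_mono)
  qed
qed


text \<open>
With growing \<open>n\<close> both factors tend to \<open>1\<close> inside the interval and are zero outside, so that the
indicator of the interval is a bounded limit of test functions.
\<close>

definition bump :: "real \<Rightarrow> real \<Rightarrow> nat \<Rightarrow> real \<Rightarrow> real" where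
  "bump s t n x = flat_exp 1 (real (Suc n) * (x - s)) * flat_exp 1 (real (Suc n) * (t - x))"

lemma test_function_bump:
  assumes "a < s" "s < t" "t < b"
  shows "test_function {a<..<b} (bump s t n)"
proof -
  have "smooth (bump s t n)"
  proof -
    have "bump s t n = (\<lambda>x. flat_exp 1 (- (real (Suc n) * s) + real (Suc n) * x) *
        flat_exp 1 (real (Suc n) * t + - real (Suc n) * x))"
      by (simp add: fun_eq_iff bump_def algebra_simps)
    then show ?thesis by (simp only:) (intro smooth_mult smooth_affine smooth_flat_exp)
  qed
  moreover have "bump s t n x = 0" if "x \<notin> {s..t}" for x
    using that by (auto simp: bump_def flat_exp_def zero_less_mult_iff)
  ultimately show ?thesis using assms test_function_interval_iff[of a b] by (meson less_trans)
qed

lemma bump_bounds: "0 \<le> bump s t n x" "bump s t n x \<le> 1"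
  by (auto simp: bump_def flat_exp_def intro!: mult_le_one)

lemma bump_tendsto_indicator: "(\<lambda>n. bump s t n x) \<longlonglongrightarrow> indicator {s<..<t} x"
proof (cases "x \<in> {s<..<t}")
  case True
  have lim: "(\<lambda>n. exp (- (1 / (real (Suc n) * y)))) \<longlonglongrightarrow> 1" if "y > 0" for y :: real
  proof -
    have "(\<lambda>n. exp (- ((1 / y) * inverse (real (Suc n))))) \<longlonglongrightarrow> exp (- ((1/y) * 0))"
      by (intro tendsto_intros LIMSEQ_inverse_real_of_nat)
    then show ?thesis by (simp add: field_simps)
  qed
  have "bump s t n x = exp (- (1 / (real (Suc n) * (x - s)))) * exp (- (1 / (real (Suc n) * (t - x))))" for n
    using True unfolding bump_def flat_exp_def by (simp add: zero_less_mult_iff)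
  then show ?thesis using tendsto_mult[OF lim[of "x - s"] lim[of "t - x"]] True by simp
next
  case False
  have "bump s t n x = 0" for n
    using False by (auto simp: bump_def flat_exp_def zero_less_mult_iff)
  then show ?thesis using False by simp
qed

lemma integrable_lebesgue_on_iff:
  fixes f :: "real \<Rightarrow> 'a::{banach, second_countable_topology}"
  shows "S \<in> sets lebesgue \<Longrightarrow>
    integrable (lebesgue_on S) f \<longleftrightarrow> integrable lebesgue (\<lambda>x. indicator S x *\<^sub>R f x)"
  by (rule integrable_restrict_space) simp

lemma integral_lebesgue_on:
  fixes f :: "real \<Rightarrow> 'a::{banach, second_countable_topology}"
  shows "S \<in> sets lebesgue \<Longrightarrow>
    (\<integral>x. f x \<partial>lebesgue_on S) = (\<integral>x. indicator S x *\<^sub>R f x \<partial>lebesgue)"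
  by (rule integral_restrict_space) simp

lemma bump_integral_tendsto:
  fixes u :: "real \<Rightarrow> complex"
  assumes "integrable (lebesgue_on {a<..<b}) u" "a < s" "s < t" "t < b"
  shows "(\<lambda>n. \<integral>x. u x * of_real (bump s t n x) \<partial>lebesgue_on {a<..<b}) \<longlonglongrightarrow>
    (\<integral>x. u x * of_real (indicator {s<..<t} x) \<partial>lebesgue_on {a<..<b})"
proof (rule integral_dominated_convergence[where w = "\<lambda>x. norm (u x)"])
  have [measurable]: "u \<in> borel_measurable (lebesgue_on {a<..<b})" using assms(1) by simp
  have [measurable]: "{s<..<t} \<in> sets (lebesgue_on {a<..<b})"
    using assms by (auto simp: sets_restrict_space_iff)
  show "(\<lambda>x. u x * of_real (indicator {s<..<t} x)) \<in> borel_measurable (lebesgue_on {a<..<b})"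
    by measurable
  show "(\<lambda>x. u x * of_real (bump s t n x)) \<in> borel_measurable (lebesgue_on {a<..<b})" for n
    using test_function_measurable_lebesgue_on[OF test_function_bump[OF assms(2-4)]] by measurable
  show "integrable (lebesgue_on {a<..<b}) (\<lambda>x. norm (u x))" using assms(1) by simp
  show "AE x in lebesgue_on {a<..<b}. (\<lambda>n. u x * of_real (bump s t n x)) \<longlonglongrightarrow> u x * of_real (indicator {s<..<t} x)"
    by (intro AE_I2 tendsto_intros bump_tendsto_indicator)
  show "AE x in lebesgue_on {a<..<b}. norm (u x * of_real (bump s t n x)) \<le> norm (u x)" for n
    using bump_bounds[of s t n] by (intro AE_I2) (auto simp: norm_mult mult_left_le)
qed

text \<open>
By Lebesgue's differentiation theorem \<open>u x\<close> is almost everywhere the limit of its means over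
\<open>{x..x + h}\<close>, which all vanish for small \<open>h\<close>.
\<close>

lemma AE_zero_if_interval_integrals_zero:
  fixes u :: "real \<Rightarrow> complex"
  assumes u: "integrable (lebesgue_on {a<..<b}) u"
    and zero: "\<And>s t. a < s \<Longrightarrow> s < t \<Longrightarrow> t < b \<Longrightarrow>
      (\<integral>x. u x * of_real (indicator {s<..<t} x) \<partial>lebesgue_on {a<..<b}) = 0"
  shows "AE x in lebesgue_on {a<..<b}. u x = 0"
proof -
  define U where "U x = indicator {a<..<b} x *\<^sub>R u x" for x
  have U: "integrable lebesgue U"
    using u integrable_lebesgue_on_iff[of "{a<..<b}" u] by (simp add: U_def[abs_def])
  have U_on: "U absolutely_integrable_on S" if "S \<in> sets lebesgue" for S
    unfolding set_integrable_def by (rule integrable_mult_indicator[OF that U])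
  have "U integrable_on cbox c d" for c d
    by (rule set_lebesgue_integral_eq_integral(1)[OF U_on]) simp
  then obtain Z where Z: "negligible Z" "\<And>x e. \<lbrakk>x \<notin> Z; 0 < e\<rbrakk> \<Longrightarrow> \<exists>d>0. \<forall>h. 0 < h \<and> h < d \<longrightarrow>
       norm (integral (cbox x (x + h *\<^sub>R One)) U /\<^sub>R h ^ DIM(real) - U x) < e"
    using integrable_ccontinuous_explicit[of U] by blast
  have zero': "integral {s..t} U = 0" if "a < s" "s < t" "t < b" for s t
  proof -
    have "integral {s..t} U = integral {s<..<t} U"
      using integral_open_interval_real[of s t U] by simp
    also have "\<dots> = (LINT x:{s<..<t}|lebesgue. U x)"
      using set_lebesgue_integral_eq_integral(2)[OF U_on[of "{s<..<t}"]] by simp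
    also have "\<dots> = (\<integral>x. indicator {a<..<b} x *\<^sub>R (u x * of_real (indicator {s<..<t} x)) \<partial>lebesgue)"
      unfolding set_lebesgue_integral_def using that
      by (intro Bochner_Integration.integral_cong) (auto simp: U_def indicator_def)
    also have "\<dots> = (\<integral>x. u x * of_real (indicator {s<..<t} x) \<partial>lebesgue_on {a<..<b})"
      by (rule integral_lebesgue_on[symmetric]) simp
    finally show ?thesis using zero[OF that] by simp
  qed
  have "u x = 0" if x: "x \<in> {a<..<b}" "x \<notin> Z" for x
  proof (rule ccontr)
    assume ne: "u x \<noteq> 0"
    then obtain d where d: "d > 0" "\<And>h. 0 < h \<Longrightarrow> h < d \<Longrightarrow>
       norm (integral (cbox x (x + h *\<^sub>R One)) U /\<^sub>R h ^ DIM(real) - U x) < norm (u x)"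
      using Z(2)[OF x(2), of "norm (u x)"] by auto
    define h where "h = min (d/2) ((b-x)/2)"
    have h: "0 < h" "h < d" "x + h < b" using d x by (auto simp: h_def min_def field_simps)
    then have "integral {x..x+h} U = 0" using zero'[of x "x+h"] x by simp
    then show False using d(2)[OF h(1,2)] x by (simp add: U_def)
  qed
  moreover have "AE x in lebesgue. x \<notin> Z"
    using Z(1) by (intro AE_not_in) (simp add: negligible_iff_null_sets)
  ultimately have "AE x in lebesgue. x \<in> {a<..<b} \<longrightarrow> u x = 0"
    by (auto elim: AE_mp)
  then show ?thesis by (simp add: AE_restrict_space_iff)
qed

lemma fundamental_lemma_calculus_of_variations:
  fixes u :: "real \<Rightarrow> complex"
  assumes u: "integrable (lebesgue_on {a<..<b}) u"
    and zero: "\<And>\<phi>. test_function {a<..<b} \<phi> \<Longrightarrow> (\<integral>x. u x * of_real (\<phi> x) \<partial>lebesgue_on {a<..<b}) = 0"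
  shows "AE x in lebesgue_on {a<..<b}. u x = 0"
proof (rule AE_zero_if_interval_integrals_zero[OF u])
  fix s t assume "a < s" "s < t" "t < b"
  then show "(\<integral>x. u x * of_real (indicator {s<..<t} x) \<partial>lebesgue_on {a<..<b}) = 0"
    using bump_integral_tendsto[OF u, of s t] zero[OF test_function_bump[of a s t b]]
    by (simp add: LIMSEQ_const_iff)
qed

lemma test_function_integral_eq:
  assumes "test_function {a<..<b} \<psi>" "\<And>x. x \<notin> {c..d} \<Longrightarrow> \<psi> x = 0" "a < c" "d < b"
  shows "(\<integral>x. \<psi> x \<partial>lebesgue_on {a<..<b}) = integral {c..d} \<psi>"
proof -
  have cont: "continuous_on {c..d} \<psi>"
    using assms(1) smooth_continuous_on test_function_smooth by blast
  have "integrable (lebesgue_on {c..d}) \<psi>"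
    by (rule continuous_imp_integrable_real[OF cont])
  moreover have "(\<integral>x. \<psi> x \<partial>lebesgue_on {a<..<b}) = (\<integral>x. \<psi> x \<partial>lebesgue_on {c..d})"
  proof -
    have "(\<lambda>x. indicator {a<..<b} x *\<^sub>R \<psi> x) = (\<lambda>x. indicator {c..d} x *\<^sub>R \<psi> x)"
      using assms by (auto simp: fun_eq_iff indicator_def)
    then show ?thesis
      using integral_lebesgue_on[of "{a<..<b}" \<psi>] integral_lebesgue_on[of "{c..d}" \<psi>] by simp
  qed
  ultimately show ?thesis using lebesgue_integral_eq_integral[of "{c..d}" \<psi>] by simp
qed

text \<open>
The antiderivative that vanishes to the left of the support is constant to the right of it, and this
constant is the integral of \<open>\<psi>\<close>.
\<close>

lemma test_function_antiderivative:
  assumes ab: "a < b" and \<psi>: "test_function {a<..<b} \<psi>" "(\<integral>x. \<psi> x \<partial>lebesgue_on {a<..<b}) = 0"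
  obtains \<Phi> where "test_function {a<..<b} \<Phi>" "deriv \<Phi> = \<psi>"
proof -
  note sm = test_function_smooth[OF \<psi>(1)]
  obtain c d where cd: "a < c" "c < d" "d < b" "\<And>x. x \<notin> {c..d} \<Longrightarrow> \<psi> x = 0"
    using \<psi>(1) test_function_interval_iff[OF ab] by blast
  have "isCont \<psi> x" for x using smooth_has_derivative[OF sm] DERIV_isCont by blast
  then obtain F where F: "\<And>x. (F has_vector_derivative \<psi> x) (at x)"
    using einterval_antiderivative[of "-\<infinity>" "\<infinity>" \<psi>] by auto
  have FTC: "integral {x..y} \<psi> = F y - F x" if "x \<le> y" for x y
    using fundamental_theorem_of_calculus[OF that, of F \<psi>] F has_vector_derivative_at_within by blast
  define \<Phi> where "\<Phi> x = F x - F c" for x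
  have D: "(\<Phi> has_real_derivative \<psi> x) (at x)" for x
    using F[of x] unfolding \<Phi>_def by (auto intro!: derivative_eq_intros simp: has_real_derivative_iff_has_vector_derivative)
  have d: "deriv \<Phi> = \<psi>" using DERIV_imp_deriv[OF D] by blast
  have "times_differentiable n \<psi>" for n using sm smooth_iff by blast
  then have "times_differentiable n \<Phi>" for n
    using D by (cases n) (auto simp: times_differentiable_Suc d field_differentiable_def)
  then have sm\<Phi>: "smooth \<Phi>" by (simp add: smooth_iff)
  have low: "\<Phi> x = 0" if "x < c" for x
  proof -
    have "integral {x..c} \<psi> = integral {x..c} (\<lambda>x. 0)"
      by (rule integral_spike[of "{c}"]) (use cd that in auto)
    then show ?thesis using FTC[of x c] that by (simp add: \<Phi>_def)
  qed
  have top: "\<Phi> d = 0"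
    using test_function_integral_eq[OF \<psi>(1) cd(4) cd(1,3)] \<psi>(2) FTC[of c d] cd by (simp add: \<Phi>_def)
  have high: "\<Phi> x = 0" if "x > d" for x
  proof -
    have "integral {d..x} \<psi> = integral {d..x} (\<lambda>x. 0)"
      by (rule integral_spike[of "{d}"]) (use cd that in auto)
    then show ?thesis using FTC[of d x] that top by (simp add: \<Phi>_def)
  qed
  have "\<forall>x. x \<notin> {c..d} \<longrightarrow> \<Phi> x = 0" using low high by (simp add: not_le)
  then have "test_function {a<..<b} \<Phi>"
    unfolding test_function_interval_iff[OF ab] using sm\<Phi> cd(1-3) by blast
  then show ?thesis using d that by blast
qed

text \<open>
Subtracting from a test function the right multiple of a fixed one makes its integral zero, and
then it is a derivative, on which \<open>u\<close> vanishes. So \<open>u\<close> acts on test functions like a constant.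
\<close>

lemma du_bois_reymond:
  fixes u :: "real \<Rightarrow> complex"
  assumes ab: "a < b" and u: "integrable (lebesgue_on {a<..<b}) u"
    and zero: "\<And>\<phi>. test_function {a<..<b} \<phi> \<Longrightarrow> (\<integral>x. u x * of_real (deriv \<phi> x) \<partial>lebesgue_on {a<..<b}) = 0"
  shows "\<exists>c. AE x in lebesgue_on {a<..<b}. u x = c"
proof -
  let ?J = "{a<..<b}"
  have one: "integrable (lebesgue_on ?J) (\<lambda>x. 1::complex)"
    by (simp add: finite_measure.integrable_const finite_measure_lebesgue_on)
  define s t where "s = (2*a+b)/3" and "t = (a+2*b)/3"
  have st: "a < s" "s < t" "t < b" using ab by (auto simp: s_def t_def field_simps)
  have "\<exists>n. (\<integral>x. bump s t n x \<partial>lebesgue_on ?J) \<noteq> 0"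
  proof (rule ccontr)
    assume "\<not> ?thesis"
    then have "(\<integral>x. 1 * of_real (bump s t n x) \<partial>lebesgue_on ?J) = (0::complex)" for n by simp
    then have "(\<integral>x. 1 * of_real (indicator {s<..<t} x) \<partial>lebesgue_on ?J) = (0::complex)"
      using bump_integral_tendsto[OF one st] by (simp add: LIMSEQ_const_iff)
    then have "(\<integral>x. indicator {s<..<t} x \<partial>lebesgue_on ?J) = (0::real)" by simp
    moreover have "(\<integral>x. indicator {s<..<t} x \<partial>lebesgue_on ?J) = measure (lebesgue_on ?J) {s<..<t}"
      using st by (simp add: space_restrict_space Int_absorb2 subset_eq)
    moreover have "measure (lebesgue_on ?J) {s<..<t} = t - s"
      using st by (subst measure_restrict_space) (auto simp: subset_eq)
    ultimately show False using st by simp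
  qed
  then obtain n where n: "(\<integral>x. bump s t n x \<partial>lebesgue_on ?J) \<noteq> 0" by blast
  define I where "I = (\<integral>x. bump s t n x \<partial>lebesgue_on ?J)"
  note bump = test_function_bump[OF st, of n]
  have int\<psi>: "integrable (lebesgue_on ?J) \<psi>" if "test_function ?J \<psi>" for \<psi>
    using integrable_Re[OF integrable_times_test_function[OF one that]] by simp
  \<comment> \<open>The value that \<open>u\<close> must have, by testing it with the bump of integral \<open>I\<close>.\<close>
  define c where "c = (\<integral>x. u x * of_real (bump s t n x) \<partial>lebesgue_on ?J) / of_real I"
  have "AE x in lebesgue_on ?J. u x - c = 0"
  proof (rule fundamental_lemma_calculus_of_variations)
    show "integrable (lebesgue_on ?J) (\<lambda>x. u x - c)"
      using u by (intro Bochner_Integration.integrable_diff) (simp_all add: finite_measure.integrable_const finite_measure_lebesgue_on)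
    fix \<psi> assume \<psi>: "test_function ?J \<psi>"
    define m where "m = (\<integral>x. \<psi> x \<partial>lebesgue_on ?J)"
    define \<eta> where "\<eta> x = \<psi> x + (- (m / I)) * bump s t n x" for x
    have "test_function ?J \<eta>"
    proof -
      obtain p q where pq: "a < p" "p < q" "q < b" "\<And>x. x \<notin> {p..q} \<Longrightarrow> \<psi> x = 0"
        using \<psi> test_function_interval_iff[OF ab] by blast
      obtain p' q' where pq': "a < p'" "p' < q'" "q' < b" "\<And>x. x \<notin> {p'..q'} \<Longrightarrow> bump s t n x = 0"
        using bump test_function_interval_iff[OF ab] by blast
      have "smooth \<eta>" unfolding \<eta>_def
        by (intro smooth_add smooth_mult smooth_const test_function_smooth[OF \<psi>] test_function_smooth[OF bump])
      moreover have "\<eta> x = 0" if "x \<notin> {min p p'..max q q'}" for x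
      proof -
        have "x \<notin> {p..q}" "x \<notin> {p'..q'}" using that by auto
        then show ?thesis using pq(4) pq'(4) by (simp add: \<eta>_def)
      qed
      moreover have "a < min p p'" "min p p' < max q q'" "max q q' < b" using pq pq' by auto
      ultimately show ?thesis unfolding test_function_interval_iff[OF ab] by blast
    qed
    moreover have "(\<integral>x. \<eta> x \<partial>lebesgue_on ?J) = 0"
      using n int\<psi>[OF \<psi>] int\<psi>[OF bump] by (simp add: \<eta>_def m_def I_def)
    ultimately obtain \<Phi> where \<Phi>: "test_function ?J \<Phi>" "deriv \<Phi> = \<eta>"
      using test_function_antiderivative[OF ab] by blast
    have i1: "integrable (lebesgue_on ?J) (\<lambda>x. u x * of_real (\<psi> x))"
      and i2: "integrable (lebesgue_on ?J) (\<lambda>x. u x * of_real (bump s t n x))"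
      using integrable_times_test_function[OF u] \<psi> bump by blast+
    have "0 = (\<integral>x. u x * of_real (\<psi> x) - of_real (m / I) * (u x * of_real (bump s t n x)) \<partial>lebesgue_on ?J)"
      using zero[OF \<Phi>(1)] by (simp add: \<Phi>(2) \<eta>_def algebra_simps)
    also have "\<dots> = (\<integral>x. u x * of_real (\<psi> x) \<partial>lebesgue_on ?J) - of_real m * c"
      using i1 i2 by (simp add: c_def)
    finally have "(\<integral>x. u x * of_real (\<psi> x) \<partial>lebesgue_on ?J) = c * of_real m" by simp
    moreover have "(\<integral>x. c * of_real (\<psi> x) \<partial>lebesgue_on ?J) = c * of_real m"
      by (simp add: m_def)
    ultimately show "(\<integral>x. (u x - c) * of_real (\<psi> x) \<partial>lebesgue_on ?J) = 0"
      using i1 int\<psi>[OF \<psi>] by (auto simp: left_diff_distrib)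
  qed
  then show ?thesis by auto
qed


section \<open>Weak derivatives on a partition into intervals\<close>

lemma integrable_lebesgue_on_subset:
  fixes u :: "real \<Rightarrow> 'a::{banach, second_countable_topology}"
  assumes "integrable (lebesgue_on T) u" "S \<subseteq> T" "S \<in> sets lebesgue" "T \<in> sets lebesgue"
  shows "integrable (lebesgue_on S) u"
proof -
  have "integrable lebesgue (\<lambda>x. indicator T x *\<^sub>R u x)"
    using assms by (simp add: integrable_lebesgue_on_iff)
  from integrable_mult_indicator[OF assms(3) this]
  have "integrable lebesgue (\<lambda>x. indicator S x *\<^sub>R (indicator T x *\<^sub>R u x))" .
  moreover have "(\<lambda>x. indicator S x *\<^sub>R (indicator T x *\<^sub>R u x)) = (\<lambda>x. indicator S x *\<^sub>R u x)"
    using assms(2) by (auto simp: indicator_def fun_eq_iff)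
  ultimately show ?thesis using assms(3) by (simp add: integrable_lebesgue_on_iff)
qed

text \<open>
The distribution that \<open>h\<close> defines on \<open>S\<close>; weak derivatives depend on \<open>h\<close> only through it.
\<close>

definition test_pairing :: "real set \<Rightarrow> L1 \<Rightarrow> (real \<Rightarrow> real) \<Rightarrow> complex" where
  "test_pairing S h \<phi> = (\<integral>x. rep_L1 h x * of_real (\<phi> x) \<partial>lebesgue_on S)"

lemma has_weak_deriv_iff:
  "has_weak_deriv N J l h g \<longleftrightarrow> (\<forall>j<N. \<forall>\<phi>. test_function (J j) \<phi> \<longrightarrow>
     test_pairing (J j) h ((deriv ^^ l) \<phi>) = (- 1) ^ l * test_pairing (J j) g \<phi>)"
  by (simp add: has_weak_deriv_def test_pairing_def)

locale interval_partition =
  fixes N :: nat and J :: "nat \<Rightarrow> real set"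
  assumes J_interval: "\<And>j. j < N \<Longrightarrow> \<exists>a b. a < b \<and> J j = {a<..<b} \<and> J j \<subseteq> {0..1}"
    and J_disjoint: "disjoint_family_on J {..<N}"
    and J_cover: "negligible ({0..1} - (\<Union>j<N. J j))"
begin

lemma J_subset: "j < N \<Longrightarrow> J j \<subseteq> {0..1}"
  using J_interval by blast

lemma J_lebesgue [measurable, simp]: "j < N \<Longrightarrow> J j \<in> sets lebesgue"
  using J_interval[of j] by auto

lemma J_unique: "i < N \<Longrightarrow> j < N \<Longrightarrow> x \<in> J i \<Longrightarrow> x \<in> J j \<Longrightarrow> i = j"
  using J_disjoint by (auto simp: disjoint_family_on_def)

lemma AE_unit_iff: "(AE x in unit_leb. P x) \<longleftrightarrow> (\<forall>j<N. AE x in lebesgue_on (J j). P x)"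
proof
  assume "AE x in unit_leb. P x"
  then have "AE x in lebesgue. x \<in> {0..1} \<longrightarrow> P x" by (simp add: AE_restrict_space_iff)
  then have "AE x in lebesgue. x \<in> J j \<longrightarrow> P x" if "j < N" for j
    by eventually_elim (use J_subset[OF that] in auto)
  then show "\<forall>j<N. AE x in lebesgue_on (J j). P x" by (simp add: AE_restrict_space_iff)
next
  assume "\<forall>j<N. AE x in lebesgue_on (J j). P x"
  then have "\<forall>j\<in>{..<N}. AE x in lebesgue. x \<in> J j \<longrightarrow> P x" by (simp add: AE_restrict_space_iff)
  then have "AE x in lebesgue. \<forall>j\<in>{..<N}. x \<in> J j \<longrightarrow> P x" by (intro AE_finite_allI) auto
  moreover have "AE x in lebesgue. x \<notin> {0..1} - (\<Union>j<N. J j)"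
    using J_cover by (intro AE_not_in) (simp add: negligible_iff_null_sets)
  ultimately have "AE x in lebesgue. x \<in> {0..1} \<longrightarrow> P x" by eventually_elim auto
  then show "AE x in unit_leb. P x" by (simp add: AE_restrict_space_iff)
qed

lemma L1_eq_iff: "h = h' \<longleftrightarrow> (\<forall>j<N. AE x in lebesgue_on (J j). rep_L1 h x = rep_L1 h' x)"
  using L1_eqI[of h h'] by (auto simp: AE_unit_iff)

lemma integrable_on_J:
  fixes u :: "real \<Rightarrow> 'a::{banach, second_countable_topology}"
  assumes "integrable unit_leb u" "j < N" shows "integrable (lebesgue_on (J j)) u"
  using assms J_subset[OF assms(2)] by (intro integrable_lebesgue_on_subset[OF assms(1)]) auto

lemma integrable_rep_J: "j < N \<Longrightarrow> integrable (lebesgue_on (J j)) (rep_L1 h)"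
  by (intro integrable_on_J integrable_rep_L1)

text \<open>
Elements of \<open>L1\<close> may be prescribed on each interval separately, since the intervals are disjoint and
cover the unit interval up to a null set.
\<close>

lemma glue_integrable:
  fixes u :: "nat \<Rightarrow> real \<Rightarrow> complex"
  assumes "\<And>j. j < N \<Longrightarrow> integrable (lebesgue_on (J j)) (u j)"
  shows "\<exists>h. \<forall>j<N. AE x in lebesgue_on (J j). rep_L1 h x = u j x"
proof -
  let ?u = "\<lambda>x. \<Sum>j<N. indicator (J j) x *\<^sub>R u j x"
  have "integrable unit_leb (\<lambda>x. indicator (J j) x *\<^sub>R u j x)" if "j < N" for j
  proof -
    have "integrable lebesgue (\<lambda>x. indicator (J j) x *\<^sub>R u j x)"
      using assms[OF that] that by (simp add: integrable_lebesgue_on_iff)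
    then have "integrable (lebesgue_on UNIV) (\<lambda>x. indicator (J j) x *\<^sub>R u j x)"
      by (simp add: lebesgue_on_UNIV_eq)
    then show ?thesis by (rule integrable_lebesgue_on_subset) auto
  qed
  then have int: "integrable unit_leb ?u"
    by (intro Bochner_Integration.integrable_sum) (simp del: indicator_scaleR_eq_if)
  have "AE x in lebesgue_on (J j). rep_L1 (abs_L1 ?u) x = u j x" if j: "j < N" for j
  proof -
    have eq: "?u x = u j x" if "x \<in> J j" for x
    proof -
      have "x \<notin> J i" if "i \<in> {..<N} - {j}" for i using J_unique[of i j x] j that \<open>x \<in> J j\<close> by blast
      then have "?u x = (\<Sum>i\<in>{j}. indicator (J i) x *\<^sub>R u i x)"
        using j by (intro sum.mono_neutral_right) auto
      then show ?thesis using that by simp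
    qed
    have "AE x in lebesgue_on (J j). rep_L1 (abs_L1 ?u) x = ?u x"
      using AE_rep_abs_L1[OF int] AE_unit_iff j by blast
    moreover have "AE x in lebesgue_on (J j). x \<in> J j"
      using AE_space[of "lebesgue_on (J j)"] by (simp add: space_restrict_space)
    ultimately show ?thesis by eventually_elim (simp only: eq)
  qed
  then show ?thesis by blast
qed

lemma set_integral_split:
  fixes u :: "real \<Rightarrow> 'a::{banach, second_countable_topology}"
  assumes "integrable unit_leb u"
  shows "(\<integral>x. u x \<partial>unit_leb) = (\<Sum>j<N. \<integral>x. u x \<partial>lebesgue_on (J j))"
    and "(\<integral>x. u x \<partial>lebesgue_on (\<Union>j<N. J j)) = (\<integral>x. u x \<partial>unit_leb)"
proof -
  let ?U = "\<Union>j<N. J j"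
  have U: "?U \<in> sets lebesgue" by (intro sets.finite_UN) auto
  have int: "integrable lebesgue (\<lambda>x. indicator {0..1} x *\<^sub>R u x)"
    using assms integrable_lebesgue_on_iff[of "{0..1}" u] by simp
  have intj: "integrable lebesgue (\<lambda>x. indicator (J j) x *\<^sub>R u x)" if "j < N" for j
    using integrable_on_J[OF assms that] that by (simp add: integrable_lebesgue_on_iff)
  have eq: "indicator ?U x *\<^sub>R u x = (\<Sum>j<N. indicator (J j) x *\<^sub>R u x)" for x
  proof -
    have "indicator ?U x = (\<Sum>j<N. indicator (J j) x :: real)"
      using J_disjoint by (intro indicator_UN_disjoint) auto
    then show ?thesis by (simp add: scaleR_sum_left)
  qed
  have "AE x in lebesgue. x \<notin> {0..1} - ?U"
    using J_cover by (intro AE_not_in) (simp add: negligible_iff_null_sets)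
  then have "AE x in lebesgue. indicator {0..1} x *\<^sub>R u x = indicator ?U x *\<^sub>R u x"
  proof eventually_elim
    case (elim x)
    have "x \<in> {0..1} \<longleftrightarrow> x \<in> ?U" using elim J_subset by blast
    then show ?case by (simp only: indicator_def)
  qed
  then have *: "(\<integral>x. indicator {0..1} x *\<^sub>R u x \<partial>lebesgue) = (\<integral>x. indicator ?U x *\<^sub>R u x \<partial>lebesgue)"
    unfolding eq using borel_measurable_integrable[OF int] borel_measurable_integrable[OF intj]
    by (intro integral_cong_AE borel_measurable_sum) (simp_all del: indicator_scaleR_eq_if)
  then show "(\<integral>x. u x \<partial>lebesgue_on ?U) = (\<integral>x. u x \<partial>unit_leb)"
    using U by (simp add: integral_lebesgue_on)
  show "(\<integral>x. u x \<partial>unit_leb) = (\<Sum>j<N. \<integral>x. u x \<partial>lebesgue_on (J j))"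
    using * Bochner_Integration.integral_sum[OF intj, of "{..<N}" id]
    by (simp add: integral_lebesgue_on eq del: indicator_scaleR_eq_if)
qed

lemma test_pairing_integrable:
  "j < N \<Longrightarrow> test_function U \<phi> \<Longrightarrow> integrable (lebesgue_on (J j)) (\<lambda>x. rep_L1 h x * of_real (\<phi> x))"
  by (rule integrable_times_test_function[OF integrable_rep_J])

lemma test_pairing_cong:
  assumes "j < N" "test_function U \<phi>" "AE x in lebesgue_on (J j). rep_L1 h x = u x"
    and "u \<in> borel_measurable (lebesgue_on (J j))"
  shows "test_pairing (J j) h \<phi> = (\<integral>x. u x * of_real (\<phi> x) \<partial>lebesgue_on (J j))"
proof -
  have [measurable]: "\<phi> \<in> borel_measurable (lebesgue_on (J j))" "rep_L1 h \<in> borel_measurable (lebesgue_on (J j))"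
    using assms integrable_rep_J[of j h] test_function_measurable_lebesgue_on by auto
  note assms(4) [measurable]
  show ?thesis unfolding test_pairing_def
    by (rule integral_cong_AE, measurable) (use assms(3) in \<open>auto elim: AE_mp\<close>)
qed

lemma test_pairing_add:
  assumes "j < N" "test_function U \<phi>"
  shows "test_pairing (J j) (h + h') \<phi> = test_pairing (J j) h \<phi> + test_pairing (J j) h' \<phi>"
proof -
  have "test_pairing (J j) (h + h') \<phi> = (\<integral>x. (rep_L1 h x + rep_L1 h' x) * of_real (\<phi> x) \<partial>lebesgue_on (J j))"
    using AE_rep_plus[of h h'] assms integrable_rep_J[OF assms(1)]
    by (intro test_pairing_cong) (auto simp: AE_unit_iff)
  also have "\<dots> = test_pairing (J j) h \<phi> + test_pairing (J j) h' \<phi>"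
    unfolding test_pairing_def distrib_right
    by (rule Bochner_Integration.integral_add[OF test_pairing_integrable[OF assms] test_pairing_integrable[OF assms]])
  finally show ?thesis .
qed

lemma test_pairing_scale:
  assumes "j < N" "test_function U \<phi>"
  shows "test_pairing (J j) (scale_L1 c h) \<phi> = c * test_pairing (J j) h \<phi>"
proof -
  have "test_pairing (J j) (scale_L1 c h) \<phi> = (\<integral>x. c * rep_L1 h x * of_real (\<phi> x) \<partial>lebesgue_on (J j))"
    using AE_rep_scale[of c h] assms integrable_rep_J[OF assms(1)]
    by (intro test_pairing_cong) (auto simp: AE_unit_iff)
  then show ?thesis unfolding test_pairing_def by (simp add: mult.assoc)
qed

lemma test_pairing_zero: "j < N \<Longrightarrow> test_function U \<phi> \<Longrightarrow> test_pairing (J j) 0 \<phi> = 0"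
  using test_pairing_scale[of j U \<phi> 0 0] by simp

lemma test_pairing_determines:
  assumes "\<And>j \<phi>. j < N \<Longrightarrow> test_function (J j) \<phi> \<Longrightarrow> test_pairing (J j) g \<phi> = test_pairing (J j) g' \<phi>"
  shows "g = g'"
proof -
  have "AE x in lebesgue_on (J j). rep_L1 g x - rep_L1 g' x = 0" if j: "j < N" for j
  proof -
    obtain a b where ab: "J j = {a<..<b}" using J_interval[OF j] by blast
    have "(\<integral>x. (rep_L1 g x - rep_L1 g' x) * of_real (\<phi> x) \<partial>lebesgue_on (J j)) = 0"
      if \<phi>: "test_function (J j) \<phi>" for \<phi>
      using assms[OF j \<phi>] test_pairing_integrable[OF j \<phi>]
      by (simp add: left_diff_distrib test_pairing_def)
    then show ?thesis
      using integrable_rep_J[OF j] unfolding ab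
      by (intro fundamental_lemma_calculus_of_variations Bochner_Integration.integrable_diff) auto
  qed
  then show ?thesis by (simp add: L1_eq_iff)
qed

lemma has_weak_deriv_0: "has_weak_deriv N J 0 h h"
  by (simp add: has_weak_deriv_iff)

lemma has_weak_deriv_0_iff: "has_weak_deriv N J 0 h g \<longleftrightarrow> g = h"
  using test_pairing_determines[of h g] has_weak_deriv_0 by (auto simp: has_weak_deriv_iff)

lemma has_weak_deriv_unique:
  "has_weak_deriv N J l h g \<Longrightarrow> has_weak_deriv N J l h g' \<Longrightarrow> g = g'"
  by (rule test_pairing_determines) (auto simp: has_weak_deriv_iff)

lemma weak_deriv_eq: "has_weak_deriv N J l h g \<Longrightarrow> weak_deriv N J l h = g"
  unfolding weak_deriv_def using has_weak_deriv_unique by blast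

lemma has_weak_deriv_add:
  "has_weak_deriv N J l h g \<Longrightarrow> has_weak_deriv N J l h' g' \<Longrightarrow> has_weak_deriv N J l (h + h') (g + g')"
  by (simp add: has_weak_deriv_iff test_pairing_add[OF _ test_function_higher_deriv] test_pairing_add
      distrib_left)

lemma has_weak_deriv_scale:
  "has_weak_deriv N J l h g \<Longrightarrow> has_weak_deriv N J l (scale_L1 c h) (scale_L1 c g)"
  by (simp add: has_weak_deriv_iff test_pairing_scale[OF _ test_function_higher_deriv] test_pairing_scale
      mult.left_commute)

lemma has_weak_deriv_diff:
  "has_weak_deriv N J l h g \<Longrightarrow> has_weak_deriv N J l h' g' \<Longrightarrow> has_weak_deriv N J l (h - h') (g - g')"
  using has_weak_deriv_add[of l h g "scale_L1 (-1) h'" "scale_L1 (-1) g'"] has_weak_deriv_scale[of l h' g' "-1"] by simp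

lemma has_weak_deriv_Suc:
  assumes "has_weak_deriv N J 1 h g" "has_weak_deriv N J l g k"
  shows "has_weak_deriv N J (Suc l) h k"
  unfolding has_weak_deriv_iff
proof (intro allI impI)
  fix j \<phi> assume j: "j < N" and \<phi>: "test_function (J j) \<phi>"
  have "test_pairing (J j) h ((deriv ^^ 1) ((deriv ^^ l) \<phi>)) = (-1) ^ 1 * test_pairing (J j) g ((deriv ^^ l) \<phi>)"
    using assms(1) j test_function_higher_deriv[OF \<phi>, of l] unfolding has_weak_deriv_iff by blast
  moreover have "test_pairing (J j) g ((deriv ^^ l) \<phi>) = (-1) ^ l * test_pairing (J j) k \<phi>"
    using assms(2) j \<phi> unfolding has_weak_deriv_iff by blast
  ultimately show "test_pairing (J j) h ((deriv ^^ Suc l) \<phi>) = (-1) ^ Suc l * test_pairing (J j) k \<phi>"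
    by simp
qed

lemma neg_one_power_cancel: "(- 1) ^ l * x = - ((- 1) ^ l * y) \<Longrightarrow> x = - y" for x y :: complex
  using mult_cancel_left[of "(- 1) ^ l" x "- y"] by simp

text \<open>
Orders of differentiation can be subtracted because derivatives of test functions are test
functions. This allows derivatives of higher order to be treated one order at a time.
\<close>

lemma has_weak_deriv_cancel:
  assumes "has_weak_deriv N J l h g" "has_weak_deriv N J (Suc l) h k"
  shows "has_weak_deriv N J 1 g k"
  unfolding has_weak_deriv_iff
proof (intro allI impI)
  fix j \<phi> assume j: "j < N" and \<phi>: "test_function (J j) \<phi>"
  have "test_pairing (J j) h ((deriv ^^ l) (deriv \<phi>)) = (-1) ^ l * test_pairing (J j) g (deriv \<phi>)"
    using assms(1) j test_function_deriv[OF \<phi>] unfolding has_weak_deriv_iff by blast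
  moreover have "test_pairing (J j) h ((deriv ^^ Suc l) \<phi>) = (-1) ^ Suc l * test_pairing (J j) k \<phi>"
    using assms(2) j \<phi> unfolding has_weak_deriv_iff by blast
  ultimately show "test_pairing (J j) g ((deriv ^^ 1) \<phi>) = (-1) ^ 1 * test_pairing (J j) k \<phi>"
    using neg_one_power_cancel[of l "test_pairing (J j) g (deriv \<phi>)" "test_pairing (J j) k \<phi>"]
    by (simp add: funpow_Suc_right del: funpow.simps(2))
qed

lemma sobolev_0: "sobolev N J 0 = UNIV"
  using has_weak_deriv_0 by (auto simp: sobolev_def)

text \<open>
Only the existence of the intermediate derivatives of \<open>g\<close> needs an argument: they are those of \<open>h\<close>,
shifted by one.
\<close>

lemma sobolev_Suc_iff: "h \<in> sobolev N J (Suc r) \<longleftrightarrow> (\<exists>g\<in>sobolev N J r. has_weak_deriv N J 1 h g)"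
proof
  assume h: "h \<in> sobolev N J (Suc r)"
  then have ex: "\<exists>k. has_weak_deriv N J l h k" if "l \<le> Suc r" for l
    using that by (simp add: sobolev_def)
  obtain g where g: "has_weak_deriv N J 1 h g" using ex[of 1] by auto
  have "\<exists>k. has_weak_deriv N J l g k \<and> has_weak_deriv N J (Suc l) h k" if "l \<le> r" for l
    using that
  proof (induction l)
    case 0
    then show ?case using g has_weak_deriv_0 by auto
  next
    case (Suc l)
    then obtain k where k: "has_weak_deriv N J l g k" "has_weak_deriv N J (Suc l) h k" by auto
    obtain m where m: "has_weak_deriv N J (Suc (Suc l)) h m" using ex Suc.prems by auto
    have km: "has_weak_deriv N J 1 k m" using has_weak_deriv_cancel[OF k(2) m] .
    have "has_weak_deriv N J (Suc l) g m" unfolding has_weak_deriv_iff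
    proof (intro allI impI)
      fix j \<phi> assume j: "j < N" and \<phi>: "test_function (J j) \<phi>"
      have "test_pairing (J j) g ((deriv ^^ l) (deriv \<phi>)) = (-1) ^ l * test_pairing (J j) k (deriv \<phi>)"
        using k(1) j test_function_deriv[OF \<phi>] unfolding has_weak_deriv_iff by blast
      moreover have "test_pairing (J j) k ((deriv ^^ 1) \<phi>) = (-1) ^ 1 * test_pairing (J j) m \<phi>"
        using km j \<phi> unfolding has_weak_deriv_iff by blast
      ultimately show "test_pairing (J j) g ((deriv ^^ Suc l) \<phi>) = (-1) ^ Suc l * test_pairing (J j) m \<phi>"
        by (simp add: funpow_Suc_right del: funpow.simps(2))
    qed
    then show ?case using m by blast
  qed
  then show "\<exists>g\<in>sobolev N J r. has_weak_deriv N J 1 h g" using g unfolding sobolev_def by blast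
next
  assume "\<exists>g\<in>sobolev N J r. has_weak_deriv N J 1 h g"
  then obtain g where g: "g \<in> sobolev N J r" "has_weak_deriv N J 1 h g" by blast
  have "\<exists>k. has_weak_deriv N J l h k" if "l \<le> Suc r" for l
  proof (cases l)
    case 0
    then show ?thesis using has_weak_deriv_0 by auto
  next
    case (Suc m)
    then have "m \<le> r" using that by simp
    then obtain k where "has_weak_deriv N J m g k" using g(1) unfolding sobolev_def by blast
    then show ?thesis using has_weak_deriv_Suc[OF g(2)] Suc by blast
  qed
  then show "h \<in> sobolev N J (Suc r)" by (simp add: sobolev_def)
qed

lemma sobolev_has_weak_deriv:
  "h \<in> sobolev N J r \<Longrightarrow> l \<le> r \<Longrightarrow> has_weak_deriv N J l h (weak_deriv N J l h)"
  using weak_deriv_eq by (fastforce simp: sobolev_def)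

lemma subspace_sobolev: "L1.subspace (sobolev N J r)"
proof (rule L1.subspaceI)
  have "has_weak_deriv N J l 0 0" for l
    by (simp add: has_weak_deriv_iff test_pairing_zero[OF _ test_function_higher_deriv] test_pairing_zero)
  then show "0 \<in> sobolev N J r" by (auto simp: sobolev_def)
next
  fix h h' assume "h \<in> sobolev N J r" "h' \<in> sobolev N J r"
  then show "h + h' \<in> sobolev N J r" using has_weak_deriv_add unfolding sobolev_def by blast
next
  fix c h assume "h \<in> sobolev N J r"
  then show "scale_L1 c h \<in> sobolev N J r" using has_weak_deriv_scale unfolding sobolev_def by blast
qed

lemma sobolev_norm_eq: "sobolev_norm N J r h = (\<Sum>l\<le>r. norm (weak_deriv N J l h))"
  unfolding sobolev_norm_def norm_L1_def
  by (intro sum.cong refl set_integral_split(2)) (simp add: integrable_rep_L1)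

lemma seminorm_on_sobolev: "seminorm_on (sobolev N J r) (sobolev_norm N J r)"
  unfolding seminorm_on_def
proof (intro conjI ballI allI)
  fix h assume h: "h \<in> sobolev N J r"
  show "0 \<le> sobolev_norm N J r h" by (simp add: sobolev_norm_eq sum_nonneg)
  fix c
  have "weak_deriv N J l (scale_L1 c h) = scale_L1 c (weak_deriv N J l h)" if "l \<le> r" for l
    by (rule weak_deriv_eq[OF has_weak_deriv_scale[OF sobolev_has_weak_deriv[OF h that]]])
  then show "sobolev_norm N J r (scale_L1 c h) = cmod c * sobolev_norm N J r h"
    by (simp add: sobolev_norm_eq norm_scale_L1 sum_distrib_left)
next
  fix h h' assume h: "h \<in> sobolev N J r" "h' \<in> sobolev N J r"
  have "weak_deriv N J l (h + h') = weak_deriv N J l h + weak_deriv N J l h'" if "l \<le> r" for l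
    by (rule weak_deriv_eq[OF has_weak_deriv_add[OF sobolev_has_weak_deriv[OF h(1) that] sobolev_has_weak_deriv[OF h(2) that]]])
  then show "sobolev_norm N J r (h + h') \<le> sobolev_norm N J r h + sobolev_norm N J r h'"
    unfolding sobolev_norm_eq sum.distrib[symmetric]
    by (intro sum_mono) (simp add: norm_triangle_ineq)
qed

lemma piecewise_poly_0_iff:
  "h \<in> piecewise_poly N J 0 \<longleftrightarrow> (\<forall>j<N. \<exists>c. AE x in lebesgue_on (J j). rep_L1 h x = c)"
proof -
  have "(\<exists>p :: complex poly. Polynomial.degree p \<le> 0 \<and> (AE x in M. f x = poly p (of_real x))) \<longleftrightarrow> (\<exists>c. AE x in M. f x = c)"
    for M :: "real measure" and f
  proof
    assume "\<exists>p :: complex poly. Polynomial.degree p \<le> 0 \<and> (AE x in M. f x = poly p (of_real x))"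
    then obtain p :: "complex poly" where "Polynomial.degree p = 0" "AE x in M. f x = poly p (of_real x)" by auto
    moreover from this(1) obtain c where "p = [:c:]" by (rule degree_eq_zeroE)
    ultimately show "\<exists>c. AE x in M. f x = c" by auto
  next
    assume "\<exists>c. AE x in M. f x = c"
    then obtain c where "AE x in M. f x = c" by blast
    then show "\<exists>p :: complex poly. Polynomial.degree p \<le> 0 \<and> (AE x in M. f x = poly p (of_real x))"
      by (intro exI[of _ "[:c:]"]) simp
  qed
  then show ?thesis by (simp add: piecewise_poly_def)
qed

lemma has_weak_deriv_zero_imp_const:
  assumes "has_weak_deriv N J 1 h 0" shows "h \<in> piecewise_poly N J 0"
  unfolding piecewise_poly_0_iff
proof (intro allI impI)
  fix j assume j: "j < N"
  obtain a b where ab: "a < b" "J j = {a<..<b}" using J_interval[OF j] by blast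
  show "\<exists>c. AE x in lebesgue_on (J j). rep_L1 h x = c"
    unfolding ab(2)
  proof (rule du_bois_reymond[OF ab(1)])
    show "integrable (lebesgue_on {a<..<b}) (rep_L1 h)" using integrable_rep_J[OF j] ab by simp
    fix \<phi> assume \<phi>: "test_function {a<..<b} \<phi>"
    then have \<phi>: "test_function (J j) \<phi>" using ab by simp
    note test_pairing_zero[OF j \<phi>]
    moreover have "test_pairing (J j) h ((deriv ^^ 1) \<phi>) = (- 1) ^ 1 * test_pairing (J j) 0 \<phi>"
      using assms j \<phi> unfolding has_weak_deriv_iff by blast
    ultimately have "test_pairing (J j) h (deriv \<phi>) = 0" by simp
    then show "(\<integral>x. rep_L1 h x * of_real (deriv \<phi> x) \<partial>lebesgue_on {a<..<b}) = 0"
      by (simp add: test_pairing_def ab)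
  qed
qed

lemma poly_of_real_has_vector_derivative:
  "((\<lambda>x. poly p (of_real x)) has_vector_derivative poly (pderiv p) (complex_of_real x)) (at x)"
proof -
  have "(of_real has_vector_derivative (1::complex)) (at x)"
    using has_vector_derivative_of_real[OF DERIV_ident] by simp
  from field_vector_diff_chain_at[OF this poly_DERIV[of p]]
  show ?thesis by (simp add: o_def)
qed

lemma integration_by_parts_poly:
  assumes "a < b" "test_function {a<..<b} \<phi>"
  shows "(\<integral>x. poly p (of_real x) * of_real (deriv \<phi> x) \<partial>lebesgue_on {a<..<b}) =
    - (\<integral>x. poly (pderiv p) (complex_of_real x) * of_real (\<phi> x) \<partial>lebesgue_on {a<..<b})"
proof -
  note sm = test_function_smooth[OF assms(2)]
  have cp: "continuous_on S (\<lambda>x. poly q (complex_of_real x))" for S q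
    by (intro continuous_intros)
  have intp: "integrable (lebesgue_on {a<..<b}) (\<lambda>x. poly q (complex_of_real x))" for q
  proof -
    have "integrable (lebesgue_on {a..b}) (\<lambda>x. poly q (complex_of_real x))"
      by (rule continuous_imp_integrable_real[OF cp])
    then show ?thesis by (rule integrable_lebesgue_on_subset) auto
  qed
  obtain c d where cd: "a < c" "c < d" "d < b" "\<And>x. x \<notin> {c..d} \<Longrightarrow> \<phi> x = 0"
    using assms test_function_interval_iff[of a b] by blast
  define F where "F x = poly p (of_real x) * of_real (\<phi> x)" for x
  define F' where "F' x = poly p (of_real x) * of_real (deriv \<phi> x) + poly (pderiv p) (complex_of_real x) * of_real (\<phi> x)" for x
  have D: "(F has_vector_derivative F' x) (at x)" for x
    unfolding F_def[abs_def] F'_def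
    using has_vector_derivative_mult[OF poly_of_real_has_vector_derivative[of p x]
        has_vector_derivative_of_real[OF smooth_has_derivative[OF sm, of x]]] by simp
  have int: "integrable (lebesgue_on {a<..<b}) F'"
    unfolding F'_def[abs_def]
    by (rule Bochner_Integration.integrable_add[OF
        integrable_times_test_function[OF intp test_function_deriv[OF assms(2)]]
        integrable_times_test_function[OF intp assms(2)]])
  have "(\<integral>x. F' x \<partial>lebesgue_on {a<..<b}) = integral {a<..<b} F'"
    using lebesgue_integral_eq_integral[OF int] by simp
  also have "\<dots> = integral {a..b} F'" by (simp add: integral_open_interval_real)
  also have "\<dots> = F b - F a"
    using fundamental_theorem_of_calculus[of a b F F'] D assms(1) has_vector_derivative_at_within by (metis integral_unique less_imp_le)
  also have "\<dots> = 0" using cd by (simp add: F_def)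
  finally have "0 = (\<integral>x. F' x \<partial>lebesgue_on {a<..<b})" by simp
  also have "\<dots> = (\<integral>x. poly p (of_real x) * of_real (deriv \<phi> x) \<partial>lebesgue_on {a<..<b}) +
     (\<integral>x. poly (pderiv p) (complex_of_real x) * of_real (\<phi> x) \<partial>lebesgue_on {a<..<b})"
    unfolding F'_def
    by (rule Bochner_Integration.integral_add[OF
        integrable_times_test_function[OF intp test_function_deriv[OF assms(2)]]
        integrable_times_test_function[OF intp assms(2)]])
  finally show ?thesis by (simp add: add_eq_0_iff)
qed

lemma has_weak_deriv_poly:
  assumes "\<And>j. j < N \<Longrightarrow> AE x in lebesgue_on (J j). rep_L1 h x = poly (p j) (of_real x)"
    and "\<And>j. j < N \<Longrightarrow> AE x in lebesgue_on (J j). rep_L1 g x = poly (pderiv (p j)) (of_real x)"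
  shows "has_weak_deriv N J 1 h g"
  unfolding has_weak_deriv_iff
proof (intro allI impI)
  fix j \<phi> assume j: "j < N" and \<phi>: "test_function (J j) \<phi>"
  obtain a b where ab: "a < b" "J j = {a<..<b}" using J_interval[OF j] by blast
  have meas: "(\<lambda>x. poly q (complex_of_real x)) \<in> borel_measurable (lebesgue_on (J j))" for q
    using j by (intro continuous_imp_measurable_on_sets_lebesgue continuous_intros) auto
  show "test_pairing (J j) h ((deriv ^^ 1) \<phi>) = (-1) ^ 1 * test_pairing (J j) g \<phi>"
    using test_pairing_cong[OF j test_function_deriv[OF \<phi>] assms(1)[OF j] meas]
      test_pairing_cong[OF j \<phi> assms(2)[OF j] meas] integration_by_parts_poly[OF ab(1), of \<phi> "p j"] \<phi>
    by (simp add: ab)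
qed

lemma glue_poly: "\<exists>h. \<forall>j<N. AE x in lebesgue_on (J j). rep_L1 h x = poly (p j) (of_real x)"
proof (rule glue_integrable)
  fix j assume j: "j < N"
  obtain a b where ab: "a < b" "J j = {a<..<b}" using J_interval[OF j] by blast
  have "integrable (lebesgue_on {a..b}) (\<lambda>x. poly (p j) (complex_of_real x))"
    by (intro continuous_imp_integrable_real continuous_intros)
  then show "integrable (lebesgue_on (J j)) (\<lambda>x. poly (p j) (complex_of_real x))"
    unfolding ab by (rule integrable_lebesgue_on_subset) auto
qed

end


section \<open>Piecewise polynomials\<close>

context interval_partition begin
lemma poly_antiderivative:
  fixes q :: "complex poly"
  obtains p where "pderiv p = q" "Polynomial.degree p \<le> Suc (Polynomial.degree q)"
proof -
  define p where "p = (\<Sum>i\<le>Polynomial.degree q. Polynomial.monom (coeff q i / of_nat (Suc i)) (Suc i))"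
  have c: "coeff p (Suc n) = coeff q n / of_nat (Suc n)" for n
  proof -
    have "coeff p (Suc n) = (\<Sum>i\<le>Polynomial.degree q. if i = n then coeff q n / of_nat (Suc n) else 0)"
      unfolding p_def coeff_sum coeff_monom by (intro sum.cong) auto
    also have "\<dots> = coeff q n / of_nat (Suc n)"
      using coeff_eq_0[of q n] by (cases "n \<le> Polynomial.degree q") (simp_all del: of_nat_Suc)
    finally show ?thesis .
  qed
  have "pderiv p = q" by (intro poly_eqI) (simp add: coeff_pderiv c del: of_nat_Suc)
  moreover have "Polynomial.degree p \<le> Suc (Polynomial.degree q)"
    unfolding p_def by (intro degree_sum_le) (auto intro: order_trans[OF degree_monom_le])
  ultimately show ?thesis using that by blast
qed

lemma piecewise_poly_iff_family:
  "h \<in> piecewise_poly N J r \<longleftrightarrow> (\<exists>p :: nat \<Rightarrow> complex poly. \<forall>j<N. Polynomial.degree (p j) \<le> r \<and>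
     (AE x in lebesgue_on (J j). rep_L1 h x = poly (p j) (of_real x)))"
  unfolding piecewise_poly_def mem_Collect_eq by (rule choice_iff')

text \<open>
An antiderivative of \<open>g\<close> on each interval is a polynomial, and by the lemma of du Bois-Reymond it
differs from \<open>h\<close> by a constant there.
\<close>

lemma piecewise_poly_Suc_iff:
  "h \<in> piecewise_poly N J (Suc r) \<longleftrightarrow> (\<exists>g\<in>piecewise_poly N J r. has_weak_deriv N J 1 h g)"
proof
  assume "h \<in> piecewise_poly N J (Suc r)"
  then obtain p :: "nat \<Rightarrow> complex poly" where "\<forall>j<N. Polynomial.degree (p j) \<le> Suc r \<and>
      (AE x in lebesgue_on (J j). rep_L1 h x = poly (p j) (of_real x))"
    by (auto simp only: piecewise_poly_iff_family)
  then have p: "\<And>j. j < N \<Longrightarrow> Polynomial.degree (p j) \<le> Suc r"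
    "\<And>j. j < N \<Longrightarrow> AE x in lebesgue_on (J j). rep_L1 h x = poly (p j) (of_real x)"
    by simp_all
  obtain g where g: "\<And>j. j < N \<Longrightarrow> AE x in lebesgue_on (J j). rep_L1 g x = poly (pderiv (p j)) (of_real x)"
    using glue_poly[of "\<lambda>j. pderiv (p j)"] by blast
  have "Polynomial.degree (pderiv (p j)) \<le> r" if "j < N" for j
    using p(1)[OF that] by (simp add: degree_pderiv)
  then have "g \<in> piecewise_poly N J r"
    unfolding piecewise_poly_iff_family using g by (intro exI[of _ "\<lambda>j. pderiv (p j)"]) simp
  then show "\<exists>g\<in>piecewise_poly N J r. has_weak_deriv N J 1 h g"
    using has_weak_deriv_poly[of h p g, OF p(2) g] by blast
next
  assume "\<exists>g\<in>piecewise_poly N J r. has_weak_deriv N J 1 h g"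
  then obtain g where g: "has_weak_deriv N J 1 h g" and gp: "g \<in> piecewise_poly N J r" by blast
  from gp obtain q :: "nat \<Rightarrow> complex poly" where "\<forall>j<N. Polynomial.degree (q j) \<le> r \<and>
      (AE x in lebesgue_on (J j). rep_L1 g x = poly (q j) (of_real x))"
    by (auto simp only: piecewise_poly_iff_family)
  then have q: "\<And>j. j < N \<Longrightarrow> Polynomial.degree (q j) \<le> r"
    "\<And>j. j < N \<Longrightarrow> AE x in lebesgue_on (J j). rep_L1 g x = poly (q j) (complex_of_real x)"
    by simp_all
  have "\<exists>p. pderiv p = q j \<and> Polynomial.degree p \<le> Suc (Polynomial.degree (q j))" for j
    by (rule poly_antiderivative[of "q j"]) blast
  then have "\<forall>j. \<exists>p. pderiv p = q j \<and> Polynomial.degree p \<le> Suc (Polynomial.degree (q j))" by blast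
  from choice[OF this] obtain p where p: "\<And>j. pderiv (p j) = q j" "\<And>j. Polynomial.degree (p j) \<le> Suc (Polynomial.degree (q j))"
    by blast
  obtain h' where h': "\<And>j. j < N \<Longrightarrow> AE x in lebesgue_on (J j). rep_L1 h' x = poly (p j) (of_real x)"
    using glue_poly[of p] by blast
  have "has_weak_deriv N J 1 h' g" by (rule has_weak_deriv_poly[of h' p g]) (simp_all add: h' q(2) p(1))
  then have "has_weak_deriv N J 1 (h - h') 0" using has_weak_deriv_diff[OF g, of h' g] by simp
  then have "h - h' \<in> piecewise_poly N J 0" by (rule has_weak_deriv_zero_imp_const)
  then have const: "\<exists>c. AE x in lebesgue_on (J j). rep_L1 (h - h') x = c" if "j < N" for j
    using that by (simp add: piecewise_poly_0_iff)
  show "h \<in> piecewise_poly N J (Suc r)"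
    unfolding piecewise_poly_def
  proof (intro CollectI allI impI)
    fix j assume j: "j < N"
    obtain c where c: "AE x in lebesgue_on (J j). rep_L1 (h - h') x = c" using const[OF j] by blast
    have "AE x in lebesgue_on (J j). rep_L1 (h - h') x = rep_L1 h x - rep_L1 h' x"
      using AE_rep_diff j AE_unit_iff by blast
    then have "AE x in lebesgue_on (J j). rep_L1 h x = poly (p j + [:c:]) (of_real x)"
      using c h'[OF j] by eventually_elim (simp add: algebra_simps)
    moreover have "Polynomial.degree (p j + [:c:]) \<le> Suc r"
      using p(2)[of j] q(1)[OF j] by (intro degree_add_le) auto
    ultimately show "\<exists>p :: complex poly. Polynomial.degree p \<le> Suc r \<and>
        (AE x in lebesgue_on (J j). rep_L1 h x = poly p (of_real x))" by blast
  qed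
qed

lemma piecewise_poly_iff:
  "h \<in> piecewise_poly N J r \<longleftrightarrow> (\<exists>g\<in>piecewise_poly N J 0. has_weak_deriv N J r h g) \<and> h \<in> sobolev N J r"
proof (induction r arbitrary: h)
  case 0
  then show ?case by (auto simp: has_weak_deriv_0_iff sobolev_0)
next
  case (Suc r)
  show ?case
  proof
    assume "h \<in> piecewise_poly N J (Suc r)"
    then obtain g where "g \<in> piecewise_poly N J r" "has_weak_deriv N J 1 h g"
      using piecewise_poly_Suc_iff by blast
    then show "(\<exists>g\<in>piecewise_poly N J 0. has_weak_deriv N J (Suc r) h g) \<and> h \<in> sobolev N J (Suc r)"
      using Suc has_weak_deriv_Suc sobolev_Suc_iff by blast
  next
    assume "(\<exists>g\<in>piecewise_poly N J 0. has_weak_deriv N J (Suc r) h g) \<and> h \<in> sobolev N J (Suc r)"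
    then obtain k g where k: "k \<in> piecewise_poly N J 0" "has_weak_deriv N J (Suc r) h k"
      and g: "g \<in> sobolev N J r" "has_weak_deriv N J 1 h g"
      using sobolev_Suc_iff by blast
    obtain k' where k': "has_weak_deriv N J r g k'" using g(1) by (auto simp: sobolev_def)
    have "k' = k" using has_weak_deriv_unique[OF has_weak_deriv_Suc[OF g(2) k'] k(2)] .
    then have "g \<in> piecewise_poly N J r" using Suc k k' g by blast
    then show "h \<in> piecewise_poly N J (Suc r)" using g(2) piecewise_poly_Suc_iff by blast
  qed
qed

end


section \<open>Integration and piecewise means\<close>

lemma id_borel_measurable_lebesgue_on [measurable]: "(\<lambda>x::real. x) \<in> borel_measurable (lebesgue_on S)"
  by (intro measurable_restrict_space1 measurable_completion) simp

lemma integral_truncated_test_deriv: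
  assumes "a < b" "test_function {a<..<b} \<phi>" "y \<in> {a<..<b}"
  shows "(\<integral>x. (if y \<le> x then of_real (deriv \<phi> x) else 0) \<partial>lebesgue_on {a<..<b}) = - complex_of_real (\<phi> y)"
proof -
  note sm = test_function_smooth[OF assms(2)]
  have b0: "\<phi> b = 0" using test_function_outside[OF assms(2)] by simp
  have "(\<integral>x. (if y \<le> x then of_real (deriv \<phi> x) else 0) \<partial>lebesgue_on {a<..<b})
      = (\<integral>x. indicator {a<..<b} x *\<^sub>R (if y \<le> x then complex_of_real (deriv \<phi> x) else 0) \<partial>lebesgue)"
    by (rule integral_lebesgue_on) simp
  also have "\<dots> = (\<integral>x. indicator {y..b} x *\<^sub>R complex_of_real (deriv \<phi> x) \<partial>lebesgue)"
  proof (rule Bochner_Integration.integral_cong[OF refl])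
    fix x
    show "indicator {a<..<b} x *\<^sub>R (if y \<le> x then complex_of_real (deriv \<phi> x) else 0) =
        indicator {y..b} x *\<^sub>R complex_of_real (deriv \<phi> x)"
      using assms test_function_outside[OF test_function_deriv[OF assms(2)], of b]
      by (cases "x = b") (auto simp: indicator_def)
  qed
  also have "\<dots> = (\<integral>x. complex_of_real (deriv \<phi> x) \<partial>lebesgue_on {y..b})"
    by (rule integral_lebesgue_on[symmetric]) simp
  also have "\<dots> = complex_of_real (\<integral>x. deriv \<phi> x \<partial>lebesgue_on {y..b})" by simp
  also have "(\<integral>x. deriv \<phi> x \<partial>lebesgue_on {y..b}) = integral {y..b} (deriv \<phi>)"
    using smooth_continuous_on[OF smooth_deriv[OF sm]]
    by (intro lebesgue_integral_eq_integral continuous_imp_integrable_real) auto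
  also have "\<dots> = \<phi> b - \<phi> y"
  proof (rule integral_unique[OF fundamental_theorem_of_calculus])
    show "(\<phi> has_vector_derivative deriv \<phi> x) (at x within {y..b})" for x
      using smooth_has_derivative[OF sm, of x] has_real_derivative_iff_has_vector_derivative has_vector_derivative_at_within by blast
  qed (use assms in auto)
  finally show ?thesis using b0 by simp
qed

text \<open>
The integration operator acts on each interval of the partition separately.
\<close>

locale bounded_interval =
  fixes a b :: real and u :: "real \<Rightarrow> complex"
  assumes a_less_b: "a < b" and u: "integrable (lebesgue_on {a<..<b}) u"
begin

abbreviation "MJ \<equiv> lebesgue_on {a<..<b}"

definition primitive_fun :: "real \<Rightarrow> complex" where
  "primitive_fun x = (\<integral>y. (if y \<le> x then u y else 0) \<partial>MJ)"

sublocale finite_measure MJ by (rule finite_measure_lebesgue_on) auto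

sublocale pair_sigma_finite MJ MJ ..

lemma u_meas [measurable]: "u \<in> borel_measurable MJ" using u by simp

lemma integrable_truncation: "integrable MJ (\<lambda>y. if y \<le> x then u y else 0)"
  by (rule Bochner_Integration.integrable_bound[OF u]) auto

lemma integrable_snd_comp: "integrable (MJ \<Otimes>\<^sub>M MJ) (\<lambda>p. u (snd p))"
proof (rule Fubini_integrable)
  show "(\<lambda>p. u (snd p)) \<in> borel_measurable (MJ \<Otimes>\<^sub>M MJ)" by measurable
qed (use u in auto)

lemma integrable_kernel_product:
  assumes [measurable]: "\<psi> \<in> borel_measurable MJ" and B: "\<And>x. \<bar>\<psi> x\<bar> \<le> B"
  shows "integrable (MJ \<Otimes>\<^sub>M MJ) (\<lambda>(x, y). (if y \<le> x then u y else 0) * of_real (\<psi> x))"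
proof (rule Bochner_Integration.integrable_bound)
  show "integrable (MJ \<Otimes>\<^sub>M MJ) (\<lambda>p. of_real B * u (snd p))" using integrable_snd_comp by simp
  show "(\<lambda>(x, y). (if y \<le> x then u y else 0) * complex_of_real (\<psi> x)) \<in> borel_measurable (MJ \<Otimes>\<^sub>M MJ)"
    by measurable
  have B0: "0 \<le> B" using B[of 0] by linarith
  show "AE p in MJ \<Otimes>\<^sub>M MJ. norm (case p of (x, y) \<Rightarrow> (if y \<le> x then u y else 0) * complex_of_real (\<psi> x))
      \<le> norm (of_real B * u (snd p))"
    using B B0 by (intro AE_I2) (auto simp: norm_mult mult.commute intro!: mult_right_mono)
qed

lemma integrable_primitive_fun: "integrable MJ primitive_fun"
proof -
  have "integrable (MJ \<Otimes>\<^sub>M MJ) (\<lambda>(x, y). (if y \<le> x then u y else 0) * of_real 1)"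
    by (rule integrable_kernel_product[of "\<lambda>_. 1" 1]) auto
  from integrable_fst'[OF this] show ?thesis by (simp add: primitive_fun_def[abs_def])
qed

lemma primitive_fun_norm: "(\<integral>x. cmod (primitive_fun x) \<partial>MJ) \<le> (b - a) * (\<integral>x. cmod (u x) \<partial>MJ)"
proof -
  have "cmod (primitive_fun x) \<le> (\<integral>x. cmod (u x) \<partial>MJ)" for x
    unfolding primitive_fun_def using integrable_truncation u
    by (intro order_trans[OF integral_norm_bound] integral_mono) auto
  then have "(\<integral>x. cmod (primitive_fun x) \<partial>MJ) \<le> (\<integral>x. (\<integral>x. cmod (u x) \<partial>MJ) \<partial>MJ)"
    using integrable_primitive_fun by (intro integral_mono) auto
  also have "\<dots> = measure MJ (space MJ) * (\<integral>x. cmod (u x) \<partial>MJ)" by simp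
  also have "measure MJ (space MJ) = b - a"
    using a_less_b by (simp add: space_restrict_space measure_restrict_space)
  finally show ?thesis .
qed

text \<open>
Exchanging the integrals leaves the integral of the derivative of \<open>\<phi>\<close> from \<open>y\<close> to the right end,
where \<open>\<phi>\<close> is zero.
\<close>

lemma primitive_fun_weak_deriv:
  assumes "test_function {a<..<b} \<phi>"
  shows "(\<integral>x. primitive_fun x * of_real (deriv \<phi> x) \<partial>MJ) = - (\<integral>x. u x * of_real (\<phi> x) \<partial>MJ)"
proof -
  note d = test_function_deriv[OF assms]
  obtain B where B: "\<And>x. \<bar>deriv \<phi> x\<bar> \<le> B" using test_function_bounded[OF d] by blast
  let ?G = "\<lambda>x y. (if y \<le> x then u y else 0) * of_real (deriv \<phi> x)"
  have int: "integrable (MJ \<Otimes>\<^sub>M MJ) (\<lambda>(x, y). ?G x y)"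
    by (rule integrable_kernel_product[OF test_function_measurable_lebesgue_on[OF d] B])
  have "(\<integral>x. primitive_fun x * of_real (deriv \<phi> x) \<partial>MJ) = (\<integral>x. (\<integral>y. ?G x y \<partial>MJ) \<partial>MJ)"
    unfolding primitive_fun_def using integrable_truncation by simp
  also have "\<dots> = (\<integral>y. (\<integral>x. ?G x y \<partial>MJ) \<partial>MJ)" by (rule Fubini_integral[OF int, symmetric])
  also have "\<dots> = (\<integral>y. - (u y * of_real (\<phi> y)) \<partial>MJ)"
  proof (rule Bochner_Integration.integral_cong[OF refl])
    fix y assume "y \<in> space MJ"
    then have y: "y \<in> {a<..<b}" by (simp add: space_restrict_space)
    have "(\<integral>x. ?G x y \<partial>MJ) = (\<integral>x. u y * (if y \<le> x then of_real (deriv \<phi> x) else 0) \<partial>MJ)"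
      by (intro Bochner_Integration.integral_cong) auto
    also have "\<dots> = u y * (\<integral>x. (if y \<le> x then of_real (deriv \<phi> x) else 0) \<partial>MJ)" by simp
    finally show "(\<integral>x. ?G x y \<partial>MJ) = - (u y * of_real (\<phi> y))"
      using integral_truncated_test_deriv[OF a_less_b assms y] by simp
  qed
  finally show ?thesis by simp
qed

end

context interval_partition
begin

text \<open>
Elements of \<open>L1\<close> that agree almost everywhere on each interval are equal, so exactly one element
qualifies.
\<close>

definition primitive :: "L1 \<Rightarrow> L1" where
  "primitive u = (SOME h. \<forall>j<N. AE x in lebesgue_on (J j).
     rep_L1 h x = (\<integral>y. (if y \<le> x then rep_L1 u y else 0) \<partial>lebesgue_on (J j)))"

lemma AE_primitive:
  assumes "j < N"
  shows "AE x in lebesgue_on (J j).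
    rep_L1 (primitive u) x = (\<integral>y. (if y \<le> x then rep_L1 u y else 0) \<partial>lebesgue_on (J j))"
proof -
  have "\<exists>h. \<forall>j<N. AE x in lebesgue_on (J j).
     rep_L1 h x = (\<integral>y. (if y \<le> x then rep_L1 u y else 0) \<partial>lebesgue_on (J j))"
  proof (rule glue_integrable)
    fix j assume j: "j < N"
    obtain a b where ab: "a < b" "J j = {a<..<b}" using J_interval[OF j] by blast
    interpret bounded_interval a b "rep_L1 u"
      using ab integrable_rep_J[OF j, of u] by unfold_locales auto
    show "integrable (lebesgue_on (J j)) (\<lambda>x. \<integral>y. (if y \<le> x then rep_L1 u y else 0) \<partial>lebesgue_on (J j))"
      using integrable_primitive_fun unfolding ab primitive_fun_def[abs_def] .
  qed
  from someI_ex[OF this] show ?thesis using assms unfolding primitive_def by blast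
qed

lemma norm_eq_sum: "norm u = (\<Sum>j<N. \<integral>x. cmod (rep_L1 u x) \<partial>lebesgue_on (J j))"
  unfolding norm_L1_def using integrable_rep_L1 by (intro set_integral_split(1)) auto

lemma norm_primitive_le: "norm (primitive u) \<le> norm u"
  unfolding norm_eq_sum
proof (intro sum_mono)
  fix j assume "j \<in> {..<N}"
  then have j: "j < N" by simp
  obtain a b where ab: "a < b" "J j = {a<..<b}" using J_interval[OF j] by blast
  interpret bounded_interval a b "rep_L1 u"
    using ab integrable_rep_J[OF j, of u] by unfold_locales auto
  have "{a<..<b} \<subseteq> {0..1}" using J_subset[OF j] ab by simp
  then have "b - a \<le> 1" using ab(1) by (simp add: greaterThanLessThan_subseteq_atLeastAtMost_iff)
  have "(\<integral>x. cmod (rep_L1 (primitive u) x) \<partial>lebesgue_on (J j)) = (\<integral>x. cmod (primitive_fun x) \<partial>lebesgue_on (J j))"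
    using AE_primitive[OF j, of u] integrable_rep_J[OF j, of "primitive u"] integrable_primitive_fun
    unfolding ab primitive_fun_def[symmetric]
    by (intro integral_cong_AE) (auto elim: AE_mp)
  also have "\<dots> \<le> (b - a) * (\<integral>x. cmod (rep_L1 u x) \<partial>lebesgue_on (J j))"
    using primitive_fun_norm ab by simp
  also have "\<dots> \<le> 1 * (\<integral>x. cmod (rep_L1 u x) \<partial>lebesgue_on (J j))"
    using \<open>b - a \<le> 1\<close> by (intro mult_right_mono) auto
  finally show "(\<integral>x. cmod (rep_L1 (primitive u) x) \<partial>lebesgue_on (J j)) \<le> (\<integral>x. cmod (rep_L1 u x) \<partial>lebesgue_on (J j))"
    by simp
qed

lemma has_weak_deriv_primitive: "has_weak_deriv N J 1 (primitive u) u"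
  unfolding has_weak_deriv_iff
proof (intro allI impI)
  fix j \<phi> assume j: "j < N" and \<phi>: "test_function (J j) \<phi>"
  obtain a b where ab: "a < b" "J j = {a<..<b}" using J_interval[OF j] by blast
  interpret bounded_interval a b "rep_L1 u"
    using ab integrable_rep_J[OF j, of u] by unfold_locales auto
  have "test_pairing (J j) (primitive u) (deriv \<phi>) = (\<integral>x. primitive_fun x * of_real (deriv \<phi> x) \<partial>lebesgue_on (J j))"
    using AE_primitive[OF j, of u] integrable_primitive_fun unfolding ab primitive_fun_def[symmetric]
    by (intro test_pairing_cong[OF j test_function_deriv[OF \<phi>], unfolded ab]) auto
  then show "test_pairing (J j) (primitive u) ((deriv ^^ 1) \<phi>) = (-1) ^ 1 * test_pairing (J j) u \<phi>"
    using primitive_fun_weak_deriv \<phi> by (simp add: ab test_pairing_def)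
qed

lemma integrable_truncated_rep:
  "j < N \<Longrightarrow> integrable (lebesgue_on (J j)) (\<lambda>y. if y \<le> x then rep_L1 u y else 0)"
  using borel_measurable_integrable[OF integrable_rep_J[of j u]]
  by (intro Bochner_Integration.integrable_bound[OF integrable_rep_J[of j u]]) auto

lemma primitive_add: "primitive (u + v) = primitive u + primitive v"
  unfolding L1_eq_iff
proof (intro allI impI)
  fix j assume j: "j < N"
  have rep: "AE y in lebesgue_on (J j). rep_L1 (u + v) y = rep_L1 u y + rep_L1 v y"
    and rep': "AE y in lebesgue_on (J j). rep_L1 (primitive u + primitive v) y = rep_L1 (primitive u) y + rep_L1 (primitive v) y"
    using AE_rep_plus AE_unit_iff j by blast+
  have "(\<integral>y. (if y \<le> x then rep_L1 (u + v) y else 0) \<partial>lebesgue_on (J j)) =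
      (\<integral>y. (if y \<le> x then rep_L1 u y else 0) + (if y \<le> x then rep_L1 v y else 0) \<partial>lebesgue_on (J j))" for x
    using integrable_truncated_rep[OF j, of x] rep
    by (intro integral_cong_AE borel_measurable_integrable Bochner_Integration.integrable_add) (auto elim: AE_mp)
  then have eq: "(\<integral>y. (if y \<le> x then rep_L1 (u + v) y else 0) \<partial>lebesgue_on (J j)) =
      (\<integral>y. (if y \<le> x then rep_L1 u y else 0) \<partial>lebesgue_on (J j)) + (\<integral>y. (if y \<le> x then rep_L1 v y else 0) \<partial>lebesgue_on (J j))" for x
    using integrable_truncated_rep[OF j, of x] by simp
  show "AE x in lebesgue_on (J j). rep_L1 (primitive (u + v)) x = rep_L1 (primitive u + primitive v) x"
    using rep' AE_primitive[OF j, of u] AE_primitive[OF j, of v] AE_primitive[OF j, of "u + v"]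
    by eventually_elim (simp only: eq)
qed

lemma primitive_scale: "primitive (scale_L1 c u) = scale_L1 c (primitive u)"
  unfolding L1_eq_iff
proof (intro allI impI)
  fix j assume j: "j < N"
  have rep: "AE y in lebesgue_on (J j). rep_L1 (scale_L1 c u) y = c * rep_L1 u y"
    and rep': "AE y in lebesgue_on (J j). rep_L1 (scale_L1 c (primitive u)) y = c * rep_L1 (primitive u) y"
    using AE_rep_scale AE_unit_iff j by blast+
  have "(\<integral>y. (if y \<le> x then rep_L1 (scale_L1 c u) y else 0) \<partial>lebesgue_on (J j)) =
      (\<integral>y. c * (if y \<le> x then rep_L1 u y else 0) \<partial>lebesgue_on (J j))" for x
    using integrable_truncated_rep[OF j, of x] rep
    by (intro integral_cong_AE borel_measurable_integrable) (auto elim: AE_mp)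
  then have eq: "(\<integral>y. (if y \<le> x then rep_L1 (scale_L1 c u) y else 0) \<partial>lebesgue_on (J j)) =
      c * (\<integral>y. (if y \<le> x then rep_L1 u y else 0) \<partial>lebesgue_on (J j))" for x
    by simp
  show "AE x in lebesgue_on (J j). rep_L1 (primitive (scale_L1 c u)) x = rep_L1 (scale_L1 c (primitive u)) x"
    using rep' AE_primitive[OF j, of u] AE_primitive[OF j, of "scale_L1 c u"]
    by eventually_elim (simp only: eq)
qed

lemma primitive_power_add: "(primitive ^^ r) (u + v) = (primitive ^^ r) u + (primitive ^^ r) v"
  by (induction r) (simp_all add: primitive_add)

lemma primitive_power_scale: "(primitive ^^ r) (scale_L1 c u) = scale_L1 c ((primitive ^^ r) u)"
  by (induction r) (simp_all add: primitive_scale)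

lemma norm_primitive_power_le: "norm ((primitive ^^ r) u) \<le> norm u"
  by (induction r) (auto intro: order_trans[OF norm_primitive_le])

text \<open>
Iterated integration is a right inverse of every order of differentiation and a bounded map into the
Sobolev space.
\<close>

lemma has_weak_deriv_primitive_power:
  "has_weak_deriv N J l ((primitive ^^ (l + m)) u) ((primitive ^^ m) u)"
proof (induction l)
  case 0
  show ?case using has_weak_deriv_0 by simp
next
  case (Suc l)
  show ?case using has_weak_deriv_Suc[OF has_weak_deriv_primitive Suc] by simp
qed

lemma primitive_power_sobolev: "(primitive ^^ r) u \<in> sobolev N J r"
  unfolding sobolev_def
proof (intro CollectI allI impI)
  fix l assume "l \<le> r"
  then show "\<exists>g. has_weak_deriv N J l ((primitive ^^ r) u) g"
    using has_weak_deriv_primitive_power[of l "r - l" u] by auto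
qed

lemma weak_deriv_primitive_power: "weak_deriv N J r ((primitive ^^ r) u) = u"
  using weak_deriv_eq[OF has_weak_deriv_primitive_power[of r 0 u]] by simp

lemma sobolev_norm_primitive_power:
  "sobolev_norm N J r ((primitive ^^ r) u) \<le> real (Suc r) * norm u"
proof -
  have "norm (weak_deriv N J l ((primitive ^^ r) u)) \<le> norm u" if "l \<le> r" for l
    using weak_deriv_eq[OF has_weak_deriv_primitive_power[of l "r - l" u]] that norm_primitive_power_le by simp
  then have "sobolev_norm N J r ((primitive ^^ r) u) \<le> (\<Sum>l\<le>r. norm u)"
    unfolding sobolev_norm_eq by (intro sum_mono) auto
  then show ?thesis by simp
qed

text \<open>
The conditional expectation given the partition, a projection of \<open>L1\<close> onto the piecewise constant
functions; it is the \<open>Q\<close> of the introduction.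
\<close>

definition piece_mean :: "L1 \<Rightarrow> L1" where
  "piece_mean u = (SOME h. \<forall>j<N. AE x in lebesgue_on (J j).
     rep_L1 h x = (\<integral>y. rep_L1 u y \<partial>lebesgue_on (J j)) / of_real (measure lebesgue (J j)))"

lemma measure_J: "j < N \<Longrightarrow> measure lebesgue (J j) > 0"
  using J_interval[of j] by auto

lemma finite_measure_J: "j < N \<Longrightarrow> finite_measure (lebesgue_on (J j))"
  using J_interval[of j] by (auto intro!: finite_measure_lebesgue_on)

lemma measure_space_J: "j < N \<Longrightarrow> measure (lebesgue_on (J j)) (J j) = measure lebesgue (J j)"
  by (simp add: measure_restrict_space)

lemma AE_piece_mean:
  assumes "j < N"
  shows "AE x in lebesgue_on (J j).
     rep_L1 (piece_mean u) x = (\<integral>y. rep_L1 u y \<partial>lebesgue_on (J j)) / of_real (measure lebesgue (J j))"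
proof -
  have "\<exists>h. \<forall>j<N. AE x in lebesgue_on (J j).
     rep_L1 h x = (\<integral>y. rep_L1 u y \<partial>lebesgue_on (J j)) / of_real (measure lebesgue (J j))"
    by (rule glue_integrable) (rule finite_measure.integrable_const[OF finite_measure_J])
  from someI_ex[OF this] show ?thesis using assms unfolding piece_mean_def by blast
qed

lemma piece_mean_const: "piece_mean u \<in> piecewise_poly N J 0"
  using AE_piece_mean unfolding piecewise_poly_0_iff by blast

lemma piece_mean_idem:
  assumes "u \<in> piecewise_poly N J 0" shows "piece_mean u = u"
  unfolding L1_eq_iff
proof (intro allI impI)
  fix j assume j: "j < N"
  obtain c where c: "AE x in lebesgue_on (J j). rep_L1 u x = c"
    using assms j by (auto simp: piecewise_poly_0_iff)
  have "(\<integral>y. rep_L1 u y \<partial>lebesgue_on (J j)) = (\<integral>y. c \<partial>lebesgue_on (J j))"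
    using borel_measurable_integrable[OF integrable_rep_J[OF j, of u]] c
    by (intro integral_cong_AE) auto
  also have "\<dots> = measure lebesgue (J j) *\<^sub>R c" by (simp add: measure_space_J[OF j])
  finally have eq: "(\<integral>y. rep_L1 u y \<partial>lebesgue_on (J j)) / of_real (measure lebesgue (J j)) = c"
    using measure_J[OF j] by (simp add: scaleR_conv_of_real)
  show "AE x in lebesgue_on (J j). rep_L1 (piece_mean u) x = rep_L1 u x"
    using AE_piece_mean[OF j, of u] c by eventually_elim (simp only: eq)
qed

lemma norm_piece_mean_le: "norm (piece_mean u) \<le> norm u"
  unfolding norm_eq_sum
proof (intro sum_mono)
  fix j assume "j \<in> {..<N}"
  then have j: "j < N" by simp
  let ?I = "\<integral>y. rep_L1 u y \<partial>lebesgue_on (J j)"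
  have "(\<integral>x. cmod (rep_L1 (piece_mean u) x) \<partial>lebesgue_on (J j)) =
      (\<integral>x. cmod (?I / of_real (measure lebesgue (J j))) \<partial>lebesgue_on (J j))"
    using AE_piece_mean[OF j, of u] borel_measurable_integrable[OF integrable_rep_J[OF j, of "piece_mean u"]]
    by (intro integral_cong_AE) auto
  also have "\<dots> = cmod ?I" using measure_J[OF j] by (simp add: measure_space_J[OF j] norm_divide)
  also have "\<dots> \<le> (\<integral>x. cmod (rep_L1 u x) \<partial>lebesgue_on (J j))" by (rule integral_norm_bound)
  finally show "(\<integral>x. cmod (rep_L1 (piece_mean u) x) \<partial>lebesgue_on (J j)) \<le> (\<integral>x. cmod (rep_L1 u x) \<partial>lebesgue_on (J j))" .
qed

lemma piece_mean_add: "piece_mean (u + v) = piece_mean u + piece_mean v"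
  unfolding L1_eq_iff
proof (intro allI impI)
  fix j assume j: "j < N"
  have rep: "AE y in lebesgue_on (J j). rep_L1 (u + v) y = rep_L1 u y + rep_L1 v y"
    and rep': "AE y in lebesgue_on (J j). rep_L1 (piece_mean u + piece_mean v) y = rep_L1 (piece_mean u) y + rep_L1 (piece_mean v) y"
    using AE_rep_plus AE_unit_iff j by blast+
  have "(\<integral>y. rep_L1 (u + v) y \<partial>lebesgue_on (J j)) = (\<integral>y. rep_L1 u y + rep_L1 v y \<partial>lebesgue_on (J j))"
    using integrable_rep_J[OF j] rep
    by (intro integral_cong_AE borel_measurable_integrable Bochner_Integration.integrable_add) auto
  then have eq: "(\<integral>y. rep_L1 (u + v) y \<partial>lebesgue_on (J j)) = (\<integral>y. rep_L1 u y \<partial>lebesgue_on (J j)) + (\<integral>y. rep_L1 v y \<partial>lebesgue_on (J j))"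
    using integrable_rep_J[OF j] by simp
  show "AE x in lebesgue_on (J j). rep_L1 (piece_mean (u + v)) x = rep_L1 (piece_mean u + piece_mean v) x"
    using rep' AE_piece_mean[OF j, of u] AE_piece_mean[OF j, of v] AE_piece_mean[OF j, of "u + v"]
    by eventually_elim (simp only: eq add_divide_distrib)
qed

lemma piece_mean_scale: "piece_mean (scale_L1 c u) = scale_L1 c (piece_mean u)"
  unfolding L1_eq_iff
proof (intro allI impI)
  fix j assume j: "j < N"
  have rep: "AE y in lebesgue_on (J j). rep_L1 (scale_L1 c u) y = c * rep_L1 u y"
    and rep': "AE y in lebesgue_on (J j). rep_L1 (scale_L1 c (piece_mean u)) y = c * rep_L1 (piece_mean u) y"
    using AE_rep_scale AE_unit_iff j by blast+
  have "(\<integral>y. rep_L1 (scale_L1 c u) y \<partial>lebesgue_on (J j)) = (\<integral>y. c * rep_L1 u y \<partial>lebesgue_on (J j))"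
    using borel_measurable_integrable[OF integrable_rep_J[OF j]] rep
    by (intro integral_cong_AE borel_measurable_times borel_measurable_const) auto
  then have eq: "(\<integral>y. rep_L1 (scale_L1 c u) y \<partial>lebesgue_on (J j)) = c * (\<integral>y. rep_L1 u y \<partial>lebesgue_on (J j))"
    by simp
  show "AE x in lebesgue_on (J j). rep_L1 (piece_mean (scale_L1 c u)) x = rep_L1 (scale_L1 c (piece_mean u)) x"
    using rep' AE_piece_mean[OF j, of u] AE_piece_mean[OF j, of "scale_L1 c u"]
    by eventually_elim (simp only: eq times_divide_eq_right)
qed

end


section \<open>Transfer operators of Markov maps\<close>

lemma AE_lebesgue_affine:
  fixes c t :: real
  assumes "AE x in lebesgue. P x" "c \<noteq> 0"
  shows "AE x in lebesgue. P (t + c * x)"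
proof -
  obtain Z where Z: "Z \<in> null_sets lebesgue" "{x. \<not> P x} \<subseteq> Z"
    using assms(1) by (auto simp: eventually_ae_filter)
  have eq: "(\<lambda>x. t + c * x) -` Z = (\<lambda>x. (1/c) *\<^sub>R x + (- t / c)) ` Z"
  proof (intro equalityI subsetI)
    fix x assume "x \<in> (\<lambda>x. t + c * x) -` Z"
    then have "t + c * x \<in> Z" by simp
    moreover have "x = (1/c) *\<^sub>R (t + c * x) + (- t / c)" using assms(2) by (simp add: field_simps)
    ultimately show "x \<in> (\<lambda>x. (1/c) *\<^sub>R x + (- t / c)) ` Z" by blast
  next
    fix x assume "x \<in> (\<lambda>x. (1/c) *\<^sub>R x + (- t / c)) ` Z"
    then show "x \<in> (\<lambda>x. t + c * x) -` Z" using assms(2) by (auto simp: field_simps)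
  qed
  have "emeasure lebesgue ((\<lambda>x. t + c * x) -` Z) = 0"
    unfolding eq using emeasure_lebesgue_affine[of "1/c" "- t / c" Z] Z(1) by (simp add: null_setsD1)
  moreover have "(\<lambda>x. t + c * x) -` Z \<in> sets lebesgue"
  proof -
    have "(\<lambda>x. t + c * x) \<in> lebesgue \<rightarrow>\<^sub>M lebesgue"
      using lebesgue_affine_measurable[where c = "\<lambda>x::real. c" and t = t] assms(2) by simp
    from measurable_sets[OF this, of Z] show ?thesis using Z(1) by auto
  qed
  ultimately have "(\<lambda>x. t + c * x) -` Z \<in> null_sets lebesgue" by (intro null_setsI)
  then show ?thesis by (rule AE_I') (use Z(2) in auto)
qed

locale markov_map =
  fixes f :: "real \<Rightarrow> real" and N :: nat and J :: "nat \<Rightarrow> real set"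
  assumes markov: "pa_expanding_markov f N J"
begin

sublocale interval_partition N J
  using markov unfolding pa_expanding_markov_def by unfold_locales auto

lemmas markov_conjuncts = markov[unfolded pa_expanding_markov_def, THEN conjunct2, THEN conjunct2,
    THEN conjunct2, THEN conjunct2]

lemmas markov_property = markov_conjuncts[THEN conjunct1]
lemmas constant_slope = markov_conjuncts[THEN conjunct2]

abbreviation "s \<equiv> slope f J"

lemma slope_props:
  assumes "j < N"
  shows slope_gt_1: "s j > 1" and f_has_derivative: "x \<in> J j \<Longrightarrow> (f has_real_derivative s j) (at x)"
proof -
  obtain c where c: "c > 1" "\<forall>x\<in>J j. (f has_real_derivative c) (at x)"
    using constant_slope assms by blast
  obtain a b where ab: "a < b" "J j = {a<..<b}" using J_interval[OF assms] by blast
  then have "(a + b) / 2 \<in> J j" by (simp add: field_simps)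
  then have "s j = c" unfolding slope_def using c(2) DERIV_unique by (intro the_equality) blast+
  then show "s j > 1" "x \<in> J j \<Longrightarrow> (f has_real_derivative s j) (at x)" using c by auto
qed

lemma slope_nonzero: "j < N \<Longrightarrow> s j \<noteq> 0" and slope_pos: "j < N \<Longrightarrow> s j > 0"
  using slope_gt_1[of j] by auto

lemma f_affine_on_piece:
  assumes "j < N" shows "\<exists>t. \<forall>x\<in>J j. f x = t + s j * x"
proof -
  obtain a b where ab: "J j = {a<..<b}" using J_interval[OF assms] by blast
  have "\<exists>t. \<forall>x\<in>J j. f x - s j * x = t"
  proof (rule has_field_derivative_zero_constant)
    show "convex (J j)" by (simp add: ab)
    fix x assume "x \<in> J j"
    then have "((\<lambda>x. f x - s j * x) has_real_derivative s j - s j * 1) (at x)"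
      using f_has_derivative[OF assms] by (intro derivative_intros) auto
    then show "((\<lambda>x. f x - s j * x) has_real_derivative 0) (at x within J j)"
      by (simp add: has_field_derivative_at_within)
  qed
  then obtain t where "\<forall>x\<in>J j. f x - s j * x = t" by blast
  then show ?thesis by (intro exI[of _ t]) auto
qed

text \<open>
The branch of \<open>f\<close> on \<open>J j\<close> is the restriction of the affine map \<open>y \<mapsto> offset j + s j * y\<close> of the line;
\<open>branch j\<close> is the inverse of that map and thus is defined everywhere.
\<close>

definition offset :: "nat \<Rightarrow> real" where
  "offset j = (SOME t. \<forall>x\<in>J j. f x = t + s j * x)"

lemma f_eq: "j < N \<Longrightarrow> x \<in> J j \<Longrightarrow> f x = offset j + s j * x"
  using someI_ex[OF f_affine_on_piece, of j] unfolding offset_def by blast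

definition branch :: "nat \<Rightarrow> real \<Rightarrow> real" where
  "branch j x = - (offset j / s j) + (1 / s j) * x"

lemma branch_inverse: "j < N \<Longrightarrow> branch j x = y \<longleftrightarrow> x = offset j + s j * y"
  using slope_nonzero[of j] by (auto simp: branch_def field_simps)

lemma branch_mem_iff: "j < N \<Longrightarrow> branch j x \<in> J j \<longleftrightarrow> x \<in> f ` J j"
  using f_eq[of j] branch_inverse[of j x] by (auto simp: image_iff) metis

lemma markov_cases:
  assumes "i < N" "j < N" "x \<in> J i" shows "branch j x \<in> J j \<longleftrightarrow> J i \<subseteq> f ` J j"
  using markov_property assms branch_mem_iff[OF assms(2), of x] by blast

definition preimage_sum :: "nat \<Rightarrow> (real \<Rightarrow> complex) \<Rightarrow> real \<Rightarrow> complex" where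
  "preimage_sum k u x = (\<Sum>j<N. indicator (J j) (branch j x) *\<^sub>R u (branch j x) / of_real (s j) ^ k)"

lemma preimage_sum_eq:
  "(\<Sum>y | y \<in> (\<Union>j<N. J j) \<and> f y = x. u y / of_real (deriv f y) ^ k) = preimage_sum k u x"
proof -
  let ?I = "{j. j < N \<and> branch j x \<in> J j}"
  have set: "{y. y \<in> (\<Union>j<N. J j) \<and> f y = x} = (\<lambda>j. branch j x) ` ?I"
  proof (intro equalityI subsetI)
    fix y assume "y \<in> {y. y \<in> (\<Union>j<N. J j) \<and> f y = x}"
    then obtain j where j: "j < N" "y \<in> J j" "f y = x" by blast
    then have "branch j x = y" using branch_inverse f_eq by metis
    then show "y \<in> (\<lambda>j. branch j x) ` ?I" using j by blast
  next
    fix y assume "y \<in> (\<lambda>j. branch j x) ` ?I"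
    then obtain j where j: "j < N" "branch j x \<in> J j" "y = branch j x" by blast
    have "f y = x" using branch_inverse[OF j(1), of x y] f_eq[OF j(1), of y] j by simp
    moreover have "y \<in> (\<Union>j<N. J j)" using j by auto
    ultimately show "y \<in> {y. y \<in> (\<Union>j<N. J j) \<and> f y = x}" by simp
  qed
  have "inj_on (\<lambda>j. branch j x) ?I"
  proof (rule inj_onI)
    fix i j assume ij: "i \<in> ?I" "j \<in> ?I" "branch i x = branch j x"
    show "i = j" by (rule J_unique[of i j "branch j x"]) (use ij in auto)
  qed
  then have "(\<Sum>y | y \<in> (\<Union>j<N. J j) \<and> f y = x. u y / of_real (deriv f y) ^ k) =
      (\<Sum>j\<in>?I. u (branch j x) / of_real (deriv f (branch j x)) ^ k)"
    unfolding set by (simp add: sum.reindex)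
  also have "\<dots> = (\<Sum>j\<in>?I. indicator (J j) (branch j x) *\<^sub>R u (branch j x) / of_real (s j) ^ k)"
    using DERIV_imp_deriv[OF f_has_derivative] by (intro sum.cong) auto
  also have "\<dots> = preimage_sum k u x"
    unfolding preimage_sum_def by (intro sum.mono_neutral_left) auto
  finally show ?thesis .
qed

lemma integrable_zero_extension:
  fixes u :: "real \<Rightarrow> complex"
  assumes "integrable unit_leb u" "j < N"
  shows "integrable lebesgue (\<lambda>y. indicator (J j) y *\<^sub>R u y)"
  using integrable_on_J[OF assms] assms(2) by (simp add: integrable_lebesgue_on_iff)

lemma branch_change_of_variables:
  fixes F :: "real \<Rightarrow> 'a::euclidean_space"
  assumes "j < N"
  shows "integrable lebesgue (\<lambda>x. F (branch j x)) \<longleftrightarrow> integrable lebesgue F"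
    and "(\<integral>x. F (branch j x) \<partial>lebesgue) = s j *\<^sub>R (\<integral>y. F y \<partial>lebesgue)"
proof -
  have c: "1 / s j \<noteq> 0" using slope_nonzero[OF assms] by simp
  show "integrable lebesgue (\<lambda>x. F (branch j x)) \<longleftrightarrow> integrable lebesgue F"
    unfolding branch_def by (rule lebesgue_integrable_real_affine_iff[OF c])
  have "(\<integral>y. F y \<partial>lebesgue) = \<bar>1 / s j\<bar> *\<^sub>R (\<integral>x. F (branch j x) \<partial>lebesgue)"
    unfolding branch_def by (rule lebesgue_integral_real_affine[OF c])
  then show "(\<integral>x. F (branch j x) \<partial>lebesgue) = s j *\<^sub>R (\<integral>y. F y \<partial>lebesgue)"
    using slope_pos[OF assms] by simp
qed

lemma integrable_branch_term:
  fixes u :: "real \<Rightarrow> complex"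
  assumes "integrable unit_leb u" "j < N"
  shows "integrable lebesgue (\<lambda>x. indicator (J j) (branch j x) *\<^sub>R u (branch j x) / of_real (s j) ^ k)"
  using branch_change_of_variables(1)[OF assms(2), of "\<lambda>y. indicator (J j) y *\<^sub>R u y / of_real (s j) ^ k"]
    integrable_divide[OF integrable_zero_extension[OF assms], of "of_real (s j) ^ k"] by blast

lemma integrable_preimage_sum:
  assumes "integrable unit_leb u"
  shows "integrable lebesgue (preimage_sum k u)"
    and "S \<in> sets lebesgue \<Longrightarrow> integrable (lebesgue_on S) (preimage_sum k u)"
proof -
  show *: "integrable lebesgue (preimage_sum k u)"
    unfolding preimage_sum_def[abs_def]
    by (intro Bochner_Integration.integrable_sum integrable_branch_term assms) simp
  then show "integrable (lebesgue_on S) (preimage_sum k u)" if "S \<in> sets lebesgue"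
    using that integrable_lebesgue_on_subset[of UNIV _ S] by (simp add: lebesgue_on_UNIV_eq)
qed

text \<open>
Inverse branches are affine and nonconstant, so that null sets have null preimages under them. Hence
the transfer operator may be computed from any representative.
\<close>

lemma preimage_sum_AE_cong:
  assumes "AE x in unit_leb. u x = v x"
  shows "AE x in unit_leb. preimage_sum k u x = preimage_sum k v x"
proof -
  have "AE x in lebesgue. x \<in> {0..1} \<longrightarrow> u x = v x" using assms by (simp add: AE_restrict_space_iff)
  then have "AE x in lebesgue. branch j x \<in> {0..1} \<longrightarrow> u (branch j x) = v (branch j x)" if "j \<in> {..<N}" for j
    unfolding branch_def using that slope_nonzero by (intro AE_lebesgue_affine) auto
  then have "AE x in lebesgue. \<forall>j\<in>{..<N}. branch j x \<in> {0..1} \<longrightarrow> u (branch j x) = v (branch j x)"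
    by (intro AE_finite_allI) auto
  then have "AE x in lebesgue. preimage_sum k u x = preimage_sum k v x"
  proof eventually_elim
    case (elim x)
    show ?case unfolding preimage_sum_def
    proof (intro sum.cong refl)
      fix j assume "j \<in> {..<N}"
      then show "indicator (J j) (branch j x) *\<^sub>R u (branch j x) / complex_of_real (s j) ^ k =
          indicator (J j) (branch j x) *\<^sub>R v (branch j x) / complex_of_real (s j) ^ k"
        using elim J_subset[of j] by (cases "branch j x \<in> J j") auto
    qed
  qed
  then show ?thesis by (auto simp: AE_restrict_space_iff elim: eventually_mono)
qed

abbreviation "L \<equiv> transfer_op f N J"

lemma transfer_op_eq: "L k h = abs_L1 (preimage_sum k (rep_L1 h))"
  unfolding transfer_op_def preimage_sum_eq by simp

lemma AE_transfer: "AE x in unit_leb. rep_L1 (L k h) x = preimage_sum k (rep_L1 h) x"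
  unfolding transfer_op_eq by (intro AE_rep_abs_L1 integrable_preimage_sum integrable_rep_L1) simp

lemma AE_transfer':
  assumes "AE x in unit_leb. rep_L1 h x = u x"
  shows "AE x in unit_leb. rep_L1 (L k h) x = preimage_sum k u x"
  using AE_transfer[of k h] preimage_sum_AE_cong[OF assms, of k] by eventually_elim simp

lemma transfer_add: "L k (h + h') = L k h + L k h'"
proof (rule L1_eqI)
  have eq: "preimage_sum k (\<lambda>x. rep_L1 h x + rep_L1 h' x) x = preimage_sum k (rep_L1 h) x + preimage_sum k (rep_L1 h') x" for x
    by (simp add: preimage_sum_def scaleR_add_right add_divide_distrib sum.distrib del: indicator_scaleR_eq_if)
  show "AE x in unit_leb. rep_L1 (L k (h + h')) x = rep_L1 (L k h + L k h') x"
    using AE_transfer'[OF AE_rep_plus, of k h h'] AE_transfer[of k h] AE_transfer[of k h'] AE_rep_plus[of "L k h" "L k h'"]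
    by eventually_elim (simp add: eq)
qed

lemma transfer_scale: "L k (scale_L1 c h) = scale_L1 c (L k h)"
proof (rule L1_eqI)
  have eq: "preimage_sum k (\<lambda>x. c * rep_L1 h x) x = c * preimage_sum k (rep_L1 h) x" for x
    by (simp add: preimage_sum_def sum_distrib_left del: indicator_scaleR_eq_if)
  show "AE x in unit_leb. rep_L1 (L k (scale_L1 c h)) x = rep_L1 (scale_L1 c (L k h)) x"
    using AE_transfer'[OF AE_rep_scale, of k c h] AE_transfer[of k h] AE_rep_scale[of c "L k h"]
    by eventually_elim (simp add: eq)
qed

text \<open>
The substitution \<open>x = f y\<close> on \<open>J j\<close> has Jacobian \<open>s j\<close>, and the weight contributes \<open>s j\<close> to the power
\<open>- k\<close>.
\<close>

lemma norm_transfer_le: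
  assumes C: "\<And>j. j < N \<Longrightarrow> s j / s j ^ k \<le> C"
  shows "norm (L k h) \<le> C * norm h"
proof -
  let ?u = "rep_L1 h"
  have int_term: "integrable lebesgue (\<lambda>x. cmod (indicator (J j) (branch j x) *\<^sub>R ?u (branch j x) / of_real (s j) ^ k))"
    and term_le: "(\<integral>x. cmod (indicator (J j) (branch j x) *\<^sub>R ?u (branch j x) / of_real (s j) ^ k) \<partial>lebesgue)
      \<le> C * (\<integral>x. cmod (?u x) \<partial>lebesgue_on (J j))" if j: "j < N" for j
  proof -
    show "integrable lebesgue (\<lambda>x. cmod (indicator (J j) (branch j x) *\<^sub>R ?u (branch j x) / of_real (s j) ^ k))"
      using integrable_branch_term[OF integrable_rep_L1 j] by (rule integrable_norm)
    have "(\<integral>x. cmod (indicator (J j) (branch j x) *\<^sub>R ?u (branch j x) / of_real (s j) ^ k) \<partial>lebesgue)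
      = s j *\<^sub>R (\<integral>y. cmod (indicator (J j) y *\<^sub>R ?u y / of_real (s j) ^ k) \<partial>lebesgue)"
      by (rule branch_change_of_variables(2)[OF j])
    also have "\<dots> = s j *\<^sub>R (\<integral>y. indicator (J j) y *\<^sub>R cmod (?u y) / s j ^ k \<partial>lebesgue)"
      using slope_pos[OF j] by (simp add: norm_divide norm_power)
    also have "\<dots> = (s j / s j ^ k) * (\<integral>x. cmod (?u x) \<partial>lebesgue_on (J j))"
      using j by (simp add: integral_lebesgue_on del: indicator_scaleR_eq_if)
    also have "\<dots> \<le> C * (\<integral>x. cmod (?u x) \<partial>lebesgue_on (J j))"
      by (intro mult_right_mono C[OF j]) simp
    finally show "(\<integral>x. cmod (indicator (J j) (branch j x) *\<^sub>R ?u (branch j x) / of_real (s j) ^ k) \<partial>lebesgue)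
      \<le> C * (\<integral>x. cmod (?u x) \<partial>lebesgue_on (J j))" .
  qed
  have "norm (L k h) = (\<integral>x. cmod (preimage_sum k ?u x) \<partial>unit_leb)"
    unfolding transfer_op_eq by (intro norm_abs_L1 integrable_preimage_sum integrable_rep_L1) simp
  also have "\<dots> = (\<integral>x. indicator {0..1} x *\<^sub>R cmod (preimage_sum k ?u x) \<partial>lebesgue)"
    by (rule integral_lebesgue_on) simp
  also have "\<dots> \<le> (\<integral>x. (\<Sum>j<N. cmod (indicator (J j) (branch j x) *\<^sub>R ?u (branch j x) / of_real (s j) ^ k)) \<partial>lebesgue)"
  proof (rule integral_mono)
    show "integrable lebesgue (\<lambda>x. indicator {0..1} x *\<^sub>R cmod (preimage_sum k ?u x))"
      by (intro integrable_mult_indicator integrable_norm integrable_preimage_sum integrable_rep_L1) simp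
    show "integrable lebesgue (\<lambda>x. \<Sum>j<N. cmod (indicator (J j) (branch j x) *\<^sub>R ?u (branch j x) / of_real (s j) ^ k))"
      by (intro Bochner_Integration.integrable_sum int_term) simp
    fix x
    have "indicator {0..1} x *\<^sub>R cmod (preimage_sum k ?u x) \<le> cmod (preimage_sum k ?u x)"
      by (simp add: indicator_def)
    also have "\<dots> \<le> (\<Sum>j<N. cmod (indicator (J j) (branch j x) *\<^sub>R ?u (branch j x) / of_real (s j) ^ k))"
      unfolding preimage_sum_def by (rule norm_sum)
    finally show "indicator {0..1} x *\<^sub>R cmod (preimage_sum k ?u x)
      \<le> (\<Sum>j<N. cmod (indicator (J j) (branch j x) *\<^sub>R ?u (branch j x) / of_real (s j) ^ k))" .
  qed
  also have "\<dots> = (\<Sum>j<N. \<integral>x. cmod (indicator (J j) (branch j x) *\<^sub>R ?u (branch j x) / of_real (s j) ^ k) \<partial>lebesgue)"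
    by (intro Bochner_Integration.integral_sum int_term) simp
  also have "\<dots> \<le> (\<Sum>j<N. C * (\<integral>x. cmod (?u x) \<partial>lebesgue_on (J j)))"
    by (intro sum_mono term_le) simp
  also have "\<dots> = C * norm h"
    using set_integral_split(1)[OF integrable_norm[OF integrable_rep_L1[of h]]] by (simp add: norm_L1_def sum_distrib_left)
  finally show ?thesis .
qed

text \<open>
Duality: against test functions the transfer operator becomes composition with the branches of \<open>f\<close>,
and no derivative of \<open>h\<close> is involved.
\<close>

lemma transfer_pairing:
  assumes i: "i < N" and \<phi>: "test_function (J i) \<phi>"
  shows "test_pairing (J i) (L k h) \<phi> =
    (\<Sum>j<N. of_real (s j / s j ^ k) * test_pairing (J j) h (\<lambda>y. \<phi> (offset j + s j * y)))"
proof -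
  let ?u = "rep_L1 h"
  have z: "indicator (J i) x *\<^sub>R (c * complex_of_real (\<phi> x)) = c * of_real (\<phi> x)" for x c
    using test_function_outside[OF \<phi>, of x] by (auto simp: indicator_def)
  have "test_pairing (J i) (L k h) \<phi> = (\<integral>x. preimage_sum k ?u x * of_real (\<phi> x) \<partial>lebesgue_on (J i))"
    using AE_transfer[of k h] i by (intro test_pairing_cong[OF i \<phi>])
     (auto simp: AE_unit_iff intro!: borel_measurable_integrable integrable_preimage_sum integrable_rep_L1)
  also have "\<dots> = (\<integral>x. preimage_sum k ?u x * of_real (\<phi> x) \<partial>lebesgue)"
    using i by (simp add: integral_lebesgue_on z del: indicator_scaleR_eq_if)
  also have "\<dots> = (\<integral>x. (\<Sum>j<N. indicator (J j) (branch j x) *\<^sub>R ?u (branch j x) / of_real (s j) ^ k * of_real (\<phi> x)) \<partial>lebesgue)"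
    by (simp add: preimage_sum_def sum_distrib_right del: indicator_scaleR_eq_if)
  also have "\<dots> = (\<Sum>j<N. \<integral>x. indicator (J j) (branch j x) *\<^sub>R ?u (branch j x) / of_real (s j) ^ k * of_real (\<phi> x) \<partial>lebesgue)"
  proof (rule Bochner_Integration.integral_sum)
    fix j assume "j \<in> {..<N}"
    then have j: "j < N" by simp
    have "integrable (lebesgue_on UNIV) (\<lambda>x. (indicator (J j) (branch j x) *\<^sub>R ?u (branch j x) / of_real (s j) ^ k) * of_real (\<phi> x))"
      by (rule integrable_times_test_function[OF _ \<phi>])
       (use integrable_branch_term[OF integrable_rep_L1 j] in \<open>simp add: lebesgue_on_UNIV_eq del: indicator_scaleR_eq_if\<close>)
    then show "integrable lebesgue (\<lambda>x. indicator (J j) (branch j x) *\<^sub>R ?u (branch j x) / of_real (s j) ^ k * of_real (\<phi> x))"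
      by (simp add: lebesgue_on_UNIV_eq del: indicator_scaleR_eq_if)
  qed
  also have "\<dots> = (\<Sum>j<N. of_real (s j / s j ^ k) * test_pairing (J j) h (\<lambda>y. \<phi> (offset j + s j * y)))"
  proof (rule sum.cong[OF refl])
    fix j assume "j \<in> {..<N}"
    then have j: "j < N" by simp
    let ?F = "\<lambda>y. indicator (J j) y *\<^sub>R ?u y / of_real (s j) ^ k * of_real (\<phi> (offset j + s j * y))"
    have x: "offset j + s j * branch j x = x" for x
      using branch_inverse[OF j, of x "branch j x"] by simp
    have "(\<integral>x. indicator (J j) (branch j x) *\<^sub>R ?u (branch j x) / of_real (s j) ^ k * of_real (\<phi> x) \<partial>lebesgue)
       = (\<integral>x. ?F (branch j x) \<partial>lebesgue)" by (simp add: x del: indicator_scaleR_eq_if)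
    also have "\<dots> = s j *\<^sub>R (\<integral>y. ?F y \<partial>lebesgue)" by (rule branch_change_of_variables(2)[OF j])
    also have "(\<integral>y. ?F y \<partial>lebesgue) = (\<integral>y. (1 / of_real (s j) ^ k) * (indicator (J j) y *\<^sub>R (?u y * of_real (\<phi> (offset j + s j * y)))) \<partial>lebesgue)"
      by (intro Bochner_Integration.integral_cong) (auto simp: indicator_def)
    also have "\<dots> = (1 / of_real (s j) ^ k) * test_pairing (J j) h (\<lambda>y. \<phi> (offset j + s j * y))"
      using j by (subst integral_mult_right_zero)
        (simp add: test_pairing_def integral_lebesgue_on del: indicator_scaleR_eq_if)
    finally show "(\<integral>x. indicator (J j) (branch j x) *\<^sub>R ?u (branch j x) / of_real (s j) ^ k * of_real (\<phi> x) \<partial>lebesgue)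
       = of_real (s j / s j ^ k) * test_pairing (J j) h (\<lambda>y. \<phi> (offset j + s j * y))"
      by (simp add: scaleR_conv_of_real)
  qed
  finally show ?thesis .
qed

text \<open>
The Markov property enters here: if \<open>f\<close> maps \<open>J j\<close> over \<open>J i\<close>, then the preimage of a compact subset
of \<open>J i\<close> is a compact subset of \<open>J j\<close>.
\<close>

lemma test_function_pullback:
  assumes i: "i < N" and j: "j < N" and sub: "J i \<subseteq> f ` J j" and \<phi>: "test_function (J i) \<phi>"
  shows "test_function (J j) (\<lambda>y. \<phi> (offset j + s j * y))"
proof -
  obtain a b where ab: "a < b" "J j = {a<..<b}" using J_interval[OF j] by blast
  obtain p q where pq: "p < q" "J i = {p<..<q}" using J_interval[OF i] by blast
  obtain c d where cd: "p < c" "c < d" "d < q" "\<And>x. x \<notin> {c..d} \<Longrightarrow> \<phi> x = 0"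
    using \<phi> test_function_interval_iff[OF pq(1)] pq(2) by auto
  have mem: "branch j c \<in> J j" "branch j d \<in> J j"
    using cd sub pq branch_mem_iff[OF j] by auto
  have eq: "x = offset j + s j * branch j x" for x using branch_inverse[OF j, of x "branch j x"] by simp
  have mono: "branch j x < branch j y \<longleftrightarrow> x < y" for x y
    using slope_pos[OF j] by (simp add: branch_def divide_less_cancel)
  have "\<phi> (offset j + s j * y) = 0" if "y \<notin> {branch j c..branch j d}" for y
  proof (rule cd(4))
    have "y = branch j (offset j + s j * y)" using branch_inverse[OF j, of "offset j + s j * y" y] by simp
    then show "offset j + s j * y \<notin> {c..d}" using that mono by (metis atLeastAtMost_iff not_le)
  qed
  then show ?thesis
    unfolding ab(2) test_function_interval_iff[OF ab(1)]
    using smooth_affine[OF test_function_smooth[OF \<phi>]] mem mono[of c d] cd(2) ab(2)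
    by (intro conjI exI[of _ "branch j c"] exI[of _ "branch j d"]) auto
qed

text \<open>
The chain rule on the test function: the \<open>l\<close>-th derivative of \<open>\<phi>\<close> composed with a branch of slope
\<open>s j\<close> carries a factor \<open>s j ^ l\<close>, which raises the exponent of the weight from \<open>k\<close> to \<open>k + l\<close>.
\<close>

lemma transfer_has_weak_deriv:
  assumes "has_weak_deriv N J l h g"
  shows "has_weak_deriv N J l (L k h) (L (k + l) g)"
  unfolding has_weak_deriv_iff
proof (intro allI impI)
  fix i \<phi> assume i: "i < N" and \<phi>: "test_function (J i) \<phi>"
  have "of_real (s j / s j ^ k) * test_pairing (J j) h (\<lambda>y. (deriv ^^ l) \<phi> (offset j + s j * y)) =
      (- 1) ^ l * (of_real (s j / s j ^ (k + l)) * test_pairing (J j) g (\<lambda>y. \<phi> (offset j + s j * y)))"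
    if j: "j < N" for j
  proof (cases "J i \<subseteq> f ` J j")
    case True
    let ?\<psi> = "\<lambda>y. \<phi> (offset j + s j * y)"
    have "test_pairing (J j) h ((deriv ^^ l) ?\<psi>) = (- 1) ^ l * test_pairing (J j) g ?\<psi>"
      using assms j test_function_pullback[OF i j True \<phi>] unfolding has_weak_deriv_iff by blast
    moreover have "test_pairing (J j) h ((deriv ^^ l) ?\<psi>) =
        of_real (s j ^ l) * test_pairing (J j) h (\<lambda>y. (deriv ^^ l) \<phi> (offset j + s j * y))"
      unfolding higher_deriv_affine[OF test_function_smooth[OF \<phi>]] test_pairing_def
        integral_mult_right_zero[symmetric]
      by (simp add: mult_ac)
    ultimately have "test_pairing (J j) h (\<lambda>y. (deriv ^^ l) \<phi> (offset j + s j * y)) =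
        (- 1) ^ l * test_pairing (J j) g ?\<psi> / of_real (s j ^ l)"
      using slope_nonzero[OF j] by (simp add: field_simps)
    then show ?thesis by (simp add: power_add)
  next
    case False
    then have "f ` J j \<inter> J i = {}" using markov_property i j by blast
    then have out: "offset j + s j * y \<notin> J i" if "y \<in> J j" for y using f_eq[OF j that] that by force
    have "test_pairing (J j) h' (\<lambda>y. \<psi> (offset j + s j * y)) = 0" if \<psi>: "test_function (J i) \<psi>" for \<psi> h'
    proof -
      have "test_pairing (J j) h' (\<lambda>y. \<psi> (offset j + s j * y)) = (\<integral>x. 0 \<partial>lebesgue_on (J j))"
        unfolding test_pairing_def using out test_function_outside[OF \<psi>]
        by (intro Bochner_Integration.integral_cong) (auto simp: space_restrict_space)
      then show ?thesis by simp
    qed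
    then show ?thesis using \<phi> test_function_higher_deriv[OF \<phi>] by simp
  qed
  then show "test_pairing (J i) (L k h) ((deriv ^^ l) \<phi>) = (- 1) ^ l * test_pairing (J i) (L (k + l) g) \<phi>"
    unfolding transfer_pairing[OF i \<phi>] transfer_pairing[OF i test_function_higher_deriv[OF \<phi>]] sum_distrib_left
    by (intro sum.cong) simp_all
qed

text \<open>
On \<open>J i\<close> an inverse branch takes values in \<open>J j\<close> either everywhere or nowhere, as recorded by the
adjacency matrix.
\<close>

lemma transfer_piecewise_const:
  assumes "\<And>j. j < N \<Longrightarrow> AE x in lebesgue_on (J j). rep_L1 h x = c j" and i: "i < N"
  shows "AE x in lebesgue_on (J i). rep_L1 (L k h) x = (\<Sum>j<N. weighted_adjacency f N J k $$ (i, j) * c j)"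
proof -
  let ?u = "\<lambda>x. \<Sum>j<N. indicator (J j) x *\<^sub>R c j"
  have u: "?u x = c j" if "j < N" "x \<in> J j" for x j
  proof -
    have "?u x = (\<Sum>i\<in>{j}. indicator (J i) x *\<^sub>R c i)"
    proof (rule sum.mono_neutral_right)
      show "\<forall>i\<in>{..<N} - {j}. indicat_real (J i) x *\<^sub>R c i = 0"
      proof
        fix i assume "i \<in> {..<N} - {j}"
        then have "x \<notin> J i" using J_unique[of i j x] that by blast
        then show "indicat_real (J i) x *\<^sub>R c i = 0" by simp
      qed
    qed (use that in auto)
    then show ?thesis using that by simp
  qed
  have "AE x in lebesgue_on (J j). rep_L1 h x = ?u x" if j: "j < N" for j
  proof -
    have "AE x in lebesgue_on (J j). x \<in> J j"
      using AE_space[of "lebesgue_on (J j)"] by (simp add: space_restrict_space)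
    then show ?thesis using assms(1)[OF j] by eventually_elim (simp only: u[OF j])
  qed
  then have "AE x in unit_leb. rep_L1 h x = ?u x" unfolding AE_unit_iff by blast
  then have "AE x in lebesgue_on (J i). rep_L1 (L k h) x = preimage_sum k ?u x"
    using AE_transfer' AE_unit_iff i by blast
  moreover have "AE x in lebesgue_on (J i). x \<in> J i"
    using AE_space[of "lebesgue_on (J i)"] by (simp add: space_restrict_space)
  ultimately show ?thesis
  proof eventually_elim
    case (elim x)
    have "preimage_sum k ?u x = (\<Sum>j<N. weighted_adjacency f N J k $$ (i, j) * c j)"
      unfolding preimage_sum_def
    proof (intro sum.cong refl)
      fix j assume "j \<in> {..<N}"
      then have j: "j < N" by simp
      show "indicat_real (J j) (branch j x) *\<^sub>R ?u (branch j x) / complex_of_real (s j) ^ k =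
          weighted_adjacency f N J k $$ (i, j) * c j"
        using markov_cases[OF i j elim(2)] u[OF j] i j
        by (cases "branch j x \<in> J j") (simp_all add: weighted_adjacency_def adjacency_def del: indicator_scaleR_eq_if)
    qed
    then show ?case using elim(1) by simp
  qed
qed

end


section \<open>The spectrum on piecewise polynomials\<close>

lemma mat_mult_entry:
  assumes "A \<in> carrier_mat n n" "B \<in> carrier_mat n n" "i < n" "j < n"
  shows "(A * B) $$ (i, j) = (\<Sum>q<n. A $$ (i, q) * B $$ (q, j))"
  using assms by (simp add: scalar_prod_def atLeast0LessThan)

lemma order_prod_linear_factors:
  fixes \<xi> :: complex
  shows "Polynomial.order \<xi> (\<Prod>e\<leftarrow>es. [:- e, 1:]) = count_list es \<xi>"
proof (induction es)
  case (Cons e es)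
  have nz: "(\<Prod>e\<leftarrow>es. [:- e, 1:]) \<noteq> (0 :: complex poly)" by (auto simp: prod_list_zero_iff)
  have "Polynomial.order \<xi> [:- e, 1:] = (if e = \<xi> then 1 else 0)"
    using order_power_n_n[of \<xi> 1] by (auto intro: order_0I)
  moreover have "Polynomial.order \<xi> ([:- e, 1:] * (\<Prod>e\<leftarrow>es. [:- e, 1:])) =
      Polynomial.order \<xi> [:- e, 1:] + Polynomial.order \<xi> (\<Prod>e\<leftarrow>es. [:- e, 1:])"
    using nz by (intro order_mult no_zero_divisors) auto
  ultimately show ?case using Cons by simp
qed simp

text \<open>
Schur's decomposition, read as a change of basis: in the columns of \<open>P\<close> the matrix \<open>B\<close> is upper
triangular.
\<close>

lemma triangularize_complex_mat:
  fixes B :: "complex mat"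
  assumes "B \<in> carrier_mat n n"
  obtains es U P Q where "char_poly B = (\<Prod>e\<leftarrow>es. [:- e, 1:])" "es = map (\<lambda>i. U $$ (i, i)) [0..<n]"
    "P \<in> carrier_mat n n" "Q \<in> carrier_mat n n" "U \<in> carrier_mat n n"
    "P * Q = 1\<^sub>m n" "Q * P = 1\<^sub>m n" "B * P = P * U"
    "\<forall>i<n. \<forall>j<i. U $$ (i, j) = 0"
proof -
  obtain es where es: "char_poly B = (\<Prod>e\<leftarrow>es. [:- e, 1:])"
    using char_poly_factorized[OF assms] by blast
  obtain U P Q where sd: "schur_decomposition B es = (U, P, Q)" by (cases "schur_decomposition B es") auto
  from schur_decomposition[OF assms es sd]
  have wit: "similar_mat_wit B U P Q" and ut: "upper_triangular U" and diag: "diag_mat U = es" by auto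
  note w = similar_mat_witD2[OF assms wit]
  have "B * P = P * U * Q * P" using w(3) by simp
  also have "\<dots> = P * U * (Q * P)" using w by (intro assoc_mult_mat[of _ n n _ n _ n]) auto
  also have "\<dots> = P * U" using w by (simp add: right_mult_one_mat[of _ n n])
  finally have "B * P = P * U" .
  moreover have "es = map (\<lambda>i. U $$ (i, i)) [0..<n]" using diag w(5) by (simp add: diag_mat_def)
  moreover have "\<forall>i<n. \<forall>j<i. U $$ (i, j) = 0"
    using ut w(5) by (auto simp: upper_triangular_def)
  ultimately show ?thesis using that es w by blast
qed

context interval_partition
begin

definition step_fun :: "(nat \<Rightarrow> complex) \<Rightarrow> L1" where
  "step_fun c = (SOME h. \<forall>j<N. AE x in lebesgue_on (J j). rep_L1 h x = c j)"

lemma AE_step_fun: "j < N \<Longrightarrow> AE x in lebesgue_on (J j). rep_L1 (step_fun c) x = c j"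
proof -
  have "\<exists>h. \<forall>j<N. AE x in lebesgue_on (J j). rep_L1 h x = c j"
    by (rule glue_integrable) (rule finite_measure.integrable_const[OF finite_measure_J])
  from someI_ex[OF this] show "j < N \<Longrightarrow> AE x in lebesgue_on (J j). rep_L1 (step_fun c) x = c j"
    unfolding step_fun_def by blast
qed

lemma step_funI: "(\<And>j. j < N \<Longrightarrow> AE x in lebesgue_on (J j). rep_L1 h x = c j) \<Longrightarrow> h = step_fun c"
  unfolding L1_eq_iff
proof (intro allI impI)
  fix j assume "j < N" "\<And>j. j < N \<Longrightarrow> AE x in lebesgue_on (J j). rep_L1 h x = c j"
  then have "AE x in lebesgue_on (J j). rep_L1 h x = c j" "AE x in lebesgue_on (J j). rep_L1 (step_fun c) x = c j"
    using AE_step_fun by blast+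
  then show "AE x in lebesgue_on (J j). rep_L1 h x = rep_L1 (step_fun c) x" by eventually_elim simp
qed

lemma step_fun_inject:
  assumes "step_fun c = step_fun d" "j < N" shows "c j = d j"
proof -
  have "AE x in lebesgue_on (J j). c j = d j"
    using AE_step_fun[OF assms(2), of c] AE_step_fun[OF assms(2), of d] unfolding assms(1)
    by eventually_elim simp
  then have "(\<integral>x. c j \<partial>lebesgue_on (J j)) = (\<integral>x. d j \<partial>lebesgue_on (J j))"
    by (intro integral_cong_AE) auto
  then show ?thesis using measure_J[OF assms(2)] by (simp add: measure_space_J[OF assms(2)])
qed

lemma step_fun_cong: "(\<And>j. j < N \<Longrightarrow> c j = d j) \<Longrightarrow> step_fun c = step_fun d"
  using AE_step_fun[of _ c] by (intro step_funI) auto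

lemma step_fun_combine: "scale_L1 a (step_fun c) + step_fun d = step_fun (\<lambda>j. a * c j + d j)"
proof (rule step_funI)
  fix j assume j: "j < N"
  have "AE x in lebesgue_on (J j). rep_L1 (scale_L1 a (step_fun c) + step_fun d) x =
      rep_L1 (scale_L1 a (step_fun c)) x + rep_L1 (step_fun d) x"
    "AE x in lebesgue_on (J j). rep_L1 (scale_L1 a (step_fun c)) x = a * rep_L1 (step_fun c) x"
    using AE_rep_plus AE_rep_scale AE_unit_iff j by blast+
  then show "AE x in lebesgue_on (J j). rep_L1 (scale_L1 a (step_fun c) + step_fun d) x = a * c j + d j"
    using AE_step_fun[OF j, of c] AE_step_fun[OF j, of d] by eventually_elim simp
qed

lemma step_fun_zero: "step_fun (\<lambda>_. 0) = 0"
  using AE_rep_zero by (intro step_funI[symmetric]) (auto simp: AE_unit_iff)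

lemma step_fun_sum:
  fixes n :: nat
  shows "step_fun (\<lambda>j. \<Sum>t<n. a t * c t j) = (\<Sum>t<n. scale_L1 (a t) (step_fun (c t)))"
proof (induction n)
  case (Suc n)
  have "step_fun (\<lambda>j. \<Sum>t<Suc n. a t * c t j) = step_fun (\<lambda>j. a n * c n j + (\<Sum>t<n. a t * c t j))"
    by (simp add: add.commute)
  also have "\<dots> = scale_L1 (a n) (step_fun (c n)) + step_fun (\<lambda>j. \<Sum>t<n. a t * c t j)"
    by (rule step_fun_combine[symmetric])
  finally show ?case by (simp add: Suc add.commute)
qed (simp add: step_fun_zero)

lemma piecewise_poly_0_eq: "piecewise_poly N J 0 = range step_fun"
proof (intro equalityI subsetI)
  fix h assume "h \<in> piecewise_poly N J 0"
  then have "\<forall>j. \<exists>c. j < N \<longrightarrow> (AE x in lebesgue_on (J j). rep_L1 h x = c)"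
    unfolding piecewise_poly_0_iff by blast
  from choice[OF this] obtain c where "\<forall>j. j < N \<longrightarrow> (AE x in lebesgue_on (J j). rep_L1 h x = c j)" ..
  then have "h = step_fun c" by (intro step_funI) blast
  then show "h \<in> range step_fun" by simp
next
  fix h assume "h \<in> range step_fun"
  then show "h \<in> piecewise_poly N J 0" using AE_step_fun unfolding piecewise_poly_0_iff by blast
qed

end

context markov_map
begin

lemma weighted_adjacency_carrier: "weighted_adjacency f N J k \<in> carrier_mat N N"
  by (simp add: weighted_adjacency_def)

lemma transfer_step_fun:
  "L k (step_fun c) = step_fun (\<lambda>i. \<Sum>j<N. weighted_adjacency f N J k $$ (i, j) * c j)"
  by (intro step_funI transfer_piecewise_const AE_step_fun)

lemma transfer_piecewise_poly_0: "h \<in> piecewise_poly N J 0 \<Longrightarrow> L k h \<in> piecewise_poly N J 0"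
  unfolding piecewise_poly_0_eq using transfer_step_fun by auto

text \<open>
The steps of the flag are spanned by the step functions whose values are the first columns of \<open>P\<close>.
\<close>

lemma triangular_flag_piecewise_const:
  "\<exists>ds. L1.triangular_flag (L k) ds (piecewise_poly N J 0) \<and>
     (\<forall>\<xi>. count_list ds \<xi> = Polynomial.order \<xi> (char_poly (weighted_adjacency f N J k)))"
proof -
  let ?B = "weighted_adjacency f N J k"
  obtain es U P Q where es: "char_poly ?B = (\<Prod>e\<leftarrow>es. [:- e, 1:])" "es = map (\<lambda>i. U $$ (i, i)) [0..<N]"
    and carr: "P \<in> carrier_mat N N" "Q \<in> carrier_mat N N" "U \<in> carrier_mat N N"
    and PQ: "P * Q = 1\<^sub>m N" "Q * P = 1\<^sub>m N" and BP: "?B * P = P * U"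
    and ut: "\<forall>i<N. \<forall>j<i. U $$ (i, j) = 0"
    by (rule triangularize_complex_mat[OF weighted_adjacency_carrier[of k]])
  define w where "w t = step_fun (\<lambda>j. P $$ (j, t))" for t
  define V where "V n = {\<Sum>t<n. scale_L1 (a t) (w t) | a :: nat \<Rightarrow> complex. True}" for n
  have comb: "(\<Sum>t<n. scale_L1 (a t) (w t)) = step_fun (\<lambda>j. \<Sum>t<n. a t * P $$ (j, t))" for a n
    unfolding w_def by (rule step_fun_sum[symmetric])
  have Lw: "L k (w t) = (\<Sum>q<Suc t. scale_L1 (U $$ (q, t)) (w q))" if t: "t < N" for t
  proof -
    have "L k (w t) = step_fun (\<lambda>i. \<Sum>j<N. ?B $$ (i, j) * P $$ (j, t))"
      unfolding w_def by (rule transfer_step_fun)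
    also have "\<dots> = step_fun (\<lambda>i. \<Sum>q<Suc t. U $$ (q, t) * P $$ (i, q))"
    proof (rule step_fun_cong)
      fix i assume i: "i < N"
      have "(\<Sum>j<N. ?B $$ (i, j) * P $$ (j, t)) = (?B * P) $$ (i, t)"
        by (rule mat_mult_entry[OF weighted_adjacency_carrier carr(1) i t, symmetric])
      also have "\<dots> = (\<Sum>q<N. P $$ (i, q) * U $$ (q, t))"
        unfolding BP by (rule mat_mult_entry[OF carr(1,3) i t])
      also have "\<dots> = (\<Sum>q<Suc t. P $$ (i, q) * U $$ (q, t))"
        using t ut by (intro sum.mono_neutral_right) auto
      finally show "(\<Sum>j<N. ?B $$ (i, j) * P $$ (j, t)) = (\<Sum>q<Suc t. U $$ (q, t) * P $$ (i, q))"
        by (simp add: mult.commute)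
    qed
    finally show ?thesis unfolding comb .
  qed
  have "L1.triangular_flag (L k) (rev (map (\<lambda>i. U $$ (i, i)) [0..<n])) (V n)" if "n \<le> N" for n
    using that
  proof (induction n)
    case 0
    have "V 0 = {0}" by (auto simp: V_def)
    then show ?case using L1.flag_Nil by simp
  next
    case (Suc n)
    then have n: "n < N" by simp
    have "w n \<notin> V n"
    proof
      assume "w n \<in> V n"
      then obtain a where "w n = (\<Sum>t<n. scale_L1 (a t) (w t))" by (auto simp: V_def)
      then have "step_fun (\<lambda>j. P $$ (j, n)) = step_fun (\<lambda>j. \<Sum>t<n. a t * P $$ (j, t))"
        by (simp add: comb[symmetric]) (simp add: w_def)
      then have P: "P $$ (j, n) = (\<Sum>t<n. a t * P $$ (j, t))" if "j < N" for j
        using step_fun_inject that by blast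
      \<comment> \<open>Column \<open>n\<close> of \<open>P\<close> is no combination of the preceding ones, as \<open>Q\<close> shows.\<close>
      have "1 = (Q * P) $$ (n, n)" using PQ(2) n by simp
      also have "\<dots> = (\<Sum>j<N. Q $$ (n, j) * P $$ (j, n))" by (rule mat_mult_entry[OF carr(2,1) n n])
      also have "\<dots> = (\<Sum>j<N. \<Sum>t<n. a t * (Q $$ (n, j) * P $$ (j, t)))"
        using P by (intro sum.cong) (auto simp: sum_distrib_left mult.left_commute)
      also have "\<dots> = (\<Sum>t<n. a t * (\<Sum>j<N. Q $$ (n, j) * P $$ (j, t)))"
        by (subst sum.swap) (simp add: sum_distrib_left)
      also have "\<dots> = (\<Sum>t<n. a t * (Q * P) $$ (n, t))"
        using n by (intro sum.cong refl) (simp add: mat_mult_entry[OF carr(2,1) n] del: index_mult_mat)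
      also have "\<dots> = 0" using PQ(2) n by (intro sum.neutral) auto
      finally show False by simp
    qed
    moreover have "L k (w n) - scale_L1 (U $$ (n, n)) (w n) \<in> V n"
      using Lw[OF n] by (auto simp: V_def)
    ultimately have "L1.triangular_flag (L k) (U $$ (n, n) # rev (map (\<lambda>i. U $$ (i, i)) [0..<n]))
        {scale_L1 c (w n) + x | c x. x \<in> V n}"
      using Suc n by (intro L1.flag_Cons) auto
    moreover have "{scale_L1 c (w n) + x | c x. x \<in> V n} = V (Suc n)"
    proof (intro equalityI subsetI)
      fix h assume "h \<in> {scale_L1 c (w n) + x | c x. x \<in> V n}"
      then obtain c a where "h = scale_L1 c (w n) + (\<Sum>t<n. scale_L1 (a t) (w t))" by (auto simp: V_def)
      then have "h = (\<Sum>t<Suc n. scale_L1 ((a(n := c)) t) (w t))" by (simp add: add.commute)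
      then show "h \<in> V (Suc n)" unfolding V_def by blast
    next
      fix h assume "h \<in> V (Suc n)"
      then obtain a where "h = scale_L1 (a n) (w n) + (\<Sum>t<n. scale_L1 (a t) (w t))"
        by (auto simp: V_def add.commute)
      then show "h \<in> {scale_L1 c (w n) + x | c x. x \<in> V n}" unfolding V_def by blast
    qed
    ultimately show ?case by simp
  qed
  then have "L1.triangular_flag (L k) (rev es) (V N)" unfolding es(2) by blast
  moreover have "V N = piecewise_poly N J 0"
  proof (intro equalityI subsetI)
    fix h assume "h \<in> V N"
    then show "h \<in> piecewise_poly N J 0" unfolding piecewise_poly_0_eq V_def comb by auto
  next
    fix h assume "h \<in> piecewise_poly N J 0"
    then obtain c where c: "h = step_fun c" unfolding piecewise_poly_0_eq by blast
    define a where "a t = (\<Sum>q<N. Q $$ (t, q) * c q)" for t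
    have "step_fun c = step_fun (\<lambda>j. \<Sum>t<N. a t * P $$ (j, t))"
    proof (rule step_fun_cong)
      fix j assume j: "j < N"
      have "(\<Sum>t<N. a t * P $$ (j, t)) = (\<Sum>t<N. \<Sum>q<N. c q * (P $$ (j, t) * Q $$ (t, q)))"
        unfolding a_def sum_distrib_right by (intro sum.cong refl) (simp add: mult_ac)
      also have "\<dots> = (\<Sum>q<N. c q * (\<Sum>t<N. P $$ (j, t) * Q $$ (t, q)))"
        by (subst sum.swap) (simp add: sum_distrib_left)
      also have "\<dots> = (\<Sum>q<N. c q * (P * Q) $$ (j, q))"
        by (intro sum.cong refl) (simp add: mat_mult_entry[OF carr(1,2) j] del: index_mult_mat)
      also have "\<dots> = (\<Sum>q<N. if q = j then c q else 0)"
        using PQ(1) j by (intro sum.cong) auto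
      also have "\<dots> = c j" using j by simp
      finally show "c j = (\<Sum>t<N. a t * P $$ (j, t))" by simp
    qed
    then show "h \<in> V N" unfolding c comb[symmetric] V_def by blast
  qed
  moreover have "count_list (rev es) \<xi> = Polynomial.order \<xi> (char_poly ?B)" for \<xi>
    unfolding es(1) order_prod_linear_factors by (rule count_list_rev)
  ultimately show ?thesis by auto
qed

lemma transfer_piecewise_poly: "h \<in> piecewise_poly N J r \<Longrightarrow> L k h \<in> piecewise_poly N J r"
proof (induction r arbitrary: h k)
  case 0
  then show ?case by (rule transfer_piecewise_poly_0)
next
  case (Suc r)
  then obtain g where g: "g \<in> piecewise_poly N J r" "has_weak_deriv N J 1 h g"
    using piecewise_poly_Suc_iff by blast
  then show ?case using Suc.IH transfer_has_weak_deriv[OF g(2)] piecewise_poly_Suc_iff by blast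
qed

lemma subspace_piecewise_poly: "L1.subspace (piecewise_poly N J r)"
proof (induction r)
  case 0
  obtain ds where "L1.triangular_flag (L 0) ds (piecewise_poly N J 0)"
    using triangular_flag_piecewise_const by blast
  then show ?case by (rule L1.triangular_flag_subspace)
next
  case (Suc r)
  show ?case
  proof (rule L1.subspaceI)
    have "has_weak_deriv N J 1 0 0"
      using has_weak_deriv_scale[OF has_weak_deriv_primitive[of 0], of 0] by simp
    then show "0 \<in> piecewise_poly N J (Suc r)"
      using piecewise_poly_Suc_iff L1.subspace_0[OF Suc] by blast
  next
    fix x y assume "x \<in> piecewise_poly N J (Suc r)" "y \<in> piecewise_poly N J (Suc r)"
    then show "x + y \<in> piecewise_poly N J (Suc r)"
      using has_weak_deriv_add L1.subspace_add[OF Suc] unfolding piecewise_poly_Suc_iff by blast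
  next
    fix c x assume "x \<in> piecewise_poly N J (Suc r)"
    then show "scale_L1 c x \<in> piecewise_poly N J (Suc r)"
      using has_weak_deriv_scale L1.subspace_scale[OF Suc] unfolding piecewise_poly_Suc_iff by blast
  qed
qed

text \<open>
The weak derivative intertwines \<open>L k\<close> on degree at most \<open>r + 1\<close> with \<open>L (k + 1)\<close> on degree at most \<open>r\<close>
and has the piecewise constants as its kernel, which contribute the diagonal of the matrix for \<open>k\<close>.
\<close>

lemma triangular_flag_piecewise_poly:
  "\<exists>ds. L1.triangular_flag (L k) ds (piecewise_poly N J r) \<and>
     (\<forall>\<xi>. count_list ds \<xi> = (\<Sum>l\<le>r. Polynomial.order \<xi> (char_poly (weighted_adjacency f N J (k + l)))))"
proof (induction r arbitrary: k)
  case 0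
  then show ?case using triangular_flag_piecewise_const[of k] by simp
next
  case (Suc r)
  let ?V = "piecewise_poly N J (Suc r)" and ?D = "weak_deriv N J 1"
  obtain es where es: "L1.triangular_flag (L (k + 1)) es (piecewise_poly N J r)"
    "\<And>\<xi>. count_list es \<xi> = (\<Sum>l\<le>r. Polynomial.order \<xi> (char_poly (weighted_adjacency f N J (k + 1 + l))))"
    using Suc.IH[of "k + 1"] by blast
  obtain ds where ds: "L1.triangular_flag (L k) ds (piecewise_poly N J 0)"
    "\<And>\<xi>. count_list ds \<xi> = Polynomial.order \<xi> (char_poly (weighted_adjacency f N J k))"
    using triangular_flag_piecewise_const[of k] by blast
  have D: "has_weak_deriv N J 1 h (?D h)" and Dmem: "?D h \<in> piecewise_poly N J r" if "h \<in> ?V" for h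
    using that weak_deriv_eq unfolding piecewise_poly_Suc_iff by auto
  have sub: "piecewise_poly N J 0 \<subseteq> ?V"
  proof
    fix h assume "h \<in> piecewise_poly N J 0"
    then obtain p :: "nat \<Rightarrow> complex poly" where "\<forall>j<N. Polynomial.degree (p j) \<le> 0 \<and>
        (AE x in lebesgue_on (J j). rep_L1 h x = poly (p j) (of_real x))"
      by (auto simp only: piecewise_poly_iff_family)
    then show "h \<in> ?V" unfolding piecewise_poly_iff_family by (intro exI[of _ p]) auto
  qed
  have "{h \<in> ?V. ?D h = 0} = piecewise_poly N J 0"
  proof (intro equalityI subsetI)
    fix h assume "h \<in> {h \<in> ?V. ?D h = 0}"
    then show "h \<in> piecewise_poly N J 0" using D[of h] has_weak_deriv_zero_imp_const by simp
  next
    fix h assume h: "h \<in> piecewise_poly N J 0"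
    then obtain c where c: "\<And>j. j < N \<Longrightarrow> AE x in lebesgue_on (J j). rep_L1 h x = c j"
      unfolding piecewise_poly_0_eq using AE_step_fun by blast
    have "has_weak_deriv N J 1 h 0"
      by (rule has_weak_deriv_poly[where p = "\<lambda>j. [:c j:]"])
        (use c AE_rep_zero in \<open>auto simp: pderiv_pCons AE_unit_iff\<close>)
    then show "h \<in> {h \<in> ?V. ?D h = 0}" using h sub weak_deriv_eq by auto
  qed
  then have K: "L1.triangular_flag (L k) ds {h \<in> ?V. ?D h = 0}" using ds(1) by simp
  have "L1.triangular_flag (L k) (es @ ds) {h \<in> ?V. ?D h \<in> piecewise_poly N J r}"
  proof (rule L1.triangular_flag_lift[OF es(1) K subspace_piecewise_poly])
    show "piecewise_poly N J r \<subseteq> ?D ` ?V"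
    proof
      fix g assume "g \<in> piecewise_poly N J r"
      then have "primitive g \<in> ?V" using has_weak_deriv_primitive piecewise_poly_Suc_iff by blast
      then show "g \<in> ?D ` ?V" using weak_deriv_eq[OF has_weak_deriv_primitive[of g]] by (metis imageI)
    qed
    show "?D (x + y) = ?D x + ?D y" if "x \<in> ?V" "y \<in> ?V" for x y
      by (rule weak_deriv_eq[OF has_weak_deriv_add[OF D[OF that(1)] D[OF that(2)]]])
    show "?D (scale_L1 c x) = scale_L1 c (?D x)" if "x \<in> ?V" for c x
      by (rule weak_deriv_eq[OF has_weak_deriv_scale[OF D[OF that]]])
    show "L k x \<in> ?V \<and> ?D (L k x) = L (k + 1) (?D x)" if "x \<in> ?V" for x
      using transfer_piecewise_poly[OF that] weak_deriv_eq[OF transfer_has_weak_deriv[OF D[OF that]]] by blast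
  qed
  moreover have "{h \<in> ?V. ?D h \<in> piecewise_poly N J r} = ?V" using Dmem by blast
  moreover have "count_list (es @ ds) \<xi> =
      (\<Sum>l\<le>Suc r. Polynomial.order \<xi> (char_poly (weighted_adjacency f N J (k + l))))" for \<xi>
    using es(2) ds(2) by (subst sum.atMost_Suc_shift) simp
  ultimately show ?case by auto
qed

end


section \<open>Projector and spectral radius\<close>

context markov_map
begin

text \<open>
The complementary projection \<open>E (1 - Q) D\<^sup>r\<close>: it discards exactly the piecewise polynomials, namely
the functions whose \<open>r\<close>-th derivative is piecewise constant.
\<close>

definition oscillation :: "nat \<Rightarrow> L1 \<Rightarrow> L1" where
  "oscillation r h =
     (primitive ^^ r) (weak_deriv N J r h - piece_mean (weak_deriv N J r h))"

lemma N_pos: "N > 0"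
proof (rule ccontr)
  assume "\<not> N > 0"
  then have "negligible {0..1::real}" using J_cover by simp
  then show False using negligible_interval(1)[of "0::real" 1] by simp
qed

lemma min_slope_le: "j < N \<Longrightarrow> min_slope f N J \<le> s j" and min_slope_gt_1: "min_slope f N J > 1"
proof -
  have fin: "finite (s ` {..<N})" "s ` {..<N} \<noteq> {}" using N_pos by auto
  show "j < N \<Longrightarrow> min_slope f N J \<le> s j" unfolding min_slope_def using fin by (intro Min_le) auto
  show "min_slope f N J > 1" unfolding min_slope_def using fin slope_gt_1 by (subst Min_gr_iff) auto
qed

lemma norm_transfer_Suc_le: "norm (L (Suc m) h) \<le> inverse (min_slope f N J) ^ m * norm h"
proof (rule norm_transfer_le)
  fix j assume j: "j < N"
  have "min_slope f N J ^ m \<le> s j ^ m"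
    using min_slope_le[OF j] min_slope_gt_1 by (intro power_mono) auto
  then show "s j / s j ^ Suc m \<le> inverse (min_slope f N J) ^ m"
    using slope_pos[OF j] min_slope_gt_1 by (simp add: field_simps)
qed

lemma transfer_bounded: "\<exists>C\<ge>0. \<forall>h. norm (L k h) \<le> C * norm h"
proof (intro exI conjI allI)
  have pos: "0 \<le> s j / s j ^ k" if "j < N" for j using slope_pos[OF that] by simp
  then show "0 \<le> (\<Sum>j<N. s j / s j ^ k)" by (intro sum_nonneg) auto
  show "norm (L k h) \<le> (\<Sum>j<N. s j / s j ^ k) * norm h" for h
    by (rule norm_transfer_le, rule member_le_sum) (use pos in auto)
qed

lemma bounded_op_on_transfer: "bounded_op_on (sobolev N J r) (sobolev_norm N J r) (L k)"
proof -
  have "\<forall>l. \<exists>C. C \<ge> 0 \<and> (\<forall>h. norm (L (k + l) h) \<le> C * norm h)" using transfer_bounded by blast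
  from choice[OF this] obtain C where C: "\<And>l. C l \<ge> 0" "\<And>l h. norm (L (k + l) h) \<le> C l * norm h" by blast
  have D: "has_weak_deriv N J l (L k h) (L (k + l) (weak_deriv N J l h))" if "h \<in> sobolev N J r" "l \<le> r" for h l
    by (rule transfer_has_weak_deriv[OF sobolev_has_weak_deriv[OF that]])
  show ?thesis
  proof (rule bounded_op_onI)
    show "L1.linear_op_on (sobolev N J r) (L k)"
      unfolding L1.linear_op_on_def using D transfer_add transfer_scale by (auto simp: sobolev_def)
    fix h assume h: "h \<in> sobolev N J r"
    have "sobolev_norm N J r (L k h) = (\<Sum>l\<le>r. norm (L (k + l) (weak_deriv N J l h)))"
      unfolding sobolev_norm_eq using weak_deriv_eq[OF D[OF h]] by (intro sum.cong) auto
    also have "\<dots> \<le> (\<Sum>l\<le>r. (\<Sum>l\<le>r. C l) * norm (weak_deriv N J l h))"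
    proof (rule sum_mono)
      fix l assume "l \<in> {..r}"
      then have "C l \<le> (\<Sum>l\<le>r. C l)" using C(1) by (intro member_le_sum) auto
      then show "norm (L (k + l) (weak_deriv N J l h)) \<le> (\<Sum>l\<le>r. C l) * norm (weak_deriv N J l h)"
        using order_trans[OF C(2)] mult_right_mono norm_ge_zero by metis
    qed
    finally show "sobolev_norm N J r (L k h) \<le> (\<Sum>l\<le>r. C l) * sobolev_norm N J r h"
      by (simp add: sobolev_norm_eq sum_distrib_left)
  qed
qed

lemma weak_deriv_add_sobolev:
  "h \<in> sobolev N J r \<Longrightarrow> h' \<in> sobolev N J r \<Longrightarrow> weak_deriv N J r (h + h') = weak_deriv N J r h + weak_deriv N J r h'"
  by (rule weak_deriv_eq[OF has_weak_deriv_add[OF sobolev_has_weak_deriv sobolev_has_weak_deriv]]) auto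

lemma weak_deriv_scale_sobolev:
  "h \<in> sobolev N J r \<Longrightarrow> weak_deriv N J r (scale_L1 c h) = scale_L1 c (weak_deriv N J r h)"
  by (rule weak_deriv_eq[OF has_weak_deriv_scale[OF sobolev_has_weak_deriv]]) auto

lemma weak_deriv_diff_sobolev:
  "h \<in> sobolev N J r \<Longrightarrow> h' \<in> sobolev N J r \<Longrightarrow> weak_deriv N J r (h - h') = weak_deriv N J r h - weak_deriv N J r h'"
  by (rule weak_deriv_eq[OF has_weak_deriv_diff[OF sobolev_has_weak_deriv sobolev_has_weak_deriv]]) auto

lemma norm_weak_deriv_le: "norm (weak_deriv N J r h) \<le> sobolev_norm N J r h"
  unfolding sobolev_norm_eq by (rule member_le_sum) auto

lemma piece_mean_diff: "piece_mean (u - v) = piece_mean u - piece_mean v"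
  using piece_mean_add[of "u - v" v] by simp

lemma piece_mean_twice: "piece_mean (piece_mean u) = piece_mean u"
  by (rule piece_mean_idem[OF piece_mean_const])

lemma transfer_diff: "L k (u - v) = L k u - L k v"
  using transfer_add[of k "u - v" v] by simp

lemma piece_mean_transfer_piece_mean: "piece_mean (L k (piece_mean u)) = L k (piece_mean u)"
  by (intro piece_mean_idem transfer_piecewise_poly_0 piece_mean_const)

lemma primitive_power_zero: "(primitive ^^ r) 0 = 0"
  using primitive_power_scale[of r 0 0] by simp

lemma oscillation_sobolev: "oscillation r h \<in> sobolev N J r"
  unfolding oscillation_def by (rule primitive_power_sobolev)

lemma weak_deriv_oscillation:
  "weak_deriv N J r (oscillation r h) = weak_deriv N J r h - piece_mean (weak_deriv N J r h)"
  unfolding oscillation_def by (rule weak_deriv_primitive_power)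

lemma linear_oscillation: "L1.linear_op_on (sobolev N J r) (oscillation r)"
  unfolding L1.linear_op_on_def
proof (intro conjI ballI allI)
  show "oscillation r h \<in> sobolev N J r" for h by (rule oscillation_sobolev)
  fix h h' assume h: "h \<in> sobolev N J r" "h' \<in> sobolev N J r"
  have "(a + b) - (c + d) = (a - c) + (b - d)" for a b c d :: L1 by simp
  then show "oscillation r (h + h') = oscillation r h + oscillation r h'"
    unfolding oscillation_def weak_deriv_add_sobolev[OF h] piece_mean_add
    by (simp only: primitive_power_add)
next
  fix c h assume h: "h \<in> sobolev N J r"
  show "oscillation r (scale_L1 c h) = scale_L1 c (oscillation r h)"
    unfolding oscillation_def weak_deriv_scale_sobolev[OF h] piece_mean_scale
    by (simp only: primitive_power_scale L1.scale_right_diff_distrib[symmetric])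
qed

lemma sobolev_norm_lift_le:
  "sobolev_norm N J r ((primitive ^^ r) (u - piece_mean u)) \<le> real (Suc r) * (2 * norm u)"
proof -
  have "norm (u - piece_mean u) \<le> 2 * norm u"
    using norm_triangle_ineq4[of u "piece_mean u"] norm_piece_mean_le[of u] by simp
  then show ?thesis
    using sobolev_norm_primitive_power[of r "u - piece_mean u"]
      mult_left_mono[of "norm (u - piece_mean u)" "2 * norm u" "real (Suc r)"] by linarith
qed

lemma bounded_op_on_oscillation: "bounded_op_on (sobolev N J r) (sobolev_norm N J r) (oscillation r)"
proof (rule bounded_op_onI[OF linear_oscillation])
  fix h
  have "sobolev_norm N J r (oscillation r h) \<le> real (Suc r) * (2 * norm (weak_deriv N J r h))"
    unfolding oscillation_def by (rule sobolev_norm_lift_le)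
  also have "\<dots> \<le> real (Suc r) * (2 * sobolev_norm N J r h)"
    using norm_weak_deriv_le by (intro mult_left_mono) auto
  finally show "sobolev_norm N J r (oscillation r h) \<le> real (Suc r) * 2 * sobolev_norm N J r h"
    by (simp only: mult.assoc)
qed

lemma oscillation_idem: "oscillation r (oscillation r h) = oscillation r h"
proof -
  have "oscillation r (oscillation r h) = (primitive ^^ r) (weak_deriv N J r (oscillation r h)
      - piece_mean (weak_deriv N J r (oscillation r h)))" by (simp add: oscillation_def)
  also have "\<dots> = oscillation r h"
    unfolding weak_deriv_oscillation piece_mean_diff piece_mean_twice by (simp add: oscillation_def)
  finally show ?thesis .
qed

lemma oscillation_piecewise_poly: "h \<in> piecewise_poly N J r \<Longrightarrow> oscillation r h = 0"
proof -
  assume "h \<in> piecewise_poly N J r"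
  then obtain g where "g \<in> piecewise_poly N J 0" "has_weak_deriv N J r h g" using piecewise_poly_iff by blast
  then have "piece_mean (weak_deriv N J r h) = weak_deriv N J r h" using weak_deriv_eq piece_mean_idem by simp
  then show ?thesis by (simp add: oscillation_def primitive_power_zero)
qed

lemma projector_piecewise_poly:
  "projector_onto (sobolev N J r) (sobolev_norm N J r) (piecewise_poly N J r) (\<lambda>h. h - oscillation r h)"
proof -
  let ?V = "sobolev N J r"
  note V = subspace_sobolev[of r]
  have mem: "h - oscillation r h \<in> ?V" if "h \<in> ?V" for h
    using L1.subspace_diff[OF V that oscillation_sobolev] .
  have "bounded_op_on ?V (sobolev_norm N J r) (\<lambda>h. scale_L1 1 h + scale_L1 (-1) (oscillation r h))"
    by (intro bounded_op_on_combine bounded_op_on_id bounded_op_on_oscillation seminorm_on_sobolev V)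
  then have "bounded_op_on ?V (sobolev_norm N J r) (\<lambda>h. h - oscillation r h)" by simp
  moreover have "(h - oscillation r h) - oscillation r (h - oscillation r h) = h - oscillation r h" if "h \<in> ?V" for h
    using L1.linear_op_on_diff[OF linear_oscillation V that oscillation_sobolev] by (simp add: oscillation_idem)
  moreover have "(\<lambda>h. h - oscillation r h) ` ?V = piecewise_poly N J r"
  proof (intro equalityI subsetI)
    fix g assume "g \<in> (\<lambda>h. h - oscillation r h) ` ?V"
    then obtain h where h: "h \<in> ?V" "g = h - oscillation r h" by blast
    have "weak_deriv N J r g = piece_mean (weak_deriv N J r h)"
      unfolding h(2) weak_deriv_diff_sobolev[OF h(1) oscillation_sobolev] weak_deriv_oscillation by simp
    then have "has_weak_deriv N J r g (piece_mean (weak_deriv N J r h))"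
      using sobolev_has_weak_deriv[of g r r] mem[OF h(1)] h(2) by simp
    then show "g \<in> piecewise_poly N J r"
      using piecewise_poly_iff[of g r] mem[OF h(1)] h(2) piece_mean_const by blast
  next
    fix g assume g: "g \<in> piecewise_poly N J r"
    then have "g \<in> ?V" using piecewise_poly_iff by blast
    then show "g \<in> (\<lambda>h. h - oscillation r h) ` ?V"
      by (rule image_eqI[rotated]) (simp add: oscillation_piecewise_poly[OF g])
  qed
  ultimately show ?thesis unfolding projector_onto_def by blast
qed

lemma transfer_power_piece_mean: "piece_mean ((L m ^^ n) (piece_mean u)) = (L m ^^ n) (piece_mean u)"
proof -
  have "(L m ^^ n) (piece_mean u) \<in> piecewise_poly N J 0"
    by (induction n) (auto intro: piece_mean_const transfer_piecewise_poly_0)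
  then show ?thesis by (rule piece_mean_idem)
qed

lemma transfer_power_diff: "(L m ^^ n) (u - v) = (L m ^^ n) u - (L m ^^ n) v"
  by (induction n) (simp_all add: transfer_diff)

lemma transfer_power_scale: "(L m ^^ n) (scale_L1 c u) = scale_L1 c ((L m ^^ n) u)"
  by (induction n) (simp_all add: transfer_scale)

lemma norm_transfer_power_le:
  assumes "\<And>u. norm (L m u) \<le> \<rho> * norm u" "0 \<le> \<rho>"
  shows "norm ((L m ^^ n) u) \<le> \<rho> ^ n * norm u"
proof (induction n)
  case (Suc n)
  have "norm ((L m ^^ Suc n) u) \<le> \<rho> * norm ((L m ^^ n) u)" using assms(1) by simp
  also have "\<dots> \<le> \<rho> * (\<rho> ^ n * norm u)" by (intro mult_left_mono Suc assms(2))
  finally show ?case by (simp add: mult.assoc)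
qed simp

text \<open>
The piecewise constants are invariant, hence \<open>(1 - Q) M Q = 0\<close> and the powers of \<open>(1 - Q) M\<close> are
\<open>(1 - Q) M\<^sup>n\<close>. So an eigenvalue satisfies \<open>|\<xi>|\<^sup>n \<le> 2 \<rho>\<^sup>n\<close> for all \<open>n\<close>, although the norm of \<open>(1 - Q) M\<close>
may exceed \<open>\<rho>\<close>.
\<close>

lemma no_large_eigenvalue_mod_constants:
  assumes M: "\<And>u. norm (L m u) \<le> \<rho> * norm u" "0 < \<rho>" "\<rho> < cmod \<xi>"
    and z: "scale_L1 \<xi> z = L m z - piece_mean (L m z)"
  shows "z = 0"
proof (rule ccontr)
  assume "z \<noteq> 0"
  have pow: "scale_L1 (\<xi> ^ n) z = (L m ^^ n) z - piece_mean ((L m ^^ n) z)" if "n > 0" for n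
    using that
  proof (induction n rule: nat_induct_non_zero)
    case 1
    then show ?case using z by simp
  next
    case (Suc n)
    have "scale_L1 (\<xi> ^ Suc n) z = scale_L1 \<xi> ((L m ^^ n) z - piece_mean ((L m ^^ n) z))"
      using Suc by (metis L1.scale_scale power_Suc)
    also have "\<dots> = (L m ^^ n) (scale_L1 \<xi> z) - piece_mean ((L m ^^ n) (scale_L1 \<xi> z))"
      by (simp add: transfer_power_scale piece_mean_scale L1.scale_right_diff_distrib)
    also have "\<dots> = (L m ^^ n) (L m z) - piece_mean ((L m ^^ n) (L m z))"
      unfolding z transfer_power_diff piece_mean_diff transfer_power_piece_mean by simp
    finally show ?case by (simp add: funpow_Suc_right del: funpow.simps)
  qed
  have le: "(cmod \<xi> / \<rho>) ^ n \<le> 2" if "n > 0" for n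
  proof -
    have "cmod \<xi> ^ n * norm z = norm ((L m ^^ n) z - piece_mean ((L m ^^ n) z))"
      using pow[OF that] by (metis norm_scale_L1 norm_power)
    also have "\<dots> \<le> 2 * norm ((L m ^^ n) z)"
      using norm_triangle_ineq4[of "(L m ^^ n) z" "piece_mean ((L m ^^ n) z)"] norm_piece_mean_le[of "(L m ^^ n) z"] by simp
    also have "\<dots> \<le> 2 * (\<rho> ^ n * norm z)"
      using norm_transfer_power_le[OF M(1)] M(2) by simp
    finally have "cmod \<xi> ^ n \<le> 2 * \<rho> ^ n" using \<open>z \<noteq> 0\<close> by simp
    then show ?thesis using M(2) by (simp add: power_divide divide_le_eq)
  qed
  have "1 < cmod \<xi> / \<rho>" using M by simp
  then obtain n where n: "2 < (cmod \<xi> / \<rho>) ^ n" using real_arch_pow by blast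
  then have "n > 0" by (cases n) auto
  then show False using le[of n] n by linarith
qed

text \<open>
With \<open>v = R (D\<^sup>r g)\<close>, that is \<open>\<xi> v - M v = D\<^sup>r g\<close> for \<open>M = L (k + r)\<close>, the candidate is
\<open>S g = (g + L k (E (1 - Q) v)) / \<xi>\<close>. Its \<open>r\<close>-th derivative is \<open>(\<xi> v - M Q v) / \<xi>\<close>, which differs from \<open>v\<close>
by a piecewise constant function. Therefore the oscillation of \<open>S g\<close> is \<open>E (1 - Q) v\<close>, and
\<open>\<xi> S g - T (S g) = g\<close>.
\<close>

lemma resolvent_off_disc:
  fixes \<xi> :: complex
  assumes m: "k + r = Suc q" and \<xi>: "inverse (min_slope f N J) ^ q < cmod \<xi>"
  shows "\<xi> \<in> op_resolvent_set (sobolev N J r) (sobolev_norm N J r) (\<lambda>h. L k (oscillation r h))"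
proof -
  let ?V = "sobolev N J r" and ?nrm = "sobolev_norm N J r" and ?D = "weak_deriv N J r"
  let ?M = "L (k + r)" and ?Q = piece_mean and ?E = "primitive ^^ r"
  let ?T = "\<lambda>h. L k (oscillation r h)"
  define \<rho> where "\<rho> = inverse (min_slope f N J) ^ q"
  have \<rho>: "0 < \<rho>" "\<rho> < cmod \<xi>" using min_slope_gt_1 \<xi> by (auto simp: \<rho>_def)
  have M: "norm (?M u) \<le> \<rho> * norm u" for u unfolding m \<rho>_def by (rule norm_transfer_Suc_le)
  have \<xi>0: "\<xi> \<noteq> 0" using \<rho> by auto
  note V = subspace_sobolev[of r]
  from resolvent_of_contraction[of ?M, OF transfer_add transfer_scale M \<rho>(2) less_imp_le[OF \<rho>(1)]]
  obtain R where R: "\<And>g. scale_L1 \<xi> (R g) - ?M (R g) = g"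
    "\<And>g g'. R (g + g') = R g + R g'" "\<And>c g. R (scale_L1 c g) = scale_L1 c (R g)"
    "\<And>g. norm (R g) \<le> 1 / (cmod \<xi> - \<rho>) * norm g" by blast
  define lift where "lift u = ?E (u - ?Q u)" for u
  have lift_add: "lift (u + v) = lift u + lift v" for u v
  proof -
    have "(u + v) - (?Q u + ?Q v) = (u - ?Q u) + (v - ?Q v)" by simp
    then show ?thesis unfolding lift_def piece_mean_add by (simp only: primitive_power_add)
  qed
  have lift_scale: "lift (scale_L1 c u) = scale_L1 c (lift u)" for c u
    unfolding lift_def piece_mean_scale
    by (simp only: primitive_power_scale L1.scale_right_diff_distrib[symmetric])
  have osc: "oscillation r h = lift (?D h)" for h by (simp add: oscillation_def lift_def)
  have liftV: "lift u \<in> ?V" for u unfolding lift_def by (rule primitive_power_sobolev)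
  note linL = bounded_op_on_linear[OF bounded_op_on_transfer[of r k]]
  have D_L_lift: "?D (L k (lift u)) = ?M (u - ?Q u)" for u
    using transfer_has_weak_deriv[OF sobolev_has_weak_deriv[OF liftV, of r], of k u]
    by (simp add: weak_deriv_eq) (simp add: lift_def weak_deriv_primitive_power)
  have LliftV: "L k (lift u) \<in> ?V" for u using L1.linear_op_onD(1)[OF linL liftV] .
  define S where "S g = scale_L1 (1 / \<xi>) (g + L k (lift (R (?D g))))" for g
  have SV: "S g \<in> ?V" if "g \<in> ?V" for g
    unfolding S_def using that L1.subspace_scale[OF V] L1.subspace_add[OF V] LliftV by blast
  have DS: "?D (S g) = scale_L1 (1 / \<xi>) (?D g + ?M (R (?D g) - ?Q (R (?D g))))" if "g \<in> ?V" for g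
    unfolding S_def
    using weak_deriv_scale_sobolev[OF L1.subspace_add[OF V that LliftV]] weak_deriv_add_sobolev[OF that LliftV] D_L_lift by simp
  have osc_S: "oscillation r (S g) = lift (R (?D g))" if g: "g \<in> ?V" for g
  proof -
    let ?v = "R (?D g)"
    have "?D g + ?M (?v - ?Q ?v) = scale_L1 \<xi> ?v - ?M (?Q ?v)"
      using R(1)[of "?D g"] by (simp add: transfer_diff algebra_simps)
    then have DS': "?D (S g) = scale_L1 (1 / \<xi>) (scale_L1 \<xi> ?v - ?M (?Q ?v))" using DS[OF g] by simp
    have "?D (S g) - ?Q (?D (S g)) = scale_L1 (1 / \<xi>) (scale_L1 \<xi> (?v - ?Q ?v))"
      unfolding DS' piece_mean_scale piece_mean_diff piece_mean_transfer_piece_mean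
      by (simp add: L1.scale_right_diff_distrib)
    also have "\<dots> = ?v - ?Q ?v" using \<xi>0 by simp
    finally show ?thesis by (simp add: oscillation_def lift_def)
  qed
  have right: "scale_L1 \<xi> (S g) - ?T (S g) = g" if "g \<in> ?V" for g
    unfolding osc_S[OF that] using \<xi>0 by (simp add: S_def)
  \<comment> \<open>Together with surjectivity, injectivity makes \<open>S\<close> a left inverse as well.\<close>
  have inj: "d = 0" if d: "d \<in> ?V" "scale_L1 \<xi> d = ?T d" for d
  proof -
    define z where "z = ?D d - ?Q (?D d)"
    have "scale_L1 \<xi> (?D d) = ?D (scale_L1 \<xi> d)" by (rule weak_deriv_scale_sobolev[OF d(1), symmetric])
    also have "\<dots> = ?M z" unfolding d(2) osc D_L_lift z_def ..
    finally have *: "scale_L1 \<xi> (?D d) = ?M z" .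
    have "scale_L1 \<xi> z = ?M z - ?Q (?M z)"
      unfolding z_def L1.scale_right_diff_distrib
      using * piece_mean_scale[of \<xi> "?D d"] by (simp add: z_def)
    then have "z = 0" by (rule no_large_eigenvalue_mod_constants[OF M \<rho>])
    then have "oscillation r d = 0" by (simp add: oscillation_def z_def primitive_power_zero)
    then have "scale_L1 \<xi> d = 0" using d(2) transfer_scale[of k 0 0] by simp
    then show ?thesis using \<xi>0 by simp
  qed
  have linS: "L1.linear_op_on ?V S"
    unfolding L1.linear_op_on_def
  proof (intro conjI ballI allI)
    show "S g \<in> ?V" if "g \<in> ?V" for g by (rule SV[OF that])
    show "S (g + g') = S g + S g'" if "g \<in> ?V" "g' \<in> ?V" for g g'
      unfolding S_def weak_deriv_add_sobolev[OF that] R(2) lift_add transfer_add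
      by (simp add: L1.scale_right_distrib)
    show "S (scale_L1 c g) = scale_L1 c (S g)" if "g \<in> ?V" for c g
      unfolding S_def weak_deriv_scale_sobolev[OF that] R(3) lift_scale transfer_scale
      by (simp add: L1.scale_right_distrib mult.commute)
  qed
  have linT: "L1.linear_op_on ?V ?T"
    using linL linear_oscillation[of r] oscillation_sobolev by (auto simp: L1.linear_op_on_def)
  have left: "S (scale_L1 \<xi> h - ?T h) = h" if h: "h \<in> ?V" for h
  proof -
    let ?g = "scale_L1 \<xi> h - ?T h"
    have g: "?g \<in> ?V"
      using L1.subspace_diff[OF V L1.subspace_scale[OF V h] L1.linear_op_onD(1)[OF linT h]] .
    have swap: "a - x = b - y" if "a - b = x - y" for a b x y :: L1
      using that by (simp add: algebra_simps)
    have "scale_L1 \<xi> (S ?g - h) = ?T (S ?g) - ?T h"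
      unfolding L1.scale_right_diff_distrib by (rule swap[OF right[OF g]])
    also have "\<dots> = ?T (S ?g - h)"
      using L1.linear_op_on_diff[OF linT V SV[OF g] h] by (rule sym)
    finally have "scale_L1 \<xi> (S ?g - h) = ?T (S ?g - h)" .
    then have "S ?g - h = 0" by (rule inj[OF L1.subspace_diff[OF V SV[OF g] h]])
    then show ?thesis by simp
  qed
  have "bounded_op_on ?V ?nrm S"
  proof -
    obtain C where C: "C \<ge> 0" "\<And>h. h \<in> ?V \<Longrightarrow> ?nrm (L k h) \<le> C * ?nrm h"
      using bounded_op_on_bound[OF bounded_op_on_transfer seminorm_on_sobolev] by metis
    define K where "K = C * (real (Suc r) * (2 * (1 / (cmod \<xi> - \<rho>))))"
    have snorm: "?nrm (h + h') \<le> ?nrm h + ?nrm h'" "?nrm (scale_L1 c h) = cmod c * ?nrm h" if "h \<in> ?V" "h' \<in> ?V" for c h h'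
      using seminorm_on_sobolev[of r] that by (auto simp: seminorm_on_def)
    show ?thesis
    proof (rule bounded_op_onI[OF linS])
      fix g assume g: "g \<in> ?V"
      have "?nrm (L k (lift (R (?D g)))) \<le> C * ?nrm (lift (R (?D g)))" by (rule C(2)[OF liftV])
      also have "\<dots> \<le> C * (real (Suc r) * (2 * norm (R (?D g))))"
        unfolding lift_def by (intro mult_left_mono sobolev_norm_lift_le C(1))
      also have "\<dots> \<le> C * (real (Suc r) * (2 * (1 / (cmod \<xi> - \<rho>) * norm (?D g))))"
        using R(4) C(1) by (intro mult_left_mono) auto
      also have "\<dots> = K * norm (?D g)" by (simp add: K_def)
      also have "\<dots> \<le> K * ?nrm g"
        using C(1) \<rho> norm_weak_deriv_le by (intro mult_left_mono) (auto simp: K_def)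
      finally have "?nrm (L k (lift (R (?D g)))) \<le> K * ?nrm g" .
      then have "?nrm (g + L k (lift (R (?D g)))) \<le> ?nrm g + K * ?nrm g"
        using snorm(1)[OF g LliftV[of "R (?D g)"]] by linarith
      then have "cmod (1 / \<xi>) * ?nrm (g + L k (lift (R (?D g)))) \<le> cmod (1 / \<xi>) * (?nrm g + K * ?nrm g)"
        by (intro mult_left_mono) auto
      then show "?nrm (S g) \<le> (cmod (1 / \<xi>) * (1 + K)) * ?nrm g"
        unfolding S_def using snorm(2)[OF L1.subspace_add[OF V g LliftV] g] by (simp add: algebra_simps)
    qed
  qed
  then show ?thesis unfolding op_resolvent_set_def using left right by blast
qed

lemma spectral_radius_complement:
  assumes "r \<ge> 1"
  shows "op_spectral_radius (sobolev N J r) (sobolev_norm N J r) (\<lambda>h. L k (h - (h - oscillation r h)))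
     \<le> ereal (min_slope f N J powi (- (int k + int r - 1)))"
proof -
  obtain q where q: "k + r = Suc q" using assms by (cases "k + r") auto
  have "min_slope f N J powi (- (int k + int r - 1)) = inverse (min_slope f N J) ^ q"
  proof -
    have "int k + int r - 1 = int q" using q by linarith
    then show ?thesis by (simp add: power_int_minus power_inverse)
  qed
  moreover have "cmod \<xi> \<le> inverse (min_slope f N J) ^ q"
    if "\<xi> \<in> op_spectrum (sobolev N J r) (sobolev_norm N J r) (\<lambda>h. L k (oscillation r h))" for \<xi>
    using that resolvent_off_disc[OF q, of \<xi>] unfolding op_spectrum_def by force
  ultimately show ?thesis unfolding op_spectral_radius_def by (intro SUP_least) auto
qed

lemma spectrum_piecewise_poly:
  shows "op_spectrum (piecewise_poly N J r) (sobolev_norm N J r) (L k) =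
      (\<Union>l\<le>r. spectrum (weighted_adjacency f N J (k + l)))"
    and "op_multiplicity (piecewise_poly N J r) (L k) \<xi> =
      (\<Sum>l\<le>r. Polynomial.order \<xi> (char_poly (weighted_adjacency f N J (k + l))))"
proof -
  let ?U = "piecewise_poly N J r"
  have UV: "?U \<subseteq> sobolev N J r" using piecewise_poly_iff by blast
  obtain ds where ds: "L1.triangular_flag (L k) ds ?U"
    "\<And>\<xi>. count_list ds \<xi> = (\<Sum>l\<le>r. Polynomial.order \<xi> (char_poly (weighted_adjacency f N J (k + l))))"
    using triangular_flag_piecewise_poly by blast
  have bd: "bounded_op_on ?U (sobolev_norm N J r) (L k)"
    using bounded_op_on_transfer[of r k] UV transfer_piecewise_poly unfolding bounded_op_on_def by (meson subsetD)
  have sn: "seminorm_on ?U (sobolev_norm N J r)"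
    using seminorm_on_sobolev[of r] UV unfolding seminorm_on_def by (meson subsetD)
  have "\<xi> \<in> set ds \<longleftrightarrow> \<xi> \<in> (\<Union>l\<le>r. spectrum (weighted_adjacency f N J (k + l)))" for \<xi>
  proof -
    have "char_poly (weighted_adjacency f N J m) \<noteq> 0" for m
      using degree_monic_char_poly[OF weighted_adjacency_carrier, of m] by auto
    then have "\<xi> \<in> spectrum (weighted_adjacency f N J m) \<longleftrightarrow>
        Polynomial.order \<xi> (char_poly (weighted_adjacency f N J m)) \<noteq> 0" for m
      unfolding spectrum_root_char_poly[OF weighted_adjacency_carrier] using order_root by auto
    then show ?thesis using count_list_0_iff[of ds \<xi>] ds(2)[of \<xi>] by auto
  qed
  then show "op_spectrum ?U (sobolev_norm N J r) (L k) = (\<Union>l\<le>r. spectrum (weighted_adjacency f N J (k + l)))"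
    using op_spectrum_triangular_flag[OF ds(1) bd sn] by blast
  show "op_multiplicity ?U (L k) \<xi> = (\<Sum>l\<le>r. Polynomial.order \<xi> (char_poly (weighted_adjacency f N J (k + l))))"
    using op_multiplicity_triangular_flag[OF ds(1) bounded_op_on_linear[OF bd]] ds(2) by simp
qed

end


theorem theorem2p4:
  fixes f :: "real \<Rightarrow> real" and N :: nat and J :: "nat \<Rightarrow> real set" and k r :: nat
  assumes "pa_expanding_markov f N J"
    and "r \<ge> 1"
  shows "(\<exists>P. projector_onto (sobolev N J r) (sobolev_norm N J r) (piecewise_poly N J r) P \<and>
            op_spectral_radius (sobolev N J r) (sobolev_norm N J r)
                (\<lambda>h. transfer_op f N J k (h - P h))
              \<le> ereal (min_slope f N J powi (- (int k + int r - 1)))) \<and>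
         op_spectrum (piecewise_poly N J r) (sobolev_norm N J r) (transfer_op f N J k) =
           (\<Union>l\<le>r. spectrum (weighted_adjacency f N J (k + l))) \<and>
         (\<forall>\<xi> \<in> op_spectrum (piecewise_poly N J r) (sobolev_norm N J r) (transfer_op f N J k).
            op_multiplicity (piecewise_poly N J r) (transfer_op f N J k) \<xi> =
              (\<Sum>l\<le>r. Polynomial.order \<xi> (char_poly (weighted_adjacency f N J (k + l)))))"
proof -
  interpret markov_map f N J by (unfold_locales) (rule assms(1))
  show ?thesis
    using projector_piecewise_poly spectral_radius_complement[OF assms(2)] spectrum_piecewise_poly by blast
qed

end
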